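(* Let $\psi:[0,1]\to\mathbb{R}$ be positive and twice continuously differentiable on $[0,1]$, and let $\vartheta=\int_0^1\sqrt{\psi(t)}\,dt$. Let $B$ be the standard Brownian bridge on $[0,1]$. Then, as $\varepsilon\to0+$, $$ \mathsf{P}\{\|B\|_\psi\leq\varepsilon\}\sim \frac{2\sqrt{2}\,\psi^{1/8}(0)\,\psi^{1/8}(1)}{\sqrt{\pi\vartheta}} \exp\left(-\frac{\vartheta^2}{8}\varepsilon^{-2}\right). $$
   Context: For a process $X(t)$, $0\le t\le 1$, and a non-negative weight $\psi$ on $[0,1]$, $\|X\|_\psi=\left(\int_0^1X^2(t)\psi(t)\,dt\right)^{1/2}$. The standard Brownian bridge $B$ is the centered continuous Gaussian process on $[0,1]$ with covariance $\min(s,t)-st$. The notation $f(\varepsilon)\sim g(\varepsilon)$ means $f(\varepsilon)/g(\varepsilon)\to1$. $\psi^{a}(t)$ means $(\psi(t))^{a}$. *)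

theory Defs
  imports "HOL-Probability.Probability" "HOL-Library.Landau_Symbols"
begin

text \<open>
  The normal distribution on the line with mean \<open>\<mu>\<close> and standard deviation \<open>\<sigma> \<ge> 0\<close>. For
  \<open>\<sigma> = 0\<close> the library's \<open>normal_density\<close> is identically \<open>0\<close>, so the point mass at \<open>\<mu>\<close> is
  given separately; it is needed because a Brownian bridge is degenerate at the end points.
\<close>

definition normal_distribution :: "real \<Rightarrow> real \<Rightarrow> real measure" where
  "normal_distribution \<mu> \<sigma> =
     (if \<sigma> = 0 then return borel \<mu> else density lborel (normal_density \<mu> \<sigma>))"

text \<open>
  Joint normality of the finite-dimensional distributions, stated as normality (possibly
  degenerate) of all finite linear combinations.
\<close>

definition gaussian_process :: "'a measure \<Rightarrow> real set \<Rightarrow> (real \<Rightarrow> 'a \<Rightarrow> real) \<Rightarrow> bool" where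
  "gaussian_process M T X \<longleftrightarrow>
     (\<forall>t\<in>T. X t \<in> borel_measurable M) \<and>
     (\<forall>F c. finite F \<and> F \<subseteq> T \<longrightarrow>
        (\<exists>\<mu> \<sigma>. 0 \<le> \<sigma> \<and>
           distr M borel (\<lambda>\<omega>. \<Sum>t\<in>F. c t * X t \<omega>) = normal_distribution \<mu> \<sigma>))"

text \<open>Only the values \<open>B t\<close> with \<open>0 \<le> t \<le> 1\<close> are constrained.\<close>

locale brownian_bridge = prob_space M
  for M :: "'a measure" and B :: "real \<Rightarrow> 'a \<Rightarrow> real" +
  assumes gaussian: "gaussian_process M {0..1} B"
    and continuous_paths: "\<And>\<omega>. \<omega> \<in> space M \<Longrightarrow> continuous_on {0..1} (\<lambda>t. B t \<omega>)"
    and centered: "\<And>t. t \<in> {0..1} \<Longrightarrow> expectation (B t) = 0"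
    and covariance: "\<And>s t. s \<in> {0..1} \<Longrightarrow> t \<in> {0..1} \<Longrightarrow>
      expectation (\<lambda>\<omega>. (B s \<omega> - expectation (B s)) * (B t \<omega> - expectation (B t))) = min s t - s * t"

definition weighted_norm :: "(real \<Rightarrow> real) \<Rightarrow> (real \<Rightarrow> real) \<Rightarrow> real" where
  "weighted_norm \<psi> x = sqrt (LINT t:{0..1}|lborel. (x t)\<^sup>2 * \<psi> t)"

text \<open>Derivatives at boundary points of \<open>S\<close> are taken within \<open>S\<close>, i.e. one-sided for an interval.\<close>

definition twice_continuously_differentiable_on :: "(real \<Rightarrow> real) \<Rightarrow> real set \<Rightarrow> bool" where
  "twice_continuously_differentiable_on f S \<longleftrightarrow>
     (\<exists>f' f''. (\<forall>x\<in>S. (f has_real_derivative f' x) (at x within S)) \<and>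
               (\<forall>x\<in>S. (f' has_real_derivative f'' x) (at x within S)) \<and>
               continuous_on S f'')"

end

theory Submission
  imports Defs
begin

text \<open>
  Write \<open>Q\<close> for the integral of \<open>(B t)\<^sup>2\<close> and \<open>Q\<psi>\<close> for that of \<open>(B t)\<^sup>2 * \<psi> t\<close>. On a grid, the
  Laplace transform of a weighted sum of squares of the bridge is \<open>1 / sqrt u\<close>, where \<open>u\<close> solves a
  discrete Sturm--Liouville recursion. The Liouville substitution, with \<open>a = \<psi> powr (1 / 4)\<close> as
  amplitude and the integral of \<open>a\<^sup>2\<close> as clock, can be carried out exactly on the grid. It changes the
  weight \<open>2 * l * \<psi>\<close> into the constant \<open>2 * l * \<theta>\<^sup>2\<close> plus a potential that does not depend on \<open>l\<close>.
  In the limit of fine grids,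
  \<open>E (exp (- l * Q\<psi>)) = sqrt (a 0 * a 1 / \<theta>) * E (exp (R - l * \<theta>\<^sup>2 * Q))\<close> with \<open>\<bar>R\<bar> \<le> K * Q\<close>, for all large \<open>l\<close>.
  By uniqueness of Laplace transforms the law of \<open>Q\<psi>\<close> is that of \<open>\<theta>\<^sup>2 * Q\<close> with density
  \<open>sqrt (a 0 * a 1 / \<theta>) * exp R\<close>; on the event \<open>\<theta>\<^sup>2 * Q \<le> \<epsilon>\<^sup>2\<close> the factor \<open>exp R\<close> tends to \<open>1\<close>. This
  leaves the constant weight, for which \<open>E (exp (- a\<^sup>2 * Q / 2)) = sqrt (a / sinh a)\<close> is expanded in powers of
  \<open>exp (- 2 * a)\<close> and inverted term by term; the first term dominates.
\<close>

section \<open>Expectations of Gaussian exponentials on a grid\<close>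

text \<open>The probabilities are of size \<open>exp (- c / \<epsilon>\<^sup>2)\<close>. At this
  scale, asymptotics of a Laplace transform determine by Tauberian arguments only the logarithm of a
  probability, not the probability up to a factor tending to 1. Hence transforms are matched
  exactly, and the potential stays inside the expectation as a density. The potential may have
  either sign, while the grid formula wants non-negative weights; therefore \<open>l\<close> has to
  be large.

  Origin of the constants: at \<open>k\<^sup>2 / 2\<close> the transform of the distribution
  function of \<open>Q\<close> is \<open>2 / k\<^sup>2 * sqrt (k / sinh k)\<close>, which is about
  \<open>2 * sqrt 2 * k powr (- 3 / 2) * exp (- k / 2)\<close>. The first term of the series has the
  transform \<open>sqrt pi * k powr (- 3 / 2) * exp (- k / 2)\<close>, so it enters with the factor
  \<open>2 * sqrt 2 / sqrt pi\<close>. That term behaves like \<open>exp (- 1 / (8 * x))\<close>,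
  taken at \<open>x = \<epsilon>\<^sup>2 / \<theta>\<^sup>2\<close>. The factor
  \<open>sqrt (a 0 * a 1 / \<theta>)\<close> compares initial slope and end value of the recursion
  before and after the substitution.\<close>

lemma integral_cos_normal_distribution:
  "(LINT x|normal_distribution 0 \<sigma>. cos (x * s + y)) = cos y * exp (- (\<sigma> * s)\<^sup>2 / 2)"
  if "0 \<le> \<sigma>"
proof (cases "\<sigma> = 0")
  case True
  then show ?thesis by (simp add: normal_distribution_def integral_return)
next
  case False
  then have [arith]: "0 < \<sigma>" using that by simp
  interpret S: prob_space std_normal_distribution
    by (rule prob_space_normal_density) simp
  have N: "normal_distribution 0 \<sigma> = distr std_normal_distribution borel (\<lambda>x. \<sigma> * x)"
  proof -
    have "distributed std_normal_distribution lborel (\<lambda>x. x) std_normal_density"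
      unfolding distributed_def by (auto simp: distr_id2)
    from S.normal_density_affine[OF this, of \<sigma> 0]
    have "distributed std_normal_distribution lborel (\<lambda>x. \<sigma> * x) (normal_density 0 \<sigma>)" by simp
    then have "distr std_normal_distribution lborel (\<lambda>x. \<sigma> * x) = density lborel (normal_density 0 \<sigma>)"
      by (simp add: distributed_def)
    then show ?thesis using False by (simp add: normal_distribution_def cong: distr_cong)
  qed
  \<comment> \<open>The characteristic function is real, so the sine averages to \<open>0\<close>
    and the phase \<open>y\<close> contributes only \<open>cos y\<close>.\<close>
  have c: "(CLINT x|std_normal_distribution. iexp (\<sigma> * s * x)) = of_real (exp (- (\<sigma> * s)\<^sup>2 / 2))"
    using fun_cong[OF char_std_normal_distribution, of "\<sigma> * s"] by (simp add: char_def)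
  have i: "complex_integrable std_normal_distribution (\<lambda>x. iexp (\<sigma> * s * x))"
    by (rule S.integrable_const_bound[where B=1]) auto
  have re: "(LINT x|std_normal_distribution. cos (\<sigma> * s * x)) = exp (- (\<sigma> * s)\<^sup>2 / 2)"
    using integral_Re[OF i] c by (simp add: Re_exp)
  have im: "(LINT x|std_normal_distribution. sin (\<sigma> * s * x)) = 0"
    using integral_Im[OF i] c by (simp add: Im_exp)
  have "(LINT x|normal_distribution 0 \<sigma>. cos (x * s + y)) =
        (LINT x|std_normal_distribution. cos (\<sigma> * s * x) * cos y - sin (\<sigma> * s * x) * sin y)"
    unfolding N by (subst integral_distr) (auto simp: cos_add ac_simps)
  also have "\<dots> = (LINT x|std_normal_distribution. cos (\<sigma> * s * x)) * cos y -
      (LINT x|std_normal_distribution. sin (\<sigma> * s * x)) * sin y"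
  proof (subst Bochner_Integration.integral_diff)
    show "integrable std_normal_distribution (\<lambda>x. cos (\<sigma> * s * x) * cos y)"
      by (intro integrable_mult_left S.integrable_const_bound[where B=1]) auto
    show "integrable std_normal_distribution (\<lambda>x. sin (\<sigma> * s * x) * sin y)"
      by (intro integrable_mult_left S.integrable_const_bound[where B=1]) auto
  qed auto
  finally show ?thesis by (simp add: re im)
qed

text \<open>\<open>gaussian_process\<close> asserts only that some \<open>\<mu>\<close> and
  \<open>\<sigma>\<close> exist; these moments identify them from the expectation and the
  covariance.\<close>

lemma normal_distribution_moments:
  assumes "0 \<le> \<sigma>"
  shows "integrable (normal_distribution \<mu> \<sigma>) (\<lambda>x. x\<^sup>2)"
    and "(LINT x|normal_distribution \<mu> \<sigma>. x) = \<mu>"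
    and "(LINT x|normal_distribution \<mu> \<sigma>. x\<^sup>2) = \<mu>\<^sup>2 + \<sigma>\<^sup>2"
proof -
  have "integrable (normal_distribution \<mu> \<sigma>) (\<lambda>x. x\<^sup>2) \<and> (LINT x|normal_distribution \<mu> \<sigma>. x) = \<mu> \<and>
    (LINT x|normal_distribution \<mu> \<sigma>. x\<^sup>2) = \<mu>\<^sup>2 + \<sigma>\<^sup>2"
  proof (cases "\<sigma> = 0")
    case True
    interpret R: prob_space "return borel \<mu>" by (rule prob_space_return) simp
    have "integrable (return borel \<mu>) (\<lambda>x. x\<^sup>2)"
      by (rule R.integrable_const_bound[where B="\<mu>\<^sup>2"]) (auto simp: AE_return)
    then show ?thesis using True by (simp add: normal_distribution_def integral_return)
  next
    case False
    then have p [arith]: "0 < \<sigma>" using assms by simp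
    have e: "normal_density \<mu> \<sigma> x * x\<^sup>2 = normal_density \<mu> \<sigma> x * (x - \<mu>)^2 +
        (2 * \<mu> * (normal_density \<mu> \<sigma> x * x) - \<mu>\<^sup>2 * normal_density \<mu> \<sigma> x)" for x
      by (simp add: power2_eq_square algebra_simps)
    note i = integrable_normal_moment[OF p, of \<mu> 2] integrable_normal_moment_nz_1[OF p, of \<mu>]
      integrable_normal_density[OF p, of \<mu>]
    have v: "(LINT x|lborel. normal_density \<mu> \<sigma> x * (x - \<mu>)^2) = \<sigma>\<^sup>2"
      using integral_normal_moment_even[OF p, of \<mu> 1] by (simp add: eval_nat_numeral)
    have "integrable lborel (\<lambda>x. normal_density \<mu> \<sigma> x * x\<^sup>2)"
      unfolding e using i by auto
    moreover have "(LINT x|lborel. normal_density \<mu> \<sigma> x * x\<^sup>2) = \<mu>\<^sup>2 + \<sigma>\<^sup>2"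
      unfolding e using i v p integral_normal_moment_nz_1[OF p, of \<mu>]
      by (subst Bochner_Integration.integral_add, simp, simp, subst Bochner_Integration.integral_diff)
        (auto simp: power2_eq_square)
    ultimately show ?thesis using p integral_normal_moment_nz_1[OF p, of \<mu>]
      by (simp add: normal_distribution_def integral_density integrable_density)
  qed
  then show "integrable (normal_distribution \<mu> \<sigma>) (\<lambda>x. x\<^sup>2)"
    and "(LINT x|normal_distribution \<mu> \<sigma>. x) = \<mu>"
    and "(LINT x|normal_distribution \<mu> \<sigma>. x\<^sup>2) = \<mu>\<^sup>2 + \<sigma>\<^sup>2" by auto
qed

section \<open>Moments and linear combinations of the bridge\<close>

context brownian_bridge
begin

lemma measurable_B [measurable]: "t \<in> {0..1} \<Longrightarrow> B t \<in> borel_measurable M"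
  using gaussian by (auto simp: gaussian_process_def)

text \<open>The Bochner integral of a non-integrable function is \<open>0\<close>, so the covariance
  identity by itself gives no integrability. It is taken from the normal law of the single value
  \<open>B t\<close>.\<close>

lemma square_integrable_B: "t \<in> {0..1} \<Longrightarrow> integrable M (\<lambda>\<omega>. (B t \<omega>)\<^sup>2)"
proof -
  assume t: "t \<in> {0..1}"
  then have "\<exists>\<mu> \<sigma>. 0 \<le> \<sigma> \<and> distr M borel (\<lambda>\<omega>. \<Sum>r\<in>{t}. 1 * B r \<omega>) = normal_distribution \<mu> \<sigma>"
    using gaussian unfolding gaussian_process_def by (elim conjE allE[of _ "{t}"] allE[of _ "\<lambda>_. 1"]) auto
  then obtain \<mu> \<sigma> where s: "0 \<le> \<sigma>" and d: "distr M borel (B t) = normal_distribution \<mu> \<sigma>"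
    by auto
  have "integrable (distr M borel (B t)) (\<lambda>x. x\<^sup>2)"
    unfolding d by (rule normal_distribution_moments[OF s])
  then show ?thesis using t by (subst (asm) integrable_distr_eq) auto
qed

lemma integrable_B_mult: "s \<in> {0..1} \<Longrightarrow> t \<in> {0..1} \<Longrightarrow> integrable M (\<lambda>\<omega>. B s \<omega> * B t \<omega>)"
proof (rule Bochner_Integration.integrable_bound[of M "\<lambda>\<omega>. (B s \<omega>)\<^sup>2 + (B t \<omega>)\<^sup>2"])
  show "AE \<omega> in M. norm (B s \<omega> * B t \<omega>) \<le> norm ((B s \<omega>)\<^sup>2 + (B t \<omega>)\<^sup>2)"
  proof (rule AE_I2)
    fix \<omega>
    have "2 * (\<bar>B s \<omega>\<bar> * \<bar>B t \<omega>\<bar>) \<le> (B s \<omega>)\<^sup>2 + (B t \<omega>)\<^sup>2"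
      using sum_squares_bound[of "\<bar>B s \<omega>\<bar>" "\<bar>B t \<omega>\<bar>"] by simp
    moreover have "0 \<le> \<bar>B s \<omega>\<bar> * \<bar>B t \<omega>\<bar>" by simp
    ultimately have "\<bar>B s \<omega>\<bar> * \<bar>B t \<omega>\<bar> \<le> (B s \<omega>)\<^sup>2 + (B t \<omega>)\<^sup>2" by linarith
    then show "norm (B s \<omega> * B t \<omega>) \<le> norm ((B s \<omega>)\<^sup>2 + (B t \<omega>)\<^sup>2)"
      by (simp add: abs_mult)
  qed
qed (auto intro!: square_integrable_B Bochner_Integration.integrable_add)

lemma integrable_B: "t \<in> {0..1} \<Longrightarrow> integrable M (B t)"
  by (rule square_integrable_imp_integrable) (auto intro: square_integrable_B)

lemma expectation_B_mult: "s \<in> {0..1} \<Longrightarrow> t \<in> {0..1} \<Longrightarrow> expectation (\<lambda>\<omega>. B s \<omega> * B t \<omega>) = min s t - s * t"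
  using covariance[of s t] by (simp add: centered)

text \<open>The linear combination is normal, its mean vanishes, and its variance is the covariance
  form of the coefficients; the expectation is then the real part of its characteristic function at
  \<open>1\<close>.\<close>

lemma expectation_cos_lincomb:
  fixes \<tau> :: "'i \<Rightarrow> real"
  assumes I: "finite I" and \<tau>: "\<And>i. i \<in> I \<Longrightarrow> \<tau> i \<in> {0..1}"
  shows "expectation (\<lambda>\<omega>. cos (\<Sum>i\<in>I. c i * B (\<tau> i) \<omega>)) =
    exp (- (\<Sum>i\<in>I. \<Sum>j\<in>I. c i * c j * (min (\<tau> i) (\<tau> j) - \<tau> i * \<tau> j)) / 2)"
proof -
  define X where "X \<omega> = (\<Sum>i\<in>I. c i * B (\<tau> i) \<omega>)" for \<omega>
  \<comment> \<open>\<open>gaussian_process\<close> speaks of sums over sets of times, so the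
    coefficients of all indices with the same time are collected.\<close>
  define d where "d t = (\<Sum>i\<in>{i\<in>I. \<tau> i = t}. c i)" for t
  have X: "X = (\<lambda>\<omega>. \<Sum>t\<in>\<tau>`I. d t * B t \<omega>)"
  proof
    fix \<omega> show "X \<omega> = (\<Sum>t\<in>\<tau>`I. d t * B t \<omega>)"
      unfolding X_def sum.image_gen[OF I, of _ \<tau>] d_def sum_distrib_right
      by (intro sum.cong) auto
  qed
  have "finite (\<tau>`I) \<and> \<tau>`I \<subseteq> {0..1}" using I \<tau> by blast
  then have "\<exists>\<mu> \<sigma>. 0 \<le> \<sigma> \<and> distr M borel X = normal_distribution \<mu> \<sigma>"
    using gaussian unfolding gaussian_process_def X by blast
  then obtain \<mu> \<sigma> where s: "0 \<le> \<sigma>" and D: "distr M borel X = normal_distribution \<mu> \<sigma>" by blast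
  have Xm [measurable]: "X \<in> borel_measurable M"
    unfolding X_def using \<tau> by (intro borel_measurable_sum borel_measurable_times measurable_B) auto
  have "expectation X = (\<Sum>i\<in>I. c i * expectation (B (\<tau> i)))"
    unfolding X_def using \<tau> integrable_B by (subst Bochner_Integration.integral_sum) auto
  then have "expectation X = 0" using centered \<tau> by simp
  moreover have "expectation X = (LINT x|distr M borel X. x)" by (subst integral_distr) auto
  ultimately have \<mu>: "\<mu> = 0" using normal_distribution_moments(2)[OF s] D by simp
  have "expectation (\<lambda>\<omega>. (X \<omega>)\<^sup>2) =
      expectation (\<lambda>\<omega>. \<Sum>i\<in>I. \<Sum>j\<in>I. c i * c j * (B (\<tau> i) \<omega> * B (\<tau> j) \<omega>))"
    by (rule Bochner_Integration.integral_cong)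
       (simp_all add: X_def power2_eq_square sum_product mult_ac)
  also have "\<dots> = (\<Sum>i\<in>I. \<Sum>j\<in>I. c i * c j * (min (\<tau> i) (\<tau> j) - \<tau> i * \<tau> j))"
    using \<tau> by (subst Bochner_Integration.integral_sum)
      (auto intro!: integrable_B_mult sum.cong Bochner_Integration.integrable_sum integrable_mult_right
        simp: Bochner_Integration.integral_sum expectation_B_mult integrable_B_mult)
  finally have V: "expectation (\<lambda>\<omega>. (X \<omega>)\<^sup>2) =
      (\<Sum>i\<in>I. \<Sum>j\<in>I. c i * c j * (min (\<tau> i) (\<tau> j) - \<tau> i * \<tau> j))" .
  have "expectation (\<lambda>\<omega>. (X \<omega>)\<^sup>2) = (LINT x|distr M borel X. x\<^sup>2)" by (subst integral_distr) auto
  then have \<sigma>: "\<sigma>\<^sup>2 = (\<Sum>i\<in>I. \<Sum>j\<in>I. c i * c j * (min (\<tau> i) (\<tau> j) - \<tau> i * \<tau> j))"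
    using V normal_distribution_moments(3)[OF s, of \<mu>] D \<mu> by simp
  have "expectation (\<lambda>\<omega>. cos (X \<omega>)) = (LINT x|distr M borel X. cos (x * 1 + 0))"
    by (subst integral_distr) auto
  also have "\<dots> = exp (- \<sigma>\<^sup>2 / 2)" unfolding D \<mu> integral_cos_normal_distribution[OF s] by simp
  finally show ?thesis unfolding \<sigma> X_def .
qed

end

section \<open>The exponential of a weighted sum of squares at grid points\<close>

lemma integral_std_normal_exp_quadratic:
  assumes "0 \<le> (q::real)"
  shows "(LINT x|std_normal_distribution. exp (- (2 * p * x + q * x\<^sup>2) / 2)) =
    exp (p\<^sup>2 / (1 + q) / 2) / sqrt (1 + q)"
proof -
  \<comment> \<open>Completing the square: the product of the two exponentials is a multiple of the
    normal density with variance \<open>1 / (1 + q)\<close> and mean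
    \<open>- p / (1 + q)\<close>.\<close>
  define \<sigma> where "\<sigma> = 1 / sqrt (1 + q)"
  define m where "m = - p / (1 + q)"
  have s: "0 < \<sigma>" "\<sigma>\<^sup>2 = 1 / (1 + q)" using assms by (auto simp: \<sigma>_def power_divide)
  have e: "std_normal_density x * exp (- (2 * p * x + q * x\<^sup>2) / 2) =
     exp (p\<^sup>2 / (1 + q) / 2) * \<sigma> * normal_density m \<sigma> x" for x
  proof -
    have *: "- x\<^sup>2 / 2 + - (2 * p * x + q * x\<^sup>2) / 2 = p\<^sup>2 / (1 + q) / 2 + - (x - m)\<^sup>2 / (2 * \<sigma>\<^sup>2)"
    proof -
      define r where "r = 1 + q"
      have r: "r \<noteq> 0" "q = r - 1" using assms by (auto simp: r_def)
      show ?thesis unfolding s m_def unfolding r_def[symmetric] using r(1)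
        by (simp add: r(2) field_simps power2_eq_square)
    qed
    have "std_normal_density x * exp (- (2 * p * x + q * x\<^sup>2) / 2) =
       exp (- x\<^sup>2 / 2 + - (2 * p * x + q * x\<^sup>2) / 2) / sqrt (2 * pi)"
      unfolding std_normal_density_def exp_add by simp
    also have "\<dots> = exp (p\<^sup>2 / (1 + q) / 2) * \<sigma> * normal_density m \<sigma> x"
      unfolding * exp_add normal_density_def using s(1) by (simp add: real_sqrt_mult)
    finally show ?thesis .
  qed
  have "(LINT x|std_normal_distribution. exp (- (2 * p * x + q * x\<^sup>2) / 2)) =
     (LINT x|lborel. std_normal_density x * exp (- (2 * p * x + q * x\<^sup>2) / 2))"
    by (subst integral_density) auto
  also have "\<dots> = exp (p\<^sup>2 / (1 + q) / 2) * \<sigma>"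
    unfolding e using s by simp
  finally show ?thesis by (simp add: \<sigma>_def)
qed

text \<open>\<open>u\<close> is a polygon with slopes \<open>s\<close> and slope jumps
  \<open>w * u\<close>, a discrete solution of \<open>u'' = w * u\<close>. Non-negative weights make
  it convex, so it never falls below the line of slope 1. This keeps the normalising constants of
  the grid formula positive.\<close>

lemma recursion_pos:
  fixes u s t w :: "nat \<Rightarrow> real"
  assumes "u 0 = 0" "s 0 = 1"
    and "\<And>k. k < m \<Longrightarrow> u (Suc k) = u k + (t (Suc k) - t k) * s k"
    and "\<And>k. k < m \<Longrightarrow> s (Suc k) = s k + w (Suc k) * u (Suc k)"
    and "\<And>k. k < m \<Longrightarrow> t k < t (Suc k)" and "\<And>k. 1 \<le> k \<Longrightarrow> k \<le> m \<Longrightarrow> 0 \<le> w k"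
  shows "0 \<le> u m" "1 \<le> s m" "0 < m \<Longrightarrow> 0 < u m"
proof -
  have "0 \<le> u k \<and> 1 \<le> s k \<and> (0 < k \<longrightarrow> 0 < u k)" if "k \<le> m" for k
    using that
  proof (induction k)
    case 0
    then show ?case using assms(1,2) by simp
  next
    case (Suc k)
    then have IH: "0 \<le> u k" "1 \<le> s k" and km: "k < m" by auto
    have "0 < (t (Suc k) - t k) * s k"
      using assms(5)[OF km] IH by (intro mult_pos_pos) auto
    then have p: "0 < u (Suc k)" using assms(3)[OF km] IH by simp
    then have "0 \<le> w (Suc k) * u (Suc k)" using assms(6)[of "Suc k"] Suc.prems by simp
    then show ?case using p assms(4)[OF km] IH by simp
  qed
  from this[of m] show "0 \<le> u m" "1 \<le> s m" "0 < m \<Longrightarrow> 0 < u m" by auto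
qed

lemma grid_mono:
  fixes t :: "nat \<Rightarrow> real"
  assumes "\<And>k. k < n \<Longrightarrow> t k < t (Suc k)" "i \<le> j" "j \<le> n"
  shows "t i \<le> t j"
  using assms(2,3)
proof (induction j rule: dec_induct)
  case (step k)
  then show ?case using assms(1)[of k] by simp
qed simp

text \<open>Linearising the square at one more grid point changes the frequency at that point only;
  this is the effect on the covariance form.\<close>

lemma quadratic_form_shift:
  fixes c :: "nat \<Rightarrow> real" and y :: real
  assumes "p \<in> I" "finite I" "\<And>i j. R i j = R j i"
  defines "d \<equiv> \<lambda>k. c k + (if k = p then y else 0)"
  shows "(\<Sum>i\<in>I. \<Sum>j\<in>I. d i * d j * R i j) =
    (\<Sum>i\<in>I. \<Sum>j\<in>I. c i * c j * R i j) + 2 * y * (\<Sum>j\<in>I. c j * R p j) + y\<^sup>2 * (R p p :: real)"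
proof -
  have *: "(\<Sum>j\<in>I. d j * f j) = (\<Sum>j\<in>I. c j * f j) + y * f p" for f :: "nat \<Rightarrow> real"
    unfolding d_def using assms(1,2)
    by (simp add: distrib_right sum.distrib if_distrib[of "\<lambda>x. x * _"] cong: if_cong)
  have "(\<Sum>i\<in>I. \<Sum>j\<in>I. d i * d j * R i j) = (\<Sum>i\<in>I. d i * (\<Sum>j\<in>I. d j * R i j))"
    by (simp add: sum_distrib_left mult.assoc)
  also have "\<dots> = (\<Sum>i\<in>I. c i * (\<Sum>j\<in>I. c j * R i j)) + y * (\<Sum>i\<in>I. c i * R i p)
      + y * (\<Sum>j\<in>I. c j * R p j) + y * (y * R p p)"
    unfolding * by (simp add: distrib_left sum.distrib sum_distrib_left mult_ac)
  also have "(\<Sum>i\<in>I. c i * R i p) = (\<Sum>j\<in>I. c j * R p j)"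
    using assms(3) by simp
  finally show ?thesis
    by (simp add: sum_distrib_left mult_ac power2_eq_square)
qed

context brownian_bridge
begin

text \<open>
  A discrete form of the Gelfand--Yaglom formula. The term carrying the frequencies \<open>c\<close>
  makes the induction possible: the factor \<open>exp (- w * x\<^sup>2 / 2)\<close> added at the next grid point is the
  average of \<open>cos (\<xi> * sqrt w * x)\<close> over a standard normal \<open>\<xi>\<close>.
\<close>
lemma expectation_exp_cos_grid:
  fixes t w u s c :: "nat \<Rightarrow> real"
  assumes u0: "u 0 = 0" and s0: "s 0 = 1"
    and u: "\<And>k. k < n \<Longrightarrow> u (Suc k) = u k + (t (Suc k) - t k) * s k"
    and s: "\<And>k. k < n \<Longrightarrow> s (Suc k) = s k + w (Suc k) * u (Suc k)"
    and t0: "t 0 = 0" and tn: "t n = 1" and t: "\<And>k. k < n \<Longrightarrow> t k < t (Suc k)"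
    and w: "\<And>k. 1 \<le> k \<Longrightarrow> k \<le> n \<Longrightarrow> 0 \<le> w k"
    and m: "m \<le> n" and c: "\<And>k. k < m \<Longrightarrow> c k = 0"
  defines "P \<equiv> \<lambda>m. u m + (1 - t m) * s m" and "A \<equiv> \<lambda>m. u m - t m * s m"
  shows "expectation (\<lambda>\<omega>. exp (- (\<Sum>k=1..m. w k * (B (t k) \<omega>)\<^sup>2) / 2) * cos (\<Sum>k\<le>n. c k * B (t k) \<omega>)) =
    exp (- ((\<Sum>i\<le>n. \<Sum>j\<le>n. c i * c j * (min (t i) (t j) - t i * t j)) +
       A m / P m * (\<Sum>k\<le>n. c k * (1 - t k))\<^sup>2) / 2) / sqrt (P m)"
  \<comment> \<open>\<open>P m\<close> is the value at time \<open>1\<close> of the solution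
    continued from \<open>t m\<close> with the constant slope \<open>s m\<close>, that is, with all
    later weights removed. After tilting by the first \<open>m\<close> weights, times beyond
    \<open>t m\<close> have the covariance \<open>min (t i) (t j) - t i * t j + A m / P m * (1 - t
    i) * (1 - t j)\<close>; this form is valid only there, hence the frequencies below
    \<open>m\<close> vanish. They are generalised because the step changes one of them.\<close>
  using m c
proof (induction m arbitrary: c)
  case 0
  have tmono: "t i \<le> t j" if "i \<le> j" "j \<le> n" for i j
    using that by (intro grid_mono[of n t] t)
  have "t k \<in> {0..1}" if "k \<le> n" for k
    using tmono[of 0 k] tmono[of k n] that t0 tn by simp
  then show ?case
    using expectation_cos_lincomb[of "{..n}" t c] by (simp add: P_def A_def u0 s0 t0)
next
  case (Suc m)
  have tmono: "t i \<le> t j" if "i \<le> j" "j \<le> n" for i j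
    using that by (intro grid_mono[of n t] t)
  have t01: "t k \<in> {0..1}" if "k \<le> n" for k
    using tmono[of 0 k] tmono[of k n] that t0 tn by simp
  have Bk: "B (t k) \<in> borel_measurable M" if "k \<le> n" for k
    by (rule measurable_B[OF t01[OF that]])
  define p where "p = Suc m"
  have pn: "p \<le> n" and mn: "m < n" using Suc.prems by (auto simp: p_def)
  define R where "R i j = min (t i) (t j) - t i * t j" for i j
  define V where "V = (\<Sum>i\<le>n. \<Sum>j\<le>n. c i * c j * R i j)"
  define S where "S = (\<Sum>k\<le>n. c k * (1 - t k))"
  define r where "r = sqrt (w p)"
  have r: "r\<^sup>2 = w p" "0 \<le> w p" using w[of p] pn by (auto simp: r_def p_def)
  have pos: "0 \<le> u k" "1 \<le> s k" "0 < k \<Longrightarrow> 0 < u k" if "k \<le> n" for k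
    using recursion_pos[of u s k t w] u0 s0 u s t w that by auto
  have Ppos: "0 < P k" if "k \<le> n" for k
  proof (cases "k = 0")
    case True then show ?thesis by (simp add: P_def u0 s0 t0)
  next
    case False
    then have "0 < u k" "0 \<le> (1 - t k) * s k" using pos[OF that] t01[OF that] by auto
    then show ?thesis by (simp add: P_def)
  qed
  \<comment> \<open>Under the tilted law, \<open>B (t p)\<close> has variance
    \<open>(1 - t p) * \<beta>\<close> and covariance \<open>\<beta> * S\<close> with the linear
    combination. So \<open>q\<close> is \<open>w p\<close> times a variance, and the Gaussian
    average over \<open>\<xi>\<close> multiplies \<open>P\<close> by \<open>1 + q\<close>.\<close>
  define \<alpha> where "\<alpha> = A m / P m"
  define \<beta> where "\<beta> = u p / P m"
  have P0: "0 < P m" "0 < P p" using Ppos mn pn by auto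
  have \<beta>0: "0 \<le> \<beta>" using pos(1)[OF pn] P0 by (simp add: \<beta>_def)
  have up: "u p = u m + (t p - t m) * s m" and sp: "s p = s m + w p * u p"
    using u[OF mn] s[OF mn] by (auto simp: p_def)
  have \<beta>_eq: "t p + \<alpha> * (1 - t p) = \<beta>"
  proof -
    have "t p * P m + A m * (1 - t p) = u p"
      unfolding P_def A_def up by (simp add: algebra_simps)
    then show ?thesis unfolding \<alpha>_def \<beta>_def using P0 by (simp add: field_simps)
  qed
  define q where "q = w p * (1 - t p) * \<beta>"
  have q0: "0 \<le> q" unfolding q_def using r \<beta>0 t01[OF pn] by simp
  have Pp: "P p = P m + w p * (1 - t p) * u p"
    unfolding P_def sp unfolding up by (simp add: algebra_simps)
  have q1: "1 + q = P p / P m"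
    unfolding q_def \<beta>_def Pp using P0 by (simp add: field_simps)
  have Ap: "A p = A m - t p * w p * u p"
    unfolding A_def sp unfolding up by (simp add: algebra_simps)
  \<comment> \<open>A rank-one update of the covariance, as in the Sherman--Morrison formula. After
    clearing denominators it is a multiple of \<open>\<beta>_eq\<close>.\<close>
  have \<alpha>_eq: "A p / P p = \<alpha> - w p * \<beta>\<^sup>2 / (1 + q)"
  proof -
    have "A m * (1 - t p) - u p + P m * t p = 0"
      unfolding P_def A_def up by (simp add: algebra_simps)
    then have 0: "w p * u p * (A m * (1 - t p) - u p + P m * t p) = 0" by simp
    have "A m * P p - w p * (u p)\<^sup>2 - P m * A p = w p * u p * (A m * (1 - t p) - u p + P m * t p)"
      unfolding Pp Ap by (simp add: algebra_simps power2_eq_square)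
    then have "P m * A p = A m * P p - w p * (u p)\<^sup>2" using 0 by simp
    then have *: "A p = (A m * P p - w p * (u p)\<^sup>2) / P m" using P0 by (simp add: field_simps)
    show ?thesis unfolding q1 \<alpha>_def \<beta>_def unfolding * using P0
      by (simp add: field_simps power2_eq_square)
  qed
  let ?W = "\<lambda>m \<omega>. exp (- (\<Sum>k=1..m. w k * (B (t k) \<omega>)\<^sup>2) / 2)"
  let ?C = "\<lambda>\<omega>. \<Sum>k\<le>n. c k * B (t k) \<omega>"
  interpret N: prob_space std_normal_distribution by (rule prob_space_normal_density) simp
  interpret pair_sigma_finite M std_normal_distribution ..
  interpret MN: pair_prob_space M std_normal_distribution ..
  have Wle: "?W k \<omega> \<le> 1" if "k \<le> n" for k \<omega>
    using w that by (auto intro!: sum_nonneg)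
  have Wm: "(\<lambda>\<omega>. ?W m \<omega>) \<in> borel_measurable M"
    using mn by (intro measurable_compose[OF _ borel_measurable_exp] borel_measurable_divide
      borel_measurable_uminus borel_measurable_sum borel_measurable_times borel_measurable_power
      borel_measurable_const Bk) auto
  have Cm: "?C \<in> borel_measurable M"
    by (intro borel_measurable_sum borel_measurable_times borel_measurable_const Bk) auto
  have Bm: "B (t p) \<in> borel_measurable M" using pn by (rule Bk)
  have norm_id: "normal_distribution 0 1 = std_normal_distribution"
    by (simp add: normal_distribution_def)
  have "expectation (\<lambda>\<omega>. ?W p \<omega> * cos (?C \<omega>)) =
     expectation (\<lambda>\<omega>. ?W m \<omega> * (LINT \<xi>|std_normal_distribution. cos (\<xi> * (r * B (t p) \<omega>) + ?C \<omega>)))"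
  proof (rule Bochner_Integration.integral_cong[OF refl])
    fix \<omega>
    have "?W p \<omega> = ?W m \<omega> * exp (- (r * B (t p) \<omega>)\<^sup>2 / 2)"
      unfolding power_mult_distrib r by (simp add: p_def exp_add[symmetric] add_divide_distrib)
    moreover have "(LINT \<xi>|std_normal_distribution. cos (\<xi> * (r * B (t p) \<omega>) + ?C \<omega>)) =
        cos (?C \<omega>) * exp (- (1 * (r * B (t p) \<omega>))\<^sup>2 / 2)"
      unfolding norm_id[symmetric] by (rule integral_cos_normal_distribution) simp
    ultimately show "?W p \<omega> * cos (?C \<omega>) =
        ?W m \<omega> * (LINT \<xi>|std_normal_distribution. cos (\<xi> * (r * B (t p) \<omega>) + ?C \<omega>))"
      by simp
  qed
  also have "\<dots> = expectation (\<lambda>\<omega>. (LINT \<xi>|std_normal_distribution. ?W m \<omega> * cos (\<xi> * (r * B (t p) \<omega>) + ?C \<omega>)))"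
    by simp
  also have "\<dots> = (LINT \<xi>|std_normal_distribution. expectation (\<lambda>\<omega>. ?W m \<omega> * cos (\<xi> * (r * B (t p) \<omega>) + ?C \<omega>)))"
  proof (rule Fubini_integral[symmetric])
    show "integrable (M \<Otimes>\<^sub>M std_normal_distribution) (\<lambda>(\<omega>, \<xi>). ?W m \<omega> * cos (\<xi> * (r * B (t p) \<omega>) + ?C \<omega>))"
    proof (rule MN.P.integrable_const_bound[where B=1])
      show "AE x in M \<Otimes>\<^sub>M std_normal_distribution.
          norm (case x of (\<omega>, \<xi>) \<Rightarrow> ?W m \<omega> * cos (\<xi> * (r * B (t p) \<omega>) + ?C \<omega>)) \<le> 1"
        using Wle[of m] mn by (intro AE_I2) (auto simp: abs_mult split_beta intro!: mult_le_one)
      note [measurable] = Wm Cm Bm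
      show "(\<lambda>(\<omega>, \<xi>). ?W m \<omega> * cos (\<xi> * (r * B (t p) \<omega>) + ?C \<omega>))
          \<in> borel_measurable (M \<Otimes>\<^sub>M std_normal_distribution)"
        by measurable
    qed
  qed
  also have "\<dots> = (LINT \<xi>|std_normal_distribution. exp (- (V + \<alpha> * S\<^sup>2) / 2) / sqrt (P m) *
      exp (- (2 * (r * S * \<beta>) * \<xi> + q * \<xi>\<^sup>2) / 2))"
  proof (rule Bochner_Integration.integral_cong[OF refl])
    fix \<xi> :: real
    \<comment> \<open>For fixed \<open>\<xi>\<close> the cosine again has a linear combination as
      argument, with the frequency at \<open>p\<close> raised by \<open>\<xi> * r\<close>. As
      \<open>p\<close> is not below \<open>m\<close>, the induction hypothesis still
      applies.\<close>
    define d where "d k = c k + (if k = p then \<xi> * r else 0)" for k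
    have "\<xi> * (r * B (t p) \<omega>) + ?C \<omega> = (\<Sum>k\<le>n. d k * B (t k) \<omega>)" for \<omega>
      unfolding d_def using pn
      by (simp add: distrib_right sum.distrib if_distrib[of "\<lambda>x. x * _"] mult.assoc add.commute cong: if_cong)
    then have "expectation (\<lambda>\<omega>. ?W m \<omega> * cos (\<xi> * (r * B (t p) \<omega>) + ?C \<omega>)) =
       exp (- ((\<Sum>i\<le>n. \<Sum>j\<le>n. d i * d j * R i j) + \<alpha> * (\<Sum>k\<le>n. d k * (1 - t k))\<^sup>2) / 2) / sqrt (P m)"
      unfolding R_def \<alpha>_def
      using Suc.IH[of d] Suc.prems by (simp add: d_def p_def)
    also have "(\<Sum>k\<le>n. d k * (1 - t k)) = S + \<xi> * r * (1 - t p)"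
      unfolding d_def S_def using pn
      by (simp add: distrib_right sum.distrib if_distrib[of "\<lambda>x. x * _"] cong: if_cong)
    also have "(\<Sum>i\<le>n. \<Sum>j\<le>n. d i * d j * R i j) =
        V + 2 * (\<xi> * r) * (\<Sum>j\<le>n. c j * R p j) + (\<xi> * r)\<^sup>2 * R p p"
      unfolding V_def d_def using pn by (intro quadratic_form_shift) (auto simp: R_def)
    \<comment> \<open>Here the vanishing of \<open>c\<close> below \<open>p\<close> enters: for
      \<open>t p \<le> t j\<close> the covariance factors as \<open>t p * (1 - t j)\<close>.\<close>
    also have "(\<Sum>j\<le>n. c j * R p j) = t p * S"
      unfolding S_def sum_distrib_left
    proof (rule sum.cong[OF refl])
      fix j assume "j \<in> {..n}"
      show "c j * R p j = t p * (c j * (1 - t j))"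
      proof (cases "j < p")
        case True
        then show ?thesis using Suc.prems(2)[of j] by (simp add: p_def)
      next
        case False
        then have "t p \<le> t j" using tmono \<open>j \<in> {..n}\<close> by simp
        then show ?thesis by (simp add: R_def algebra_simps)
      qed
    qed
    also have "V + 2 * (\<xi> * r) * (t p * S) + (\<xi> * r)\<^sup>2 * R p p + \<alpha> * (S + \<xi> * r * (1 - t p))\<^sup>2 =
       (V + \<alpha> * S\<^sup>2) + (2 * (r * S * (t p + \<alpha> * (1 - t p))) * \<xi> +
         r\<^sup>2 * (1 - t p) * (t p + \<alpha> * (1 - t p)) * \<xi>\<^sup>2)"
      by (simp add: R_def algebra_simps power2_eq_square)
    also have "\<dots> = (V + \<alpha> * S\<^sup>2) + (2 * (r * S * \<beta>) * \<xi> + q * \<xi>\<^sup>2)"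
      unfolding \<beta>_eq r q_def ..
    finally show "expectation (\<lambda>\<omega>. ?W m \<omega> * cos (\<xi> * (r * B (t p) \<omega>) + ?C \<omega>)) =
      exp (- (V + \<alpha> * S\<^sup>2) / 2) / sqrt (P m) * exp (- (2 * (r * S * \<beta>) * \<xi> + q * \<xi>\<^sup>2) / 2)"
      by (simp add: exp_add[symmetric] add_divide_distrib diff_divide_distrib)
  qed
  also have "\<dots> = exp (- (V + \<alpha> * S\<^sup>2) / 2) / sqrt (P m) * (exp ((r * S * \<beta>)\<^sup>2 / (1 + q) / 2) / sqrt (1 + q))"
    using integral_std_normal_exp_quadratic[OF q0, of "r * S * \<beta>"] by simp
  also have "\<dots> = exp (- (V + \<alpha> * S\<^sup>2) / 2 + (r * S * \<beta>)\<^sup>2 / (1 + q) / 2) / (sqrt (P m) * sqrt (1 + q))"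
    by (simp add: exp_add)
  also have "sqrt (P m) * sqrt (1 + q) = sqrt (P p)"
    unfolding q1 using P0 by (simp add: real_sqrt_mult[symmetric])
  also have "- (V + \<alpha> * S\<^sup>2) / 2 + (r * S * \<beta>)\<^sup>2 / (1 + q) / 2 = - (V + A p / P p * S\<^sup>2) / 2"
    unfolding \<alpha>_eq by (simp add: power_mult_distrib r algebra_simps add_divide_distrib diff_divide_distrib)
  finally show ?case unfolding V_def S_def R_def p_def .
qed

corollary expectation_exp_grid:
  fixes t w u s :: "nat \<Rightarrow> real"
  assumes n: "0 < n" and u0: "u 0 = 0" and s0: "s 0 = 1"
    and u: "\<And>k. k < n \<Longrightarrow> u (Suc k) = u k + (t (Suc k) - t k) * s k"
    and s: "\<And>k. Suc k < n \<Longrightarrow> s (Suc k) = s k + w (Suc k) * u (Suc k)"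
    and t: "t 0 = 0" "t n = 1" "\<And>k. k < n \<Longrightarrow> t k < t (Suc k)"
    and w: "\<And>k. 1 \<le> k \<Longrightarrow> k < n \<Longrightarrow> 0 \<le> w k"
  shows "expectation (\<lambda>\<omega>. exp (- (\<Sum>k=1..<n. w k * (B (t k) \<omega>)\<^sup>2) / 2)) = 1 / sqrt (u n)"
proof -
  \<comment> \<open>The preceding lemma also wants a weight and a slope at the last node. Weight
    \<open>0\<close> there leaves the slope as it was, and at \<open>t n = 1\<close> the slope drops
    out of the result.\<close>
  define s' where "s' k = (if k = n then s (n - 1) else s k)" for k
  define w' where "w' k = (if k = n then 0 else w k)" for k
  have s'_rec: "s' (Suc k) = s' k + w' (Suc k) * u (Suc k)" if "k < n" for k
    using that s[of k] by (cases "Suc k = n") (auto simp: s'_def w'_def)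
  have "(\<Sum>k=1..n. w' k * (B (t k) \<omega>)\<^sup>2) = (\<Sum>k=1..<n. w k * (B (t k) \<omega>)\<^sup>2)" for \<omega>
    using n by (intro sum.mono_neutral_cong_right) (auto simp: w'_def)
  moreover have "expectation (\<lambda>\<omega>. exp (- (\<Sum>k=1..n. w' k * (B (t k) \<omega>)\<^sup>2) / 2) *
      cos (\<Sum>k\<le>n. 0 * B (t k) \<omega>)) =
    exp (- ((\<Sum>i\<le>n. \<Sum>j\<le>n. 0 * 0 * (min (t i) (t j) - t i * t j)) +
       (u n - t n * s' n) / (u n + (1 - t n) * s' n) * (\<Sum>k\<le>n. 0 * (1 - t k))\<^sup>2) / 2) /
       sqrt (u n + (1 - t n) * s' n)"
    by (rule expectation_exp_cos_grid[where s = s' and c = "\<lambda>_. 0"])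
      (use n u0 s0 u s'_rec t w in \<open>auto simp: s'_def w'_def\<close>)
  ultimately show ?thesis using t(2) by simp
qed

end

section \<open>Riemann sums and second differences\<close>

lemma LINT_Icc_eq_integral:
  fixes f :: "real \<Rightarrow> real"
  assumes "continuous_on {a..b} f"
  shows "(LINT t:{a..b}|lborel. f t) = integral {a..b} f"
  using assms by (intro set_borel_integral_eq_integral borel_integrable_atLeastAtMost')

lemma tendsto_floor_div:
  fixes t :: real
  assumes "0 \<le> t"
  shows "(\<lambda>n. (real (nat \<lfloor>real n * t\<rfloor>) + c) / real n) \<longlonglongrightarrow> t"
proof -
  have "(\<lambda>n. (real (nat \<lfloor>real n * t\<rfloor>) + c) / real n - t) \<longlonglongrightarrow> 0"
  proof (rule Lim_null_comparison)
    show "\<forall>\<^sub>F n in sequentially. norm ((real (nat \<lfloor>real n * t\<rfloor>) + c) / real n - t) \<le> (1 + \<bar>c\<bar>) / real n"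
      using eventually_gt_at_top[of 0]
    proof eventually_elim
      case (elim n)
      have "\<bar>real (nat \<lfloor>real n * t\<rfloor>) + c - real n * t\<bar> \<le> 1 + \<bar>c\<bar>"
        using assms by (simp add: of_nat_nat) linarith
      moreover have "(real (nat \<lfloor>real n * t\<rfloor>) + c) / real n - t = (real (nat \<lfloor>real n * t\<rfloor>) + c - real n * t) / real n"
        using elim by (simp add: field_simps)
      ultimately show ?case by (simp add: divide_right_mono)
    qed
    show "(\<lambda>n. (1 + \<bar>c\<bar>) / real n) \<longlonglongrightarrow> 0"
      by (rule lim_const_over_n)
  qed
  then show ?thesis by (rule LIM_zero_cancel)
qed

text \<open>Dominated convergence for step functions. \<open>F\<close> is a triangular array and not
  a sampled function, since the weights and nodes used later depend on \<open>n\<close>; the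
  exceptional point \<open>p\<close> allows for the jump of an indicator.\<close>

lemma riemann_sum_tendsto:
  fixes F :: "nat \<Rightarrow> nat \<Rightarrow> real"
  assumes bnd: "\<And>n k. k < n \<Longrightarrow> \<bar>F n k\<bar> \<le> C"
    and lim: "\<And>t. 0 < t \<Longrightarrow> t < 1 \<Longrightarrow> t \<noteq> p \<Longrightarrow> (\<lambda>n. F n (nat \<lfloor>real n * t\<rfloor>)) \<longlonglongrightarrow> f t"
  shows "(\<lambda>n. (\<Sum>k<n. F n k) / real n) \<longlonglongrightarrow> (LINT t:{0..1}|lborel. f t)"
proof -
  \<comment> \<open>Restricting \<open>f\<close> to the points of assumed convergence makes it a
    limit of measurable step functions; the omitted points form a null set.\<close>
  define g where "g t = indicator ({0<..<1} - {p}) t *\<^sub>R f t" for t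
  define G where "G n t = (\<Sum>k<n. F n k * indicator {real k / real n ..< real (Suc k) / real n} t)" for n t
  have G: "G n t = (if 0 \<le> t \<and> t < 1 then F n (nat \<lfloor>real n * t\<rfloor>) else 0)" if "0 < n" for n t
  proof -
    have *: "t \<in> {real k / real n ..< real (Suc k) / real n} \<longleftrightarrow> 0 \<le> t \<and> k = nat \<lfloor>real n * t\<rfloor>" for k
    proof -
      have "t \<in> {real k / real n ..< real (Suc k) / real n} \<longleftrightarrow> real k \<le> real n * t \<and> real n * t < real k + 1"
        using that by (auto simp: field_simps)
      also have "\<dots> \<longleftrightarrow> \<lfloor>real n * t\<rfloor> = int k"
        by (simp add: floor_eq_iff)
      also have "\<dots> \<longleftrightarrow> 0 \<le> t \<and> k = nat \<lfloor>real n * t\<rfloor>"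
      proof
        assume a: "\<lfloor>real n * t\<rfloor> = int k"
        then have "0 \<le> real n * t" by linarith
        then show "0 \<le> t \<and> k = nat \<lfloor>real n * t\<rfloor>" using a that by (simp add: zero_le_mult_iff)
      qed auto
      finally show ?thesis .
    qed
    have "nat \<lfloor>real n * t\<rfloor> < n \<longleftrightarrow> t < 1" if "0 \<le> t"
    proof -
      have "nat \<lfloor>real n * t\<rfloor> < n \<longleftrightarrow> \<lfloor>real n * t\<rfloor> < int n" using \<open>0 < n\<close> by linarith
      also have "\<dots> \<longleftrightarrow> real n * t < real n * 1" by (simp add: floor_less_iff)
      also have "\<dots> \<longleftrightarrow> t < 1" using \<open>0 < n\<close> by simp
      finally show ?thesis .
    qed
    then show ?thesis unfolding G_def indicator_def *
      by (cases "0 \<le> t") (auto simp: if_distrib[of "\<lambda>x. _ * x"] sum.delta' cong: if_cong)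
  qed
  have Gint: "integral\<^sup>L lborel (G n) = (\<Sum>k<n. F n k) / real n" for n
  proof -
    have "integral\<^sup>L lborel (G n) =
        (\<Sum>k<n. F n k * measure lborel {real k / real n ..< real (Suc k) / real n})"
    proof -
      have "integrable lborel (indicat_real {real k / real n ..< real (Suc k) / real n})" for k
        by (rule integrable_real_indicator) (simp_all add: divide_right_mono)
      then show ?thesis
        unfolding G_def by (subst Bochner_Integration.integral_sum) auto
    qed
    also have "\<dots> = (\<Sum>k<n. F n k) / real n"
      unfolding sum_divide_distrib
      by (rule sum.cong) (simp_all add: divide_right_mono diff_divide_distrib[symmetric])
    finally show ?thesis .
  qed
  have Gm: "G n \<in> borel_measurable lborel" for n unfolding G_def by measurable
  have gl: "(\<lambda>n. indicator ({0<..<1} - {p}) t * G n t) \<longlonglongrightarrow> g t" for t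
  proof (cases "t \<in> {0<..<1} - {p}")
    case True
    then have "(\<lambda>n. F n (nat \<lfloor>real n * t\<rfloor>)) \<longlonglongrightarrow> g t" using lim[of t] by (auto simp: g_def)
    moreover have "\<forall>\<^sub>F n in sequentially. F n (nat \<lfloor>real n * t\<rfloor>) = indicator ({0<..<1} - {p}) t * G n t"
      using eventually_gt_at_top[of "0::nat"] by eventually_elim (use True G in auto)
    ultimately show ?thesis by (rule Lim_transform_eventually)
  qed (simp add: g_def)
  have gm: "g \<in> borel_measurable lborel"
    by (rule borel_measurable_LIMSEQ_real[OF gl]) (use Gm in measurable)
  have "(\<lambda>n. integral\<^sup>L lborel (G n)) \<longlonglongrightarrow> integral\<^sup>L lborel g"
  proof (rule integral_dominated_convergence[OF gm Gm])
    show "integrable lborel (\<lambda>t. C * indicator {0..<1::real} t)" by simp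
    show "AE t in lborel. (\<lambda>n. G n t) \<longlonglongrightarrow> g t"
    proof -
      have "AE t in lborel. t \<noteq> 0 \<and> t \<noteq> p" using AE_lborel_singleton[of 0] AE_lborel_singleton[of p] by simp
      then show ?thesis
      proof eventually_elim
        case (elim t)
        show ?case
        proof (cases "0 < t \<and> t < 1")
          case True
          then show ?thesis using gl[of t] elim by simp
        next
          case False
          have "\<forall>\<^sub>F n in sequentially. 0 = G n t"
            using eventually_gt_at_top[of "0::nat"] by eventually_elim (use False elim G in auto)
          then show ?thesis using False tendsto_const[of 0]
            by (auto simp: g_def intro: Lim_transform_eventually)
        qed
      qed
    qed
    fix n
    show "AE t in lborel. norm (G n t) \<le> C * indicator {0..<1} t"
    proof (rule AE_I2)
      fix t :: real
      show "norm (G n t) \<le> C * indicator {0..<1} t"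
      proof (cases "n = 0")
        case True
        have "0 \<le> C" using bnd[of 0 1] abs_ge_zero[of "F 1 0"] by linarith
        then show ?thesis using True by (simp add: G_def)
      next
        case False
        then have "nat \<lfloor>real n * t\<rfloor> < n" if "0 \<le> t" "t < 1"
        proof -
          have "real n * t < real n" using False that by simp
          then have "\<lfloor>real n * t\<rfloor> < int n" by (simp add: floor_less_iff)
          then show ?thesis using False by linarith
        qed
        then show ?thesis using G[of n t] bnd False by (auto simp: indicator_def)
      qed
    qed
  qed
  also have "integral\<^sup>L lborel g = (LINT t:{0..1}|lborel. f t)"
    unfolding set_lebesgue_integral_def
    by (rule integral_discrete_difference[of "{0,1,p}"]) (auto simp: g_def indicator_def)
  finally show ?thesis unfolding Gint .
qed

text \<open>The mean value theorem is applied to the first difference \<open>b (y + h) - b y\<close>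
  and then to \<open>b'\<close>. Having one exact value of \<open>b''\<close> gives both the uniform
  bound and the limit of the discrete potential.\<close>

lemma second_difference:
  fixes b b' b'' :: "real \<Rightarrow> real"
  assumes b: "\<And>x. x \<in> {0..1} \<Longrightarrow> (b has_real_derivative b' x) (at x within {0..1})"
    and b': "\<And>x. x \<in> {0..1} \<Longrightarrow> (b' has_real_derivative b'' x) (at x within {0..1})"
    and h: "0 < h" and x: "0 \<le> x - h" "x + h \<le> 1"
  shows "\<exists>z. x - h < z \<and> z < x + h \<and> b (x + h) - 2 * b x + b (x - h) = h\<^sup>2 * b'' z"
proof -
  have D: "(b has_real_derivative b' y) (at y)" "(b' has_real_derivative b'' y) (at y)" if "0 < y" "y < 1" for y
    using b[of y] b'[of y] that at_within_Icc_at[of 0 y 1] by auto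
  have cb: "continuous_on {0..1} b"
    by (rule DERIV_continuous_on[OF b])
  have "continuous_on {x - h..x} (\<lambda>y. b (y + h) - b y)"
    using x h by (intro continuous_on_diff continuous_on_compose2[OF cb] continuous_intros) auto
  moreover have "(\<lambda>y. b (y + h) - b y) differentiable at y" if "x - h < y" "y < x" for y
  proof -
    have "0 < y" "y < 1" "0 < y + h" "y + h < 1" using that x h by linarith+
    then have "((\<lambda>y. b (y + h) - b y) has_real_derivative b' (y + h) - b' y) (at y)"
      using D(1)[of y] DERIV_shift[of b "b' (y + h)" y h] D(1)[of "y + h"] by (auto intro!: derivative_eq_intros)
    then show ?thesis
      using real_differentiable_def by blast
  qed
  ultimately obtain l z where z: "x - h < z" "z < x"
    and l: "((\<lambda>y. b (y + h) - b y) has_real_derivative l) (at z)"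
      "(b (x + h) - b x) - (b (x - h + h) - b (x - h)) = (x - (x - h)) * l"
    using MVT[of "x - h" x "\<lambda>y. b (y + h) - b y"] h by force
  have z': "0 < z" "z < 1" "0 < z + h" "z + h < 1" using x h z by linarith+
  then have "((\<lambda>y. b (y + h) - b y) has_real_derivative b' (z + h) - b' z) (at z)"
    using D(1)[of z] DERIV_shift[of b "b' (z + h)" z h] D(1)[of "z + h"] by (auto intro!: derivative_eq_intros)
  then have l': "l = b' (z + h) - b' z" using l(1) DERIV_unique by blast
  obtain y where y: "z < y" "y < z + h" "b' (z + h) - b' z = (z + h - z) * b'' y"
    using MVT2[of z "z + h" b' b''] D(2) z' h by force
  have "b (x + h) - 2 * b x + b (x - h) = h * l" using l(2) by simp
  also have "\<dots> = h\<^sup>2 * b'' y" using y(3) l' by (simp add: power2_eq_square)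
  finally show ?thesis using y z by (intro exI[of _ y]) auto
qed

section \<open>Laplace transform of the unweighted square integral\<close>

lemma continuous_on_Icc_abs_bound:
  fixes g :: "real \<Rightarrow> real"
  assumes "continuous_on {a..b} g"
  shows "\<exists>C. \<forall>x\<in>{a..b}. \<bar>g x\<bar> \<le> C"
  using compact_continuous_image[OF assms compact_Icc, THEN compact_imp_bounded]
  by (simp add: bounded_iff)

lemma riemann_sum_tendsto_continuous:
  fixes g :: "real \<Rightarrow> real"
  assumes g: "continuous_on {0..1} g"
  shows "(\<lambda>n. (\<Sum>k<n. g (real k / real n)) / real n) \<longlonglongrightarrow> (LINT t:{0..1}|lborel. g t)"
proof -
  obtain C where C: "\<bar>g x\<bar> \<le> C" if "x \<in> {0..1}" for x
    using continuous_on_Icc_abs_bound[OF g] by blast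
  show ?thesis
  proof (rule riemann_sum_tendsto[where C=C and p=0])
    show "\<bar>g (real k / real n)\<bar> \<le> C" if "k < n" for n k
      using that by (intro C) auto
    fix t :: real assume t: "0 < t" "t < 1"
    have "(\<lambda>n. real (nat \<lfloor>real n * t\<rfloor>) / real n) \<longlonglongrightarrow> t"
      using tendsto_floor_div[of t 0] t by simp
    then show "(\<lambda>n. g (real (nat \<lfloor>real n * t\<rfloor>) / real n)) \<longlonglongrightarrow> g t"
    proof (rule continuous_on_tendsto_compose[OF g])
      show "\<forall>\<^sub>F n in sequentially. real (nat \<lfloor>real n * t\<rfloor>) / real n \<in> {0..1}"
        using eventually_gt_at_top[of "0::nat"]
      proof eventually_elim
        case (elim n)
        have "real n * t \<le> real n" using t by (intro mult_left_le) auto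
        then have "real (nat \<lfloor>real n * t\<rfloor>) \<le> real n" using t by linarith
        then show ?case using elim by simp
      qed
    qed (use t in auto)
  qed
qed

lemma floor_mult_less: "nat \<lfloor>real n * t\<rfloor> < n" if "0 < n" "0 \<le> t" "t < 1"
proof -
  have "real n * t < real n" using that by simp
  then have "\<lfloor>real n * t\<rfloor> < int n" by (simp add: floor_less_iff)
  then show ?thesis using that by linarith
qed

section \<open>From grids to path integrals\<close>

context brownian_bridge
begin

lemma continuous_path_comp:
  fixes \<sigma> h :: "real \<Rightarrow> real"
  assumes "\<omega> \<in> space M" "continuous_on {0..1} \<sigma>" "\<sigma> ` {0..1} \<subseteq> {0..1}" "continuous_on {0..1} h"
  shows "continuous_on {0..1} (\<lambda>t. h t * (B (\<sigma> t) \<omega>)\<^sup>2)"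
  using assms continuous_on_compose2[OF continuous_paths[OF assms(1)] assms(2,3)]
  by (intro continuous_intros) auto

text \<open>Joint measurability of \<open>B\<close> in time and chance is not among the assumptions.
  Continuity of the paths makes the integral a pointwise limit of Riemann sums, each involving
  finitely many values of \<open>B\<close>.\<close>

lemma measurable_weighted_square_integral:
  fixes \<sigma> h :: "real \<Rightarrow> real"
  assumes \<sigma>: "continuous_on {0..1} \<sigma>" "\<sigma> ` {0..1} \<subseteq> {0..1}" and h: "continuous_on {0..1} h"
  shows "(\<lambda>\<omega>. LINT t:{0..1}|lborel. h t * (B (\<sigma> t) \<omega>)\<^sup>2) \<in> borel_measurable M"
proof (rule borel_measurable_LIMSEQ_real)
  show "(\<lambda>n. (\<Sum>k<n. h (real k / real n) * (B (\<sigma> (real k / real n)) \<omega>)\<^sup>2) / real n) \<longlonglongrightarrow>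
      (LINT t:{0..1}|lborel. h t * (B (\<sigma> t) \<omega>)\<^sup>2)" if "\<omega> \<in> space M" for \<omega>
    by (rule riemann_sum_tendsto_continuous[OF continuous_path_comp[OF that assms]])
  have "B (\<sigma> (real k / real n)) \<in> borel_measurable M" if "k < n" for k n
    using \<sigma>(2) that by (intro measurable_B) (force simp: image_subset_iff)
  then show "(\<lambda>\<omega>. (\<Sum>k<n. h (real k / real n) * (B (\<sigma> (real k / real n)) \<omega>)\<^sup>2) / real n)
      \<in> borel_measurable M" for n
    by (intro borel_measurable_divide borel_measurable_sum borel_measurable_times
      borel_measurable_power borel_measurable_const) auto
qed

text \<open>Path by path the exponents are Riemann sums, and non-negative weights bound the
  exponentials by \<open>1\<close>. Letting \<open>W\<close> and \<open>\<tau>\<close> depend on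
  \<open>n\<close> permits weights tuned to an exact recursion and nodes that only approximate the
  clock \<open>\<sigma>\<close>.\<close>

lemma expectation_exp_grid_tendsto:
  fixes W \<tau> :: "nat \<Rightarrow> nat \<Rightarrow> real" and \<sigma> h :: "real \<Rightarrow> real"
  assumes \<sigma>: "continuous_on {0..1} \<sigma>" "\<sigma> ` {0..1} \<subseteq> {0..1}" and h: "continuous_on {0..1} h"
    and \<tau>: "\<And>n k. k < n \<Longrightarrow> \<tau> n k \<in> {0..1}"
    and W: "\<And>n k. 0 < k \<Longrightarrow> k < n \<Longrightarrow> 0 \<le> W n k" "\<And>n k. 0 < k \<Longrightarrow> k < n \<Longrightarrow> W n k \<le> C"
    and W_lim: "\<And>t. 0 < t \<Longrightarrow> t < 1 \<Longrightarrow> (\<lambda>n. W n (nat \<lfloor>real n * t\<rfloor>)) \<longlonglongrightarrow> h t"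
    and \<tau>_lim: "\<And>t. 0 < t \<Longrightarrow> t < 1 \<Longrightarrow> (\<lambda>n. \<tau> n (nat \<lfloor>real n * t\<rfloor>)) \<longlonglongrightarrow> \<sigma> t"
  shows "(\<lambda>n. expectation (\<lambda>\<omega>. exp (- (\<Sum>k=1..<n. W n k / real n * (B (\<tau> n k) \<omega>)\<^sup>2) / 2))) \<longlonglongrightarrow>
      expectation (\<lambda>\<omega>. exp (- (LINT t:{0..1}|lborel. h t * (B (\<sigma> t) \<omega>)\<^sup>2) / 2))" (is "?lim")
    and "\<omega> \<in> space M \<Longrightarrow> 0 \<le> (LINT t:{0..1}|lborel. h t * (B (\<sigma> t) \<omega>)\<^sup>2)"
proof -
  \<comment> \<open>The sums start at \<open>1\<close> and \<open>W n 0\<close> is uncontrolled, so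
    index \<open>0\<close> is given the value \<open>0\<close>; for fixed \<open>t > 0\<close> the
    floor meets it only finitely often.\<close>
  define F where "F \<omega> n k = (if k = 0 then 0 else W n k * (B (\<tau> n k) \<omega>)\<^sup>2)" for \<omega> n k
  have sum_F: "(\<Sum>k=1..<n. W n k / real n * (B (\<tau> n k) \<omega>)\<^sup>2) = (\<Sum>k<n. F \<omega> n k) / real n" for \<omega> n
    unfolding sum_divide_distrib
    by (rule sum.mono_neutral_cong_left) (auto simp: F_def)
  have F_nonneg: "0 \<le> (\<Sum>k<n. F \<omega> n k) / real n" for \<omega> n
    using W(1) by (auto intro!: sum_nonneg divide_nonneg_nonneg simp: F_def)
  have lim: "(\<lambda>n. (\<Sum>k<n. F \<omega> n k) / real n) \<longlonglongrightarrow> (LINT t:{0..1}|lborel. h t * (B (\<sigma> t) \<omega>)\<^sup>2)"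
    if \<omega>: "\<omega> \<in> space M" for \<omega>
  proof -
    note cont = continuous_paths[OF \<omega>]
    obtain K where K: "\<bar>B x \<omega>\<bar> \<le> K" if "x \<in> {0..1}" for x
      using continuous_on_Icc_abs_bound[OF cont] by blast
    then have "0 \<le> K" using order_trans[OF abs_ge_zero K[of 0]] by simp
    show ?thesis
    proof (rule riemann_sum_tendsto[where C="\<bar>C\<bar> * K\<^sup>2" and p=0])
      fix n k :: nat assume k: "k < n"
      show "\<bar>F \<omega> n k\<bar> \<le> \<bar>C\<bar> * K\<^sup>2"
      proof (cases "k = 0")
        case False
        then have "\<bar>W n k\<bar> \<le> \<bar>C\<bar>" using W[of k n] k by simp
        moreover have "(B (\<tau> n k) \<omega>)\<^sup>2 \<le> K\<^sup>2"
          using K[OF \<tau>[OF k]] by (rule abs_le_square_iff[THEN iffD1, OF order_trans]) simp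
        ultimately show ?thesis using False
          by (auto simp: F_def abs_mult intro!: mult_mono)
      qed (simp add: F_def)
    next
      fix t :: real assume t: "0 < t" "t < 1"
      have B_lim: "(\<lambda>n. B (\<tau> n (nat \<lfloor>real n * t\<rfloor>)) \<omega>) \<longlonglongrightarrow> B (\<sigma> t) \<omega>"
      proof (rule continuous_on_tendsto_compose[OF cont \<tau>_lim[OF t]])
        show "\<sigma> t \<in> {0..1}" using \<sigma>(2) t by (force simp: image_subset_iff)
        show "\<forall>\<^sub>F n in sequentially. \<tau> n (nat \<lfloor>real n * t\<rfloor>) \<in> {0..1}"
          using eventually_gt_at_top[of "0::nat"]
          by eventually_elim (intro \<tau> floor_mult_less, use t in auto)
      qed
      have "(\<lambda>n. W n (nat \<lfloor>real n * t\<rfloor>) * (B (\<tau> n (nat \<lfloor>real n * t\<rfloor>)) \<omega>)\<^sup>2) \<longlonglongrightarrow> h t * (B (\<sigma> t) \<omega>)\<^sup>2"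
        by (intro tendsto_intros W_lim B_lim t)
      moreover have "\<forall>\<^sub>F n in sequentially. W n (nat \<lfloor>real n * t\<rfloor>) * (B (\<tau> n (nat \<lfloor>real n * t\<rfloor>)) \<omega>)\<^sup>2 =
          F \<omega> n (nat \<lfloor>real n * t\<rfloor>)"
      proof -
        obtain N where N: "1 / t < real N" using reals_Archimedean2 by blast
        have "nat \<lfloor>real n * t\<rfloor> \<noteq> 0" if "N \<le> n" for n
        proof -
          have "1 < real N * t" using N t by (simp add: field_simps)
          also have "\<dots> \<le> real n * t" using that t by simp
          finally show ?thesis by linarith
        qed
        then show ?thesis unfolding F_def eventually_sequentially by auto
      qed
      ultimately show "(\<lambda>n. F \<omega> n (nat \<lfloor>real n * t\<rfloor>)) \<longlonglongrightarrow> h t * (B (\<sigma> t) \<omega>)\<^sup>2"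
        by (rule Lim_transform_eventually)
    qed
  qed
  show "\<omega> \<in> space M \<Longrightarrow> 0 \<le> (LINT t:{0..1}|lborel. h t * (B (\<sigma> t) \<omega>)\<^sup>2)"
    by (rule LIMSEQ_le_const[OF lim]) (use F_nonneg in auto)
  have F_meas: "(\<lambda>\<omega>. F \<omega> n k) \<in> borel_measurable M" if "k < n" for n k
  proof -
    have "B (\<tau> n k) \<in> borel_measurable M" by (rule measurable_B[OF \<tau>[OF that]])
    then show ?thesis unfolding F_def by (cases "k = 0") auto
  qed
  show ?lim
    unfolding sum_F
  proof (rule integral_dominated_convergence[where w="\<lambda>_. 1"])
    show "(\<lambda>\<omega>. exp (- (LINT t:{0..1}|lborel. h t * (B (\<sigma> t) \<omega>)\<^sup>2) / 2)) \<in> borel_measurable M"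
      using measurable_weighted_square_integral[OF \<sigma> h] by simp
    show "(\<lambda>\<omega>. exp (- ((\<Sum>k<n. F \<omega> n k) / real n) / 2)) \<in> borel_measurable M" for n
      by (intro measurable_compose[OF _ borel_measurable_exp] borel_measurable_divide
        borel_measurable_uminus borel_measurable_sum borel_measurable_const F_meas) auto
    show "AE \<omega> in M. (\<lambda>n. exp (- ((\<Sum>k<n. F \<omega> n k) / real n) / 2)) \<longlonglongrightarrow>
        exp (- (LINT t:{0..1}|lborel. h t * (B (\<sigma> t) \<omega>)\<^sup>2) / 2)"
      by (intro AE_I2 tendsto_intros lim) auto
    show "AE \<omega> in M. norm (exp (- ((\<Sum>k<n. F \<omega> n k) / real n) / 2)) \<le> 1" for n
      using F_nonneg by (intro AE_I2) (simp del: divide_divide_eq_left)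
  qed simp
qed

text \<open>The weight is perturbed with \<open>n\<close> so that the grid recursion is solved
  exactly by hyperbolic sines; only the elementary limit of \<open>n * sinh (c / n)\<close>
  remains.\<close>

lemma expectation_exp_square_integral:
  assumes \<kappa>: "0 < (\<kappa>::real)"
  shows "expectation (\<lambda>\<omega>. exp (- (\<kappa>\<^sup>2 / 2) * (LINT t:{0..1}|lborel. (B t \<omega>)\<^sup>2))) = sqrt (\<kappa> / sinh \<kappa>)"
proof -
  have sinh_lim: "(\<lambda>n. real n * sinh (c / real n)) \<longlonglongrightarrow> c" for c :: real
  proof (cases "c = 0")
    case False
    have "((\<lambda>x::real. sinh x / x) \<longlongrightarrow> 1) (at 0)"
      using has_field_derivative_sinh[OF DERIV_ident, of "0::real" UNIV] by (simp add: has_field_derivative_iff)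
    moreover have "filterlim (\<lambda>n. c / real n) (at 0) sequentially"
    proof (rule filterlim_atI)
      show "(\<lambda>n. c / real n) \<longlonglongrightarrow> 0" by (rule lim_const_over_n)
      show "\<forall>\<^sub>F n in sequentially. c / real n \<noteq> 0"
        using eventually_gt_at_top[of "0::nat"] by eventually_elim (use False in simp)
    qed
    ultimately have "(\<lambda>n. sinh (c / real n) / (c / real n)) \<longlonglongrightarrow> 1"
      by (rule filterlim_compose)
    then have "(\<lambda>n. c * (sinh (c / real n) / (c / real n))) \<longlonglongrightarrow> c * 1"
      by (intro tendsto_intros)
    then show ?thesis using False by (simp add: mult.commute)
  qed simp
  \<comment> \<open>This is \<open>n\<^sup>2 * (2 * cosh (\<kappa> / n) - 2)\<close>, the value
    dictated by the addition theorem for \<open>sinh\<close>. Written as a square by the half-angle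
    formula it is visibly non-negative and tends to \<open>\<kappa>\<^sup>2\<close>.\<close>
  define W where "W n = (2 * real n * sinh (\<kappa> / 2 / real n))\<^sup>2" for n
  have W_nonneg: "0 \<le> W n" for n by (simp add: W_def)
  have W_lim: "W \<longlonglongrightarrow> \<kappa>\<^sup>2"
    unfolding W_def using tendsto_power[OF tendsto_mult[OF tendsto_const[of 2] sinh_lim[of "\<kappa> / 2"]], of 2]
    by (simp add: mult.assoc)
  then obtain C where C: "W n \<le> C" for n
    using convergent_imp_Bseq[of W] by (auto simp: convergent_def Bseq_def abs_le_iff)
  have lim: "(\<lambda>n. expectation (\<lambda>\<omega>. exp (- (\<Sum>k=1..<n. W n / real n * (B (real k / real n) \<omega>)\<^sup>2) / 2))) \<longlonglongrightarrow>
      expectation (\<lambda>\<omega>. exp (- (LINT t:{0..1}|lborel. \<kappa>\<^sup>2 * (B t \<omega>)\<^sup>2) / 2))"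
  proof (rule expectation_exp_grid_tendsto(1)[where C=C])
    show "(\<lambda>n. real (nat \<lfloor>real n * t\<rfloor>) / real n) \<longlonglongrightarrow> t" if "0 < t" "t < 1" for t
      using tendsto_floor_div[of t 0] that by simp
  qed (use C W_lim W_nonneg in auto)
  have eq: "\<forall>\<^sub>F n in sequentially.
      expectation (\<lambda>\<omega>. exp (- (\<Sum>k=1..<n. W n / real n * (B (real k / real n) \<omega>)\<^sup>2) / 2)) =
      sqrt (real n * sinh (\<kappa> / real n) / sinh \<kappa>)"
    using eventually_gt_at_top[of "0::nat"]
  proof eventually_elim
    case (elim n)
    define \<delta> where "\<delta> = \<kappa> / real n"
    have \<delta>: "0 < \<delta>" "real n * \<delta> = \<kappa>" using elim \<kappa> by (auto simp: \<delta>_def)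
    \<comment> \<open>The denominator normalises the first increment to \<open>1 / n\<close>, that
      is, the initial slope to \<open>1\<close>.\<close>
    define u where "u k = sinh (real k * \<delta>) / (real n * sinh \<delta>)" for k
    define s where "s k = (u (Suc k) - u k) * real n" for k
    have sp: "0 < sinh \<delta>" "0 < sinh \<kappa>" using \<delta> \<kappa> by simp_all
    have "expectation (\<lambda>\<omega>. exp (- (\<Sum>k=1..<n. W n / real n * (B (real k / real n) \<omega>)\<^sup>2) / 2)) = 1 / sqrt (u n)"
    proof (rule expectation_exp_grid[where s=s])
      show "s (Suc k) = s k + W n / real n * u (Suc k)" for k
      proof -
        have W': "W n = (real n)\<^sup>2 * (2 * cosh \<delta> - 2)"
        proof -
          have "cosh \<delta> = 2 * (sinh (\<delta> / 2))\<^sup>2 + 1"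
            using cosh_double[of "\<delta> / 2"] cosh_square_eq[of "\<delta> / 2"] by simp
          then show ?thesis by (simp add: W_def \<delta>_def power_mult_distrib algebra_simps)
        qed
        have "sinh (real (Suc (Suc k)) * \<delta>) + sinh (real k * \<delta>) = 2 * cosh \<delta> * sinh (real (Suc k) * \<delta>)"
          using sinh_add[of "real (Suc k) * \<delta>" \<delta>] sinh_diff[of "real (Suc k) * \<delta>" \<delta>]
          by (simp add: algebra_simps)
        then have "u (Suc (Suc k)) + u k = 2 * cosh \<delta> * u (Suc k)"
          unfolding u_def by (simp add: add_divide_distrib[symmetric])
        then have "u (Suc (Suc k)) - u (Suc k) = u (Suc k) - u k + (2 * cosh \<delta> - 2) * u (Suc k)"
          by (simp add: algebra_simps)
        moreover have "W n / real n = (2 * cosh \<delta> - 2) * real n"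
          unfolding W' using elim by (simp add: power2_eq_square)
        ultimately show ?thesis unfolding s_def by (simp only: distrib_left distrib_right mult_ac)
      qed
    qed (use elim sp in \<open>auto simp: u_def s_def W_def field_simps\<close>)
    also have "u n = sinh \<kappa> / (real n * sinh (\<kappa> / real n))"
      using \<delta> by (simp add: u_def) (simp add: \<delta>_def)
    finally show ?case by (simp add: real_sqrt_divide)
  qed
  have "(\<lambda>n. sqrt (real n * sinh (\<kappa> / real n) / sinh \<kappa>)) \<longlonglongrightarrow> sqrt (\<kappa> / sinh \<kappa>)"
    using \<kappa> by (intro tendsto_intros sinh_lim) auto
  then have "expectation (\<lambda>\<omega>. exp (- (LINT t:{0..1}|lborel. \<kappa>\<^sup>2 * (B t \<omega>)\<^sup>2) / 2)) = sqrt (\<kappa> / sinh \<kappa>)"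
    by (rule LIMSEQ_unique[OF Lim_transform_eventually[OF lim eq]])
  then show ?thesis by (simp add: mult_ac)
qed

end

section \<open>The Liouville substitution\<close>

context brownian_bridge
begin

text \<open>
  A discrete Liouville transformation: in the clock with increments proportional to
  \<open>a k * a (Suc k)\<close>, the solution \<open>u\<close> of the recursion on the uniform grid is
  carried to a solution \<open>a k * u k\<close> of a recursion of the same form.
\<close>
lemma expectation_exp_grid_time_change:
  fixes a w :: "nat \<Rightarrow> real"
  assumes n: "0 < n" and a: "\<And>k. k \<le> n \<Longrightarrow> 0 < a k"
    and w: "\<And>k. 1 \<le> k \<Longrightarrow> k < n \<Longrightarrow> 0 \<le> w k"
  defines "S \<equiv> \<lambda>k. (\<Sum>j<k. a j * a (Suc j)) / real n"
  defines "w' \<equiv> \<lambda>k. S n * (w k / (a k)\<^sup>2 -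
      real n * (1 / a (Suc k) - 2 * (1 / a k) + 1 / a (k - 1)) / a k)"
  assumes w': "\<And>k. 1 \<le> k \<Longrightarrow> k < n \<Longrightarrow> 0 \<le> w' k"
  shows "expectation (\<lambda>\<omega>. exp (- (\<Sum>k=1..<n. w k * (B (real k / real n) \<omega>)\<^sup>2) / 2)) =
    sqrt (a 0 * a n / S n) * expectation (\<lambda>\<omega>. exp (- (\<Sum>k=1..<n. w' k * (B (S k / S n) \<omega>)\<^sup>2) / 2))"
proof -
  define us where "us = rec_nat (0::real, 1::real)
    (\<lambda>k (u, s). (u + s / real n, s + w (Suc k) * (u + s / real n)))"
  define u where "u k = fst (us k)" for k
  define s where "s k = snd (us k)" for k
  have u0: "u 0 = 0" and s0: "s 0 = 1" by (auto simp: u_def s_def us_def)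
  have u_Suc: "u (Suc k) = u k + s k / real n" for k
    by (simp add: u_def s_def us_def split_beta)
  have s_Suc: "s (Suc k) = s k + w (Suc k) * u (Suc k)" for k
    by (simp add: u_def s_def us_def split_beta)
  have E: "expectation (\<lambda>\<omega>. exp (- (\<Sum>k=1..<n. w k * (B (real k / real n) \<omega>)\<^sup>2) / 2)) = 1 / sqrt (u n)"
    by (rule expectation_exp_grid[where u=u and s=s, OF n u0 s0])
      (use n w in \<open>auto simp: u_Suc s_Suc diff_divide_distrib[symmetric] divide_strict_right_mono\<close>)
  have a0: "a k \<noteq> 0" if "k \<le> n" for k using a[OF that] by simp
  have S_Suc: "S (Suc k) - S k = a k * a (Suc k) / real n" for k
    by (simp add: S_def add_divide_distrib)
  have S_less: "S k < S (Suc k)" if "k < n" for k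
  proof -
    have "0 < a k * a (Suc k) / real n" using a[of k] a[of "Suc k"] that n by simp
    then show ?thesis using S_Suc[of k] by linarith
  qed
  have S0: "S 0 = 0" by (simp add: S_def)
  have Sn: "0 < S n"
    unfolding S_def using n a by (intro divide_pos_pos sum_pos mult_pos_pos) auto
  \<comment> \<open>The transformed solution, normalised to have initial slope \<open>1\<close> in
    the clock \<open>S k / S n\<close>.\<close>
  define v where "v k = a 0 / S n * a k * u k" for k
  \<comment> \<open>The slope of \<open>v\<close> in the new clock equals
    \<open>a 0 * n * (u (Suc k) / a k - u k / a (Suc k))\<close>, a discrete Wronskian of
    \<open>u\<close> and \<open>1 / a\<close>. Its increments involve only second differences of
    \<open>u\<close> and of \<open>1 / a\<close>; this is why \<open>w'\<close> contains the second
    difference of \<open>1 / a\<close>.\<close>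
  define r where "r k = a 0 * (s k / a k - u k * (1 / a (Suc k) - 1 / a k) * real n)" for k
  have E': "expectation (\<lambda>\<omega>. exp (- (\<Sum>k=1..<n. w' k * (B (S k / S n) \<omega>)\<^sup>2) / 2)) = 1 / sqrt (v n)"
  proof (rule expectation_exp_grid[OF n])
    show "v 0 = 0" by (simp add: v_def u0)
    show "r 0 = 1" using a0 by (simp add: r_def u0 s0)
    show "S 0 / S n = 0" "S n / S n = 1" using S0 Sn by auto
    show "S k / S n < S (Suc k) / S n" if "k < n" for k
      using S_less[OF that] Sn by (rule divide_strict_right_mono)
    show "0 \<le> w' k" if "1 \<le> k" "k < n" for k using w' that .
    show "v (Suc k) = v k + (S (Suc k) / S n - S k / S n) * r k" if "k < n" for k
    proof -
      have "a k \<noteq> 0" "a (Suc k) \<noteq> 0" using a0[of k] a0[of "Suc k"] that by auto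
      then have "a (Suc k) * (u k + s k / real n) =
          a k * u k + a k * a (Suc k) / real n * (s k / a k - u k * (1 / a (Suc k) - 1 / a k) * real n)"
        using n by (simp add: field_simps)
      then have "a 0 / S n * (a (Suc k) * u (Suc k)) = a 0 / S n * (a k * u k) +
          a 0 / S n * (a k * a (Suc k) / real n * (s k / a k - u k * (1 / a (Suc k) - 1 / a k) * real n))"
        by (simp add: u_Suc distrib_left)
      then show ?thesis
        unfolding diff_divide_distrib[symmetric] S_Suc v_def r_def by (simp add: mult_ac)
    qed
    show "r (Suc k) = r k + w' (Suc k) * v (Suc k)" if "Suc k < n" for k
    proof -
      have nz: "a (Suc k) \<noteq> 0" using a0 that by auto
      have "w' (Suc k) * v (Suc k) = a 0 * a (Suc k) * u (Suc k) * (w (Suc k) / (a (Suc k))\<^sup>2 -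
          real n * (1 / a (Suc (Suc k)) - 2 * (1 / a (Suc k)) + 1 / a k) / a (Suc k))"
        unfolding w'_def v_def using Sn by simp
      also have "\<dots> = a 0 * u (Suc k) * (w (Suc k) / a (Suc k) -
          real n * (1 / a (Suc (Suc k)) - 2 * (1 / a (Suc k)) + 1 / a k))"
        using nz by (simp add: power2_eq_square right_diff_distrib)
      finally have 1: "w' (Suc k) * v (Suc k) = a 0 * u (Suc k) * (w (Suc k) / a (Suc k) -
          real n * (1 / a (Suc (Suc k)) - 2 * (1 / a (Suc k)) + 1 / a k))" .
      define p q x where "p = 1 / a k" and "q = 1 / a (Suc k)" and "x = 1 / a (Suc (Suc k))"
      have uk: "real n * u (Suc k) = real n * u k + s k" using n by (simp add: u_Suc field_simps)
      have "a 0 * (s (Suc k) * q - u (Suc k) * (x - q) * real n) -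
        (a 0 * (s k * p - u k * (q - p) * real n) + a 0 * u (Suc k) * (w (Suc k) * q - real n * (x - 2 * q + p))) =
        a 0 * ((q - p) * (s k + real n * u k - real n * u (Suc k)))"
        unfolding s_Suc by (simp add: algebra_simps)
      also have "\<dots> = 0" using uk by simp
      finally have "a 0 * (s (Suc k) * q - u (Suc k) * (x - q) * real n) =
        a 0 * (s k * p - u k * (q - p) * real n) + a 0 * u (Suc k) * (w (Suc k) * q - real n * (x - 2 * q + p))"
        by simp
      then show ?thesis unfolding 1 unfolding r_def p_def q_def x_def by simp
    qed
  qed
  \<comment> \<open>The comparison of the two end values yields the prefactor.\<close>
  have "u n = v n * (S n / (a 0 * a n))" using a0 Sn by (simp add: v_def)
  then show ?thesis unfolding E E' by (simp add: real_sqrt_mult real_sqrt_divide)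
qed

end

text \<open>The exact discrete substitution forces products of neighbouring values as clock
  increments; by continuity they have the same limit as squares.\<close>

lemma clock_sum_tendsto:
  fixes a :: "real \<Rightarrow> real"
  assumes a: "continuous_on {0..1} a" and t: "0 \<le> t" "t \<le> 1"
  shows "(\<lambda>n. (\<Sum>j<nat \<lfloor>real n * t\<rfloor>. a (real j / real n) * a (real (Suc j) / real n)) / real n)
    \<longlonglongrightarrow> integral {0..t} (\<lambda>s. (a s)\<^sup>2)"
proof -
  obtain C where C: "\<bar>a x\<bar> \<le> C" if "x \<in> {0..1}" for x
    using continuous_on_Icc_abs_bound[OF a] by blast
  have C0: "0 \<le> C" using order_trans[OF abs_ge_zero C[of 0]] by simp
  \<comment> \<open>Cutting the summand off at the upper index gives a Riemann sum over all of
    \<open>{0..1}\<close> whose limit function jumps at \<open>t\<close>, which is therefore the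
    exceptional point.\<close>
  define F where "F n k = (if k < nat \<lfloor>real n * t\<rfloor> then a (real k / real n) * a (real (Suc k) / real n) else 0)" for n k
  have le: "nat \<lfloor>real n * t\<rfloor> \<le> n" for n
  proof -
    have "real n * t \<le> real n" using t by (intro mult_left_le) auto
    then show ?thesis by linarith
  qed
  have "(\<lambda>n. (\<Sum>k<n. F n k) / real n) \<longlonglongrightarrow> (LINT s:{0..1}|lborel. indicator {..<t} s * (a s)\<^sup>2)"
  proof (rule riemann_sum_tendsto[where C="C * C" and p=t])
    fix n k :: nat assume k: "k < n"
    have "real k / real n \<in> {0..1}" "real (Suc k) / real n \<in> {0..1}" using k by auto
    then show "\<bar>F n k\<bar> \<le> C * C"
      using C0 C by (auto simp: F_def abs_mult intro!: mult_mono)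
  next
    fix s :: real assume s: "0 < s" "s < 1" "s \<noteq> t"
    let ?k = "\<lambda>n. nat \<lfloor>real n * s\<rfloor>"
    have s0: "(\<lambda>n. real (?k n) / real n) \<longlonglongrightarrow> s" and s1: "(\<lambda>n. real (Suc (?k n)) / real n) \<longlonglongrightarrow> s"
      using tendsto_floor_div[of s 0] tendsto_floor_div[of s 1] s by (simp_all add: add.commute)
    have t0: "(\<lambda>n. real (nat \<lfloor>real n * t\<rfloor>) / real n) \<longlonglongrightarrow> t"
      using tendsto_floor_div[of t 0] t by simp
    have "(\<lambda>n. a (real (?k n) / real n) * a (real (Suc (?k n)) / real n)) \<longlonglongrightarrow> a s * a s"
    proof (intro tendsto_mult continuous_on_tendsto_compose[OF a s0] continuous_on_tendsto_compose[OF a s1])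
      have k: "?k n < n" if "0 < n" for n using floor_mult_less[OF that, of s] s by simp
      show "\<forall>\<^sub>F n in sequentially. real (?k n) / real n \<in> {0..1}"
        using eventually_gt_at_top[of "0::nat"]
        by eventually_elim (use k in \<open>fastforce intro: less_imp_le\<close>)
      show "\<forall>\<^sub>F n in sequentially. real (Suc (?k n)) / real n \<in> {0..1}"
        using eventually_gt_at_top[of "0::nat"]
      proof eventually_elim
        case (elim n)
        then have "real (Suc (?k n)) \<le> real n" using k[of n] by linarith
        then show ?case using elim by simp
      qed
    qed (use s in auto)
    then have lim: "(\<lambda>n. a (real (?k n) / real n) * a (real (Suc (?k n)) / real n)) \<longlonglongrightarrow> (a s)\<^sup>2"
      by (simp add: power2_eq_square)
    show "(\<lambda>n. F n (?k n)) \<longlonglongrightarrow> indicator {..<t} s * (a s)\<^sup>2"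
    proof (cases "s < t")
      case True
      \<comment> \<open>The midpoint of \<open>s\<close> and \<open>t\<close> separates the two
        rounded nodes for large \<open>n\<close>.\<close>
      have "\<forall>\<^sub>F n in sequentially. real (?k n) / real n < (s + t) / 2"
        using order_tendstoD(2)[OF s0, of "(s + t) / 2"] True by simp
      moreover have "\<forall>\<^sub>F n in sequentially. real (nat \<lfloor>real n * t\<rfloor>) / real n > (s + t) / 2"
        using order_tendstoD(1)[OF t0, of "(s + t) / 2"] True by simp
      ultimately have "\<forall>\<^sub>F n in sequentially. a (real (?k n) / real n) * a (real (Suc (?k n)) / real n) = F n (?k n)"
        using eventually_gt_at_top[of "0::nat"]
      proof eventually_elim
        case (elim n)
        then have "real (?k n) / real n < real (nat \<lfloor>real n * t\<rfloor>) / real n" by linarith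
        then have "?k n < nat \<lfloor>real n * t\<rfloor>" using elim(3) by (simp add: divide_less_cancel)
        then show ?case by (simp add: F_def)
      qed
      with lim have "(\<lambda>n. F n (?k n)) \<longlonglongrightarrow> (a s)\<^sup>2" by (rule Lim_transform_eventually)
      then show ?thesis using True by simp
    next
      case False
      then have "t \<le> s" by simp
      then have "nat \<lfloor>real n * t\<rfloor> \<le> ?k n" for n
        by (intro nat_mono floor_mono mult_left_mono) auto
      then have "F n (?k n) = 0" for n unfolding F_def using leD by metis
      then show ?thesis using False by simp
    qed
  qed
  also have "(\<lambda>n. (\<Sum>k<n. F n k) / real n) =
      (\<lambda>n. (\<Sum>j<nat \<lfloor>real n * t\<rfloor>. a (real j / real n) * a (real (Suc j) / real n)) / real n)"
  proof
    fix n
    have "(\<Sum>k<n. F n k) = (\<Sum>j<nat \<lfloor>real n * t\<rfloor>. a (real j / real n) * a (real (Suc j) / real n))"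
      using le[of n] by (intro sum.mono_neutral_cong_right) (auto simp: F_def)
    then show "(\<Sum>k<n. F n k) / real n =
      (\<Sum>j<nat \<lfloor>real n * t\<rfloor>. a (real j / real n) * a (real (Suc j) / real n)) / real n" by simp
  qed
  also have "(LINT s:{0..1}|lborel. indicator {..<t} s * (a s)\<^sup>2) = (LINT s:{0..t}|lborel. (a s)\<^sup>2)"
    unfolding set_lebesgue_integral_def using t
    by (intro integral_discrete_difference[of "{t}"]) (auto simp: indicator_def)
  also have "\<dots> = integral {0..t} (\<lambda>s. (a s)\<^sup>2)"
    using t by (intro LINT_Icc_eq_integral continuous_intros continuous_on_subset[OF a]) auto
  finally show ?thesis .
qed

text \<open>The weight is \<open>a ^ 4\<close>. Smoothness is asked of \<open>b = 1 / a\<close>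
  because the discrete potential is a second difference of this function. In the old time the new
  weight is \<open>\<theta> * (2 * \<gamma> * (a t)\<^sup>2 - b t * b'' t)\<close>: its first part
  becomes constant in the clock \<open>\<sigma>\<close>, and its second part, free of
  \<open>\<gamma>\<close>, becomes \<open>R\<close>.\<close>

lemma (in brownian_bridge) expectation_exp_time_change:
  fixes a b b' b'' :: "real \<Rightarrow> real"
  assumes a: "continuous_on {0..1} a" and a_pos: "\<And>t. t \<in> {0..1} \<Longrightarrow> 0 < a t"
    and b_eq: "\<And>t. t \<in> {0..1} \<Longrightarrow> b t = 1 / a t"
    and b: "\<And>t. t \<in> {0..1} \<Longrightarrow> (b has_real_derivative b' t) (at t within {0..1})"
    and b': "\<And>t. t \<in> {0..1} \<Longrightarrow> (b' has_real_derivative b'' t) (at t within {0..1})"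
    and b'': "continuous_on {0..1} b''"
  defines "\<theta> \<equiv> integral {0..1} (\<lambda>t. (a t)\<^sup>2)"
  shows "0 < \<theta>"
    and "\<exists>R K \<gamma>\<^sub>0. R \<in> borel_measurable M \<and>
      (\<forall>\<omega>\<in>space M. \<bar>R \<omega>\<bar> \<le> K * (LINT t:{0..1}|lborel. (B t \<omega>)\<^sup>2)) \<and>
      (\<forall>\<gamma>\<ge>\<gamma>\<^sub>0. expectation (\<lambda>\<omega>. exp (- \<gamma> * (LINT t:{0..1}|lborel. (a t)^4 * (B t \<omega>)\<^sup>2))) =
         sqrt (a 0 * a 1 / \<theta>) *
         expectation (\<lambda>\<omega>. exp (R \<omega> - \<gamma> * (\<theta>\<^sup>2 * (LINT t:{0..1}|lborel. (B t \<omega>)\<^sup>2)))))"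
proof -
  obtain A where A: "\<bar>a x\<bar> \<le> A" if "x \<in> {0..1}" for x
    using continuous_on_Icc_abs_bound[OF a] by blast
  have cb: "continuous_on {0..1} b" by (rule DERIV_continuous_on[OF b])
  obtain Cb where Cb: "\<bar>b x\<bar> \<le> Cb" if "x \<in> {0..1}" for x
    using continuous_on_Icc_abs_bound[OF cb] by blast
  obtain Cc where Cc: "\<bar>b'' x\<bar> \<le> Cc" if "x \<in> {0..1}" for x
    using continuous_on_Icc_abs_bound[OF b''] by blast
  have Cb0: "0 < Cb" using Cb[of 0] b_eq[of 0] a_pos[of 0] by (smt (verit) atLeastAtMost_iff divide_pos_pos)
  have Cc0: "0 \<le> Cc" using order_trans[OF abs_ge_zero Cc[of 0]] by simp
  have A0: "0 \<le> A" using order_trans[OF abs_ge_zero A[of 0]] by simp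
  \<comment> \<open>An upper bound of \<open>1 / a\<close> provides the lower bound \<open>m\<close>
    of the square of \<open>a\<close>.\<close>
  define m where "m = (1 / Cb)\<^sup>2"
  have m0: "0 < m" using Cb0 by (simp add: m_def)
  have m: "m \<le> (a t)\<^sup>2" if t: "t \<in> {0..1}" for t
  proof -
    have "1 / a t \<le> Cb" using Cb[OF t] a_pos[OF t] unfolding b_eq[OF t] by simp
    then have "1 / Cb \<le> a t" using Cb0 a_pos[OF t] by (simp add: field_simps)
    then show ?thesis unfolding m_def using Cb0 by (intro power_mono) auto
  qed
  \<comment> \<open>The bound must allow two different arguments, since the second difference yields
    \<open>b''\<close> at a point near the node and not at it.\<close>
  define D where "D = Cb * Cc"
  have D: "\<bar>b s * b'' t\<bar> \<le> D" if "s \<in> {0..1}" "t \<in> {0..1}" for s t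
    unfolding D_def abs_mult using Cb[OF that(1)] Cc[OF that(2)] Cb0 by (intro mult_mono) auto
  have D0: "0 \<le> D" using Cb0 Cc0 by (simp add: D_def)
  have ca2: "continuous_on {0..1} (\<lambda>t. (a t)\<^sup>2)" by (intro continuous_intros a)
  have int_mono: "integral {0..s} (\<lambda>t. (a t)\<^sup>2) \<le> integral {0..t} (\<lambda>t. (a t)\<^sup>2)" if "0 \<le> s" "s \<le> t" "t \<le> 1" for s t
    using that by (intro integral_subset_le integrable_continuous_real continuous_on_subset[OF ca2]) auto
  have "m \<le> \<theta>"
  proof -
    have "integral {0..1::real} (\<lambda>_. m) \<le> \<theta>"
      unfolding \<theta>_def using m by (intro integral_le integrable_continuous_real ca2 continuous_intros) auto
    then show ?thesis by simp
  qed
  with m0 show \<theta>0: "0 < \<theta>" by simp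
  define \<sigma> where "\<sigma> t = integral {0..t} (\<lambda>t. (a t)\<^sup>2) / \<theta>" for t
  have \<sigma>': "(\<sigma> has_real_derivative (a t)\<^sup>2 / \<theta>) (at t within {0..1})" if "t \<in> {0..1}" for t
    unfolding \<sigma>_def by (intro DERIV_cdivide integral_has_real_derivative ca2 that)
  have \<sigma>c: "continuous_on {0..1} \<sigma>" by (rule DERIV_continuous_on[OF \<sigma>'])
  have \<sigma>0: "\<sigma> 0 = 0" and \<sigma>1: "\<sigma> 1 = 1" using \<theta>0 by (auto simp: \<sigma>_def \<theta>_def)
  have \<sigma>im: "\<sigma> ` {0..1} \<subseteq> {0..1}"
  proof
    fix y assume "y \<in> \<sigma> ` {0..1}"
    then obtain t where t: "0 \<le> t" "t \<le> 1" "y = \<sigma> t" by auto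
    have "\<sigma> 0 \<le> \<sigma> t" "\<sigma> t \<le> \<sigma> 1"
      unfolding \<sigma>_def using int_mono[of 0 t] int_mono[of t 1] t \<theta>0 by (auto intro!: divide_right_mono)
    then show "y \<in> {0..1}" using \<sigma>0 \<sigma>1 t by simp
  qed
  define Q where "Q \<omega> = (LINT t:{0..1}|lborel. (B t \<omega>)\<^sup>2)" for \<omega>
  \<comment> \<open>Since \<open>\<sigma>\<close> has derivative
    \<open>(a t)\<^sup>2 / \<theta>\<close>, this part of the transformed weight is constant in the
    new time.\<close>
  have Q_subst: "integral {0..1} (\<lambda>t. (a t)\<^sup>2 * (B (\<sigma> t) \<omega>)\<^sup>2) = \<theta> * Q \<omega>" if \<omega>: "\<omega> \<in> space M" for \<omega>
  proof -
    have c: "continuous_on {0..1} (\<lambda>t. (B t \<omega>)\<^sup>2)" by (intro continuous_intros continuous_paths \<omega>)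
    have "((\<lambda>t. ((a t)\<^sup>2 / \<theta>) *\<^sub>R (B (\<sigma> t) \<omega>)\<^sup>2) has_integral integral {\<sigma> 0..\<sigma> 1} (\<lambda>t. (B t \<omega>)\<^sup>2)) {0..1}"
      by (rule has_integral_substitution[where c=0 and d=1]) (use \<sigma>0 \<sigma>1 \<sigma>im c \<sigma>' in auto)
    then have "((\<lambda>t. \<theta> * (((a t)\<^sup>2 / \<theta>) *\<^sub>R (B (\<sigma> t) \<omega>)\<^sup>2)) has_integral \<theta> * Q \<omega>) {0..1}"
      unfolding \<sigma>0 \<sigma>1 LINT_Icc_eq_integral[OF c, symmetric] Q_def by (rule has_integral_mult_right)
    then show ?thesis using \<theta>0 by (intro integral_unique) simp
  qed
  have cpath: "continuous_on {0..1} (\<lambda>t. h t * (B (\<sigma> t) \<omega>)\<^sup>2)"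
    if "\<omega> \<in> space M" "continuous_on {0..1} h" for \<omega> and h :: "real \<Rightarrow> real"
    by (rule continuous_path_comp[OF that(1) \<sigma>c \<sigma>im that(2)])
  have cbb: "continuous_on {0..1} (\<lambda>t. b t * b'' t)" by (intro continuous_intros cb b'')
  \<comment> \<open>\<open>R\<close> is the potential part of minus half the transformed integral.
    \<open>K\<close> comes from comparing \<open>\<bar>b t * b'' t\<bar>\<close> with
    \<open>D / m * (a t)\<^sup>2\<close>, and \<open>\<gamma>\<^sub>0\<close> is the threshold from
    which \<open>2 * \<gamma> * m\<close> dominates \<open>D\<close>, which makes all transformed
    weights non-negative.\<close>
  define R where "R \<omega> = \<theta> / 2 * (LINT t:{0..1}|lborel. b t * b'' t * (B (\<sigma> t) \<omega>)\<^sup>2)" for \<omega>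
  define K where "K = \<theta> / 2 * (D / m * \<theta>)"
  define \<gamma>\<^sub>0 where "\<gamma>\<^sub>0 = D / (2 * m)"
  have R_meas: "R \<in> borel_measurable M"
    unfolding R_def using measurable_weighted_square_integral[OF \<sigma>c \<sigma>im cbb] by simp
  have R_le: "\<bar>R \<omega>\<bar> \<le> K * Q \<omega>" if \<omega>: "\<omega> \<in> space M" for \<omega>
  proof -
    have "\<bar>LINT t:{0..1}|lborel. b t * b'' t * (B (\<sigma> t) \<omega>)\<^sup>2\<bar> = \<bar>integral {0..1} (\<lambda>t. b t * b'' t * (B (\<sigma> t) \<omega>)\<^sup>2)\<bar>"
      by (subst LINT_Icc_eq_integral[OF cpath[OF \<omega> cbb]]) simp
    also have "\<dots> \<le> integral {0..1} (\<lambda>t. D / m * ((a t)\<^sup>2 * (B (\<sigma> t) \<omega>)\<^sup>2))"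
    proof (rule integral_norm_bound_integral[where 'a=real, unfolded real_norm_def])
      show "(\<lambda>t. b t * b'' t * (B (\<sigma> t) \<omega>)\<^sup>2) integrable_on {0..1}"
        by (intro integrable_continuous_real cpath \<omega> cbb)
      show "(\<lambda>t. D / m * ((a t)\<^sup>2 * (B (\<sigma> t) \<omega>)\<^sup>2)) integrable_on {0..1}"
        by (intro integrable_continuous_real continuous_on_mult continuous_on_const cpath \<omega> ca2)
      fix t :: real assume t: "t \<in> {0..1}"
      have "\<bar>b t * b'' t\<bar> \<le> D / m * m" using D[OF t t] m0 by simp
      also have "\<dots> \<le> D / m * (a t)\<^sup>2" using D0 m0 m[OF t] by (intro mult_left_mono) auto
      finally have "\<bar>b t * b'' t\<bar> * (B (\<sigma> t) \<omega>)\<^sup>2 \<le> D / m * (a t)\<^sup>2 * (B (\<sigma> t) \<omega>)\<^sup>2"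
        by (rule mult_right_mono) simp
      then show "\<bar>b t * b'' t * (B (\<sigma> t) \<omega>)\<^sup>2\<bar> \<le> D / m * ((a t)\<^sup>2 * (B (\<sigma> t) \<omega>)\<^sup>2)"
        by (simp add: abs_mult)
    qed
    also have "\<dots> = D / m * (\<theta> * Q \<omega>)" using Q_subst[OF \<omega>] by simp
    finally have "\<theta> / 2 * \<bar>LINT t:{0..1}|lborel. b t * b'' t * (B (\<sigma> t) \<omega>)\<^sup>2\<bar> \<le>
        \<theta> / 2 * (D / m * (\<theta> * Q \<omega>))"
      using \<theta>0 by (intro mult_left_mono) auto
    then show ?thesis unfolding R_def K_def abs_mult using \<theta>0
      by (simp only: abs_of_pos half_gt_zero mult.assoc)
  qed
  have main: "expectation (\<lambda>\<omega>. exp (- \<gamma> * (LINT t:{0..1}|lborel. (a t)^4 * (B t \<omega>)\<^sup>2))) =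
      sqrt (a 0 * a 1 / \<theta>) * expectation (\<lambda>\<omega>. exp (R \<omega> - \<gamma> * (\<theta>\<^sup>2 * Q \<omega>)))" if \<gamma>: "\<gamma>\<^sub>0 \<le> \<gamma>" for \<gamma>
  proof -
    have \<gamma>0: "0 \<le> \<gamma>" using \<gamma> D0 m0 unfolding \<gamma>\<^sub>0_def by (meson divide_nonneg_pos mult_pos_pos order_trans zero_less_numeral)
    have D\<gamma>: "D \<le> 2 * \<gamma> * (a t)\<^sup>2" if "t \<in> {0..1}" for t
    proof -
      have "D \<le> 2 * \<gamma> * m" using \<gamma> m0 by (simp add: \<gamma>\<^sub>0_def field_simps)
      also have "\<dots> \<le> 2 * \<gamma> * (a t)\<^sup>2" using m[OF that] \<gamma>0 by (intro mult_left_mono) auto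
      finally show ?thesis .
    qed
    define S where "S n k = (\<Sum>j<k. a (real j / real n) * a (real (Suc j) / real n)) / real n" for n k
    define \<Delta> where "\<Delta> n k = (real n)\<^sup>2 * (b (real (Suc k) / real n) - 2 * b (real k / real n) + b (real (k - 1) / real n))" for n k
    \<comment> \<open>\<open>W n k / real n\<close> is the weight that the discrete substitution
      produces from \<open>2 * \<gamma> * (a t) ^ 4 / n\<close> at the node;
      \<open>\<Delta> n k\<close> is the second difference quotient of \<open>b\<close>.\<close>
    define W where "W n k = S n n * (2 * \<gamma> * (a (real k / real n))\<^sup>2 - b (real k / real n) * \<Delta> n k)" for n k
    have grid: "real k / real n \<in> {0..1}" if "k \<le> n" for n k using that by (cases "n = 0") auto
    have \<Delta>: "\<exists>z\<in>{0..1}. \<bar>z - real k / real n\<bar> \<le> 1 / real n \<and> \<Delta> n k = b'' z" if "0 < k" "k < n" for n k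
    proof -
      define h where "h = 1 / real n"
      have h: "0 < h" using that by (simp add: h_def)
      have e: "real (Suc k) / real n = real k / real n + h" "real (k - 1) / real n = real k / real n - h"
        using that by (auto simp: h_def add_divide_distrib diff_divide_distrib of_nat_diff)
      have "0 \<le> real k / real n - h" "real k / real n + h \<le> 1"
        unfolding e[symmetric] using that by auto
      from second_difference[OF b b' h this] obtain z where z: "real k / real n - h < z" "z < real k / real n + h"
        "b (real k / real n + h) - 2 * b (real k / real n) + b (real k / real n - h) = h\<^sup>2 * b'' z" by auto
      have "z \<in> {0..1}" using z \<open>0 \<le> real k / real n - h\<close> \<open>real k / real n + h \<le> 1\<close> by auto
      moreover have "\<Delta> n k = b'' z"
        unfolding \<Delta>_def e z(3) using that by (simp add: h_def power_divide)
      ultimately show ?thesis using z by (intro bexI[of _ z]) (auto simp: h_def abs_le_iff)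
    qed
    have S_pos: "0 < S n n" if "0 < n" for n
      unfolding S_def using that by (intro divide_pos_pos sum_pos mult_pos_pos a_pos grid) auto
    have S_le: "S n n \<le> A * A" if "0 < n" for n
    proof -
      have "(\<Sum>j<n. a (real j / real n) * a (real (Suc j) / real n)) \<le> (\<Sum>j<n. A * A)"
      proof (rule sum_mono)
        fix j assume "j \<in> {..<n}"
        then have "real j / real n \<in> {0..1}" "real (Suc j) / real n \<in> {0..1}" by (auto intro!: grid)
        then show "a (real j / real n) * a (real (Suc j) / real n) \<le> A * A"
          using A a_pos A0 by (intro mult_mono) (auto simp: abs_le_iff less_imp_le)
      qed
      then show ?thesis unfolding S_def using that by (simp add: field_simps)
    qed
    have W_nonneg: "0 \<le> W n k" if k: "0 < k" "k < n" for n k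
    proof -
      obtain z where z: "z \<in> {0..1}" "\<Delta> n k = b'' z" using \<Delta>[OF k] by blast
      have "b (real k / real n) * \<Delta> n k \<le> D" using D[OF grid z(1), of k n] z that by (simp add: abs_le_iff)
      also have "D \<le> 2 * \<gamma> * (a (real k / real n))\<^sup>2" using that by (intro D\<gamma> grid) simp
      finally show ?thesis unfolding W_def using S_pos[of n] that by simp
    qed
    have W_le: "W n k \<le> A * A * (2 * \<gamma> * A\<^sup>2 + D)" if k: "0 < k" "k < n" for n k
    proof -
      obtain z where z: "z \<in> {0..1}" "\<Delta> n k = b'' z" using \<Delta>[OF k] by blast
      have 1: "- (b (real k / real n) * \<Delta> n k) \<le> D" using D[OF grid z(1), of k n] z that by (simp add: abs_le_iff)
      have "(a (real k / real n))\<^sup>2 \<le> A\<^sup>2"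
        using A[OF grid, of k n] that by (intro abs_le_square_iff[THEN iffD1]) auto
      then have "2 * \<gamma> * (a (real k / real n))\<^sup>2 \<le> 2 * \<gamma> * A\<^sup>2" using \<gamma>0 by (intro mult_left_mono) auto
      then have "2 * \<gamma> * (a (real k / real n))\<^sup>2 - b (real k / real n) * \<Delta> n k \<le> 2 * \<gamma> * A\<^sup>2 + D"
        using 1 by linarith
      then have "W n k \<le> S n n * (2 * \<gamma> * A\<^sup>2 + D)"
        unfolding W_def using S_pos[of n] that by (intro mult_left_mono) auto
      also have "\<dots> \<le> A * A * (2 * \<gamma> * A\<^sup>2 + D)"
        using S_le[of n] that \<gamma>0 D0 by (intro mult_right_mono) auto
      finally show ?thesis .
    qed
    have S_lim: "(\<lambda>n. S n n) \<longlonglongrightarrow> \<theta>"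
      using clock_sum_tendsto[OF a, of 1] by (simp add: S_def \<theta>_def)
    have floor_grid: "\<forall>\<^sub>F n in sequentially. 0 < nat \<lfloor>real n * t\<rfloor> \<and> nat \<lfloor>real n * t\<rfloor> < n" if t: "0 < t" "t < 1" for t
    proof -
      obtain N where N: "1 / t < real N" using reals_Archimedean2 by blast
      have "0 < nat \<lfloor>real n * t\<rfloor> \<and> nat \<lfloor>real n * t\<rfloor> < n" if "N \<le> n" for n
      proof -
        have "1 < real N * t" using N t by (simp add: field_simps)
        also have "\<dots> \<le> real n * t" using that t by simp
        finally have "1 < real n * t" .
        moreover from this have "0 < n" using t by (cases n) auto
        ultimately show ?thesis using floor_mult_less[of n t] t by auto
      qed
      then show ?thesis unfolding eventually_sequentially by auto
    qed
    have comp_lim: "(\<lambda>n. g (real (nat \<lfloor>real n * t\<rfloor>) / real n)) \<longlonglongrightarrow> g t"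
      if t: "0 < t" "t < 1" and g: "continuous_on {0..1} g" for t and g :: "real \<Rightarrow> real"
    proof (rule continuous_on_tendsto_compose[OF g])
      show "(\<lambda>n. real (nat \<lfloor>real n * t\<rfloor>) / real n) \<longlonglongrightarrow> t" using tendsto_floor_div[of t 0] t by simp
      show "\<forall>\<^sub>F n in sequentially. real (nat \<lfloor>real n * t\<rfloor>) / real n \<in> {0..1}"
        using floor_grid[OF t] by eventually_elim (intro grid, simp)
    qed (use t in auto)
    have \<Delta>_lim: "(\<lambda>n. \<Delta> n (nat \<lfloor>real n * t\<rfloor>)) \<longlonglongrightarrow> b'' t" if t: "0 < t" "t < 1" for t
    proof -
      \<comment> \<open>One intermediate point is chosen for each \<open>n\<close>. It lies within
        \<open>1 / n\<close> of a node near \<open>t\<close>, so the limit reduces to continuity of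
        \<open>b''\<close>.\<close>
      define z where "z n = (SOME z. z \<in> {0..1} \<and> \<bar>z - real (nat \<lfloor>real n * t\<rfloor>) / real n\<bar> \<le> 1 / real n \<and>
        \<Delta> n (nat \<lfloor>real n * t\<rfloor>) = b'' z)" for n
      have z: "\<forall>\<^sub>F n in sequentially. z n \<in> {0..1} \<and> \<bar>z n - real (nat \<lfloor>real n * t\<rfloor>) / real n\<bar> \<le> 1 / real n \<and>
        \<Delta> n (nat \<lfloor>real n * t\<rfloor>) = b'' (z n)"
        using floor_grid[OF t]
      proof eventually_elim
        case (elim n)
        then have "\<exists>z. z \<in> {0..1} \<and> \<bar>z - real (nat \<lfloor>real n * t\<rfloor>) / real n\<bar> \<le> 1 / real n \<and>
            \<Delta> n (nat \<lfloor>real n * t\<rfloor>) = b'' z"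
          using \<Delta>[of "nat \<lfloor>real n * t\<rfloor>" n] by blast
        then show ?case unfolding z_def by (rule someI_ex)
      qed
      have "(\<lambda>n. z n - real (nat \<lfloor>real n * t\<rfloor>) / real n) \<longlonglongrightarrow> 0"
        by (rule Lim_null_comparison[OF _ lim_const_over_n[of 1]]) (use z in eventually_elim, simp)
      moreover have "(\<lambda>n. real (nat \<lfloor>real n * t\<rfloor>) / real n) \<longlonglongrightarrow> t" using tendsto_floor_div[of t 0] t by simp
      ultimately have "(\<lambda>n. z n - real (nat \<lfloor>real n * t\<rfloor>) / real n + real (nat \<lfloor>real n * t\<rfloor>) / real n) \<longlonglongrightarrow> 0 + t"
        by (rule tendsto_add)
      then have "z \<longlonglongrightarrow> t" by simp
      then have "(\<lambda>n. b'' (z n)) \<longlonglongrightarrow> b'' t"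
        by (rule continuous_on_tendsto_compose[OF b'']) (use t z in \<open>auto elim: eventually_mono\<close>)
      moreover have "\<forall>\<^sub>F n in sequentially. b'' (z n) = \<Delta> n (nat \<lfloor>real n * t\<rfloor>)"
        using z by eventually_elim simp
      ultimately show ?thesis by (rule Lim_transform_eventually)
    qed
    define h where "h t = \<theta> * (2 * \<gamma> * (a t)\<^sup>2 - b t * b'' t)" for t
    have ch: "continuous_on {0..1} h" unfolding h_def by (intro continuous_intros a cb b'')
    have lim2: "(\<lambda>n. expectation (\<lambda>\<omega>. exp (- (\<Sum>k=1..<n. W n k / real n * (B (S n k / S n n) \<omega>)\<^sup>2) / 2))) \<longlonglongrightarrow>
        expectation (\<lambda>\<omega>. exp (- (LINT t:{0..1}|lborel. h t * (B (\<sigma> t) \<omega>)\<^sup>2) / 2))"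
    proof (rule expectation_exp_grid_tendsto(1)[OF \<sigma>c \<sigma>im ch _ W_nonneg W_le])
      show "S n k / S n n \<in> {0..1}" if "k < n" for n k
      proof -
        have "0 \<le> S n k"
          unfolding S_def using that
          by (intro divide_nonneg_nonneg sum_nonneg mult_nonneg_nonneg less_imp_le[OF a_pos] grid) auto
        moreover have "S n k \<le> S n n"
          unfolding S_def using that
          by (intro divide_right_mono sum_mono2 mult_nonneg_nonneg less_imp_le[OF a_pos] grid) auto
        ultimately show ?thesis using S_pos[of n] that by simp
      qed
      fix t :: real assume t: "0 < t" "t < 1"
      show "(\<lambda>n. W n (nat \<lfloor>real n * t\<rfloor>)) \<longlonglongrightarrow> h t"
        unfolding W_def h_def
        by (intro tendsto_intros S_lim \<Delta>_lim comp_lim t a cb)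
      show "(\<lambda>n. S n (nat \<lfloor>real n * t\<rfloor>) / S n n) \<longlonglongrightarrow> \<sigma> t"
        unfolding \<sigma>_def using t \<theta>0 clock_sum_tendsto[OF a, of t]
        by (intro tendsto_divide S_lim) (auto simp: S_def)
    qed auto
    have ca4: "continuous_on {0..1} (\<lambda>t. 2 * \<gamma> * (a t)^4)" by (intro continuous_intros a)
    \<comment> \<open>The side before the substitution, on uniform nodes; the factor
      \<open>2\<close> offsets the halving in the grid formula.\<close>
    have lim1: "(\<lambda>n. expectation (\<lambda>\<omega>. exp (- (\<Sum>k=1..<n. 2 * \<gamma> * (a (real k / real n))^4 / real n * (B (real k / real n) \<omega>)\<^sup>2) / 2))) \<longlonglongrightarrow>
        expectation (\<lambda>\<omega>. exp (- (LINT t:{0..1}|lborel. 2 * \<gamma> * (a t)^4 * (B t \<omega>)\<^sup>2) / 2))"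
    proof (rule expectation_exp_grid_tendsto(1)[OF _ _ ca4, where C="2 * \<gamma> * A^4"])
      show "2 * \<gamma> * (a (real k / real n))^4 \<le> 2 * \<gamma> * A^4" if "k < n" for n k
      proof -
        have "\<bar>a (real k / real n)\<bar>^4 \<le> A^4" using A[OF grid, of k n] that by (intro power_mono) auto
        then show ?thesis using \<gamma>0 by (intro mult_left_mono) (auto simp: power_even_abs)
      qed
      show "(\<lambda>n. 2 * \<gamma> * (a (real (nat \<lfloor>real n * t\<rfloor>) / real n))^4) \<longlonglongrightarrow> 2 * \<gamma> * (a t)^4" if "0 < t" "t < 1" for t
        by (intro tendsto_intros comp_lim that a)
      show "(\<lambda>n. real (nat \<lfloor>real n * t\<rfloor>) / real n) \<longlonglongrightarrow> t" if "0 < t" "t < 1" for t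
        using tendsto_floor_div[of t 0] that by simp
    qed (use \<gamma>0 in \<open>auto intro: continuous_on_id\<close>)
    have eq: "expectation (\<lambda>\<omega>. exp (- (\<Sum>k=1..<n. 2 * \<gamma> * (a (real k / real n))^4 / real n * (B (real k / real n) \<omega>)\<^sup>2) / 2)) =
       sqrt (a 0 * a 1 / S n n) *
       expectation (\<lambda>\<omega>. exp (- (\<Sum>k=1..<n. W n k / real n * (B (S n k / S n n) \<omega>)\<^sup>2) / 2))" if n: "0 < n" for n
    proof -
      have W_eq: "S n n * (2 * \<gamma> * (a (real k / real n))^4 / real n / (a (real k / real n))\<^sup>2 -
          real n * (1 / a (real (Suc k) / real n) - 2 * (1 / a (real k / real n)) + 1 / a (real (k - 1) / real n)) /
          a (real k / real n)) = W n k / real n" if "1 \<le> k" "k < n" for k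
      proof -
        have g: "real (Suc k) / real n \<in> {0..1}" "real k / real n \<in> {0..1}" "real (k - 1) / real n \<in> {0..1}"
          using that by (auto intro!: grid)
        have p: "a (real k / real n) \<noteq> 0" using a_pos[OF g(2)] by simp
        have "2 * \<gamma> * (a (real k / real n))^4 / real n / (a (real k / real n))\<^sup>2 = 2 * \<gamma> * (a (real k / real n))\<^sup>2 / real n"
          using p n by (simp add: field_simps eval_nat_numeral)
        moreover have "real n * (1 / a (real (Suc k) / real n) - 2 * (1 / a (real k / real n)) + 1 / a (real (k - 1) / real n)) /
            a (real k / real n) = b (real k / real n) * \<Delta> n k / real n"
          unfolding \<Delta>_def b_eq[OF g(1)] b_eq[OF g(2)] b_eq[OF g(3)] using n by (simp add: power2_eq_square)
        ultimately show ?thesis unfolding W_def by (simp only: diff_divide_distrib[symmetric] times_divide_eq_right)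
      qed
      have "expectation (\<lambda>\<omega>. exp (- (\<Sum>k=1..<n. 2 * \<gamma> * (a (real k / real n))^4 / real n * (B (real k / real n) \<omega>)\<^sup>2) / 2)) =
        sqrt (a (real 0 / real n) * a (real n / real n) / S n n) *
        expectation (\<lambda>\<omega>. exp (- (\<Sum>k=1..<n. S n n * (2 * \<gamma> * (a (real k / real n))^4 / real n / (a (real k / real n))\<^sup>2 -
          real n * (1 / a (real (Suc k) / real n) - 2 * (1 / a (real k / real n)) + 1 / a (real (k - 1) / real n)) /
          a (real k / real n)) * (B (S n k / S n n) \<omega>)\<^sup>2) / 2))"
        unfolding S_def
      proof (rule expectation_exp_grid_time_change[of n "\<lambda>k. a (real k / real n)"
            "\<lambda>k. 2 * \<gamma> * (a (real k / real n))^4 / real n"], goal_cases)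
        case 1 show ?case by (rule n)
      next
        case (2 k) then show ?case by (intro a_pos grid)
      next
        case (3 k) then show ?case using \<gamma>0 by simp
      next
        case (4 k)
        then show ?case
          unfolding S_def[symmetric] using W_eq[of k] W_nonneg[of k n] by (simp only:) simp
      qed
      also have "(\<lambda>\<omega>. exp (- (\<Sum>k=1..<n. S n n * (2 * \<gamma> * (a (real k / real n))^4 / real n / (a (real k / real n))\<^sup>2 -
          real n * (1 / a (real (Suc k) / real n) - 2 * (1 / a (real k / real n)) + 1 / a (real (k - 1) / real n)) /
          a (real k / real n)) * (B (S n k / S n n) \<omega>)\<^sup>2) / 2)) =
          (\<lambda>\<omega>. exp (- (\<Sum>k=1..<n. W n k / real n * (B (S n k / S n n) \<omega>)\<^sup>2) / 2))"
        by (intro ext arg_cong[where f="\<lambda>x. exp (- x / 2)"] sum.cong refl) (subst W_eq, auto)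
      finally show ?thesis using n by simp
    qed
    have "(\<lambda>n. sqrt (a 0 * a 1 / S n n) *
        expectation (\<lambda>\<omega>. exp (- (\<Sum>k=1..<n. W n k / real n * (B (S n k / S n n) \<omega>)\<^sup>2) / 2))) \<longlonglongrightarrow>
        sqrt (a 0 * a 1 / \<theta>) * expectation (\<lambda>\<omega>. exp (- (LINT t:{0..1}|lborel. h t * (B (\<sigma> t) \<omega>)\<^sup>2) / 2))"
      using \<theta>0 by (intro tendsto_mult lim2 tendsto_real_sqrt tendsto_divide S_lim tendsto_const) auto
    then have "(\<lambda>n. expectation (\<lambda>\<omega>. exp (- (\<Sum>k=1..<n. 2 * \<gamma> * (a (real k / real n))^4 / real n * (B (real k / real n) \<omega>)\<^sup>2) / 2))) \<longlonglongrightarrow>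
        sqrt (a 0 * a 1 / \<theta>) * expectation (\<lambda>\<omega>. exp (- (LINT t:{0..1}|lborel. h t * (B (\<sigma> t) \<omega>)\<^sup>2) / 2))"
      by (rule Lim_transform_eventually)
        (use eventually_gt_at_top[of "0::nat"] in eventually_elim, rule eq[symmetric])
    then have "expectation (\<lambda>\<omega>. exp (- (LINT t:{0..1}|lborel. 2 * \<gamma> * (a t)^4 * (B t \<omega>)\<^sup>2) / 2)) =
        sqrt (a 0 * a 1 / \<theta>) * expectation (\<lambda>\<omega>. exp (- (LINT t:{0..1}|lborel. h t * (B (\<sigma> t) \<omega>)\<^sup>2) / 2))"
      by (rule LIMSEQ_unique[OF lim1])
    also have "expectation (\<lambda>\<omega>. exp (- (LINT t:{0..1}|lborel. h t * (B (\<sigma> t) \<omega>)\<^sup>2) / 2)) =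
        expectation (\<lambda>\<omega>. exp (R \<omega> - \<gamma> * (\<theta>\<^sup>2 * Q \<omega>)))"
    proof (rule Bochner_Integration.integral_cong[OF refl])
      fix \<omega> assume \<omega>: "\<omega> \<in> space M"
      note i = integrable_continuous_real[OF cpath[OF \<omega> ca2]] integrable_continuous_real[OF cpath[OF \<omega> cbb]]
      have "(LINT t:{0..1}|lborel. h t * (B (\<sigma> t) \<omega>)\<^sup>2) =
          integral {0..1} (\<lambda>t. 2 * \<gamma> * \<theta> * ((a t)\<^sup>2 * (B (\<sigma> t) \<omega>)\<^sup>2) - \<theta> * (b t * b'' t * (B (\<sigma> t) \<omega>)\<^sup>2))"
        unfolding LINT_Icc_eq_integral[OF cpath[OF \<omega> ch]] by (simp add: h_def algebra_simps)
      also have "\<dots> = 2 * \<gamma> * \<theta> * (\<theta> * Q \<omega>) - \<theta> * integral {0..1} (\<lambda>t. b t * b'' t * (B (\<sigma> t) \<omega>)\<^sup>2)"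
        using i Q_subst[OF \<omega>] by (subst Henstock_Kurzweil_Integration.integral_diff) (auto intro: integrable_on_mult_right)
      finally have "(LINT t:{0..1}|lborel. h t * (B (\<sigma> t) \<omega>)\<^sup>2) = 2 * \<gamma> * \<theta> * (\<theta> * Q \<omega>) - 2 * R \<omega>"
        unfolding R_def LINT_Icc_eq_integral[OF cpath[OF \<omega> cbb]] by simp
      then show "exp (- (LINT t:{0..1}|lborel. h t * (B (\<sigma> t) \<omega>)\<^sup>2) / 2) = exp (R \<omega> - \<gamma> * (\<theta>\<^sup>2 * Q \<omega>))"
        by (simp add: power2_eq_square)
    qed
    finally show ?thesis by (simp add: mult.assoc)
  qed
  show "\<exists>R K \<gamma>\<^sub>0. R \<in> borel_measurable M \<and>
      (\<forall>\<omega>\<in>space M. \<bar>R \<omega>\<bar> \<le> K * (LINT t:{0..1}|lborel. (B t \<omega>)\<^sup>2)) \<and>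
      (\<forall>\<gamma>\<ge>\<gamma>\<^sub>0. expectation (\<lambda>\<omega>. exp (- \<gamma> * (LINT t:{0..1}|lborel. (a t)^4 * (B t \<omega>)\<^sup>2))) =
         sqrt (a 0 * a 1 / \<theta>) *
         expectation (\<lambda>\<omega>. exp (R \<omega> - \<gamma> * (\<theta>\<^sup>2 * (LINT t:{0..1}|lborel. (B t \<omega>)\<^sup>2)))))"
    using R_meas R_le main unfolding Q_def by blast
qed

section \<open>Uniqueness of Laplace transforms\<close>

text \<open>On \<open>{-1..1}\<close> the moments are bounded by \<open>1\<close>, so the Taylor
  remainder of the characteristic function is at most \<open>2 * \<bar>t\<bar> ^ n / fact n\<close>.
  The moments thus determine the characteristic function at every \<open>t\<close>.\<close>

lemma real_distribution_eqI_moments: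
  assumes "real_distribution M" "real_distribution N"
    and M: "AE x in M. \<bar>x\<bar> \<le> 1" and N: "AE x in N. \<bar>x\<bar> \<le> 1"
    and eq: "\<And>k. (LINT x|M. x ^ k) = (LINT x|N. x ^ k)"
  shows "M = N"
proof -
  have lim: "(\<lambda>n. \<Sum>k\<le>n. (\<i> * of_real t) ^ k / fact k * of_real (LINT x|L. x ^ k)) \<longlonglongrightarrow> char L t"
    if L: "real_distribution L" "AE x in L. \<bar>x\<bar> \<le> 1" for L t
  proof -
    interpret L: real_distribution L by fact
    have int: "integrable L (\<lambda>x. x ^ k)" for k
      by (rule L.integrable_const_bound[where B=1])
        (use L(2) in eventually_elim, auto simp: power_abs power_le_one)
    have le: "(LINT x|L. \<bar>x\<bar> ^ k) \<le> 1" for k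
    proof -
      have "(LINT x|L. \<bar>x\<bar> ^ k) \<le> (LINT x|L. 1)"
        using integrable_abs[OF int[of k]] L(2)
        by (intro integral_mono_AE) (auto simp: power_abs power_le_one elim!: eventually_mono)
      then show ?thesis using L.prob_space by simp
    qed
    have "(\<lambda>n. (\<Sum>k\<le>n. (\<i> * of_real t) ^ k / fact k * of_real (LINT x|L. x ^ k)) - char L t) \<longlonglongrightarrow> 0"
    proof (rule Lim_null_comparison)
      show "\<forall>\<^sub>F n in sequentially.
          norm ((\<Sum>k\<le>n. (\<i> * of_real t) ^ k / fact k * of_real (LINT x|L. x ^ k)) - char L t) \<le>
          2 * (\<bar>t\<bar> ^ n / fact n)"
      proof (rule always_eventually, rule allI)
        fix n
        have "norm (char L t - (\<Sum>k\<le>n. (\<i> * of_real t) ^ k / fact k * of_real (LINT x|L. x ^ k))) \<le>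
            (2 * \<bar>t\<bar> ^ n / fact n) * (LINT x|L. \<bar>x\<bar> ^ n)"
          using L.char_approx1[of n t] int by simp
        also have "\<dots> \<le> 2 * \<bar>t\<bar> ^ n / fact n * 1"
          by (intro mult_left_mono le) auto
        finally show "norm ((\<Sum>k\<le>n. (\<i> * of_real t) ^ k / fact k * of_real (LINT x|L. x ^ k)) - char L t) \<le>
          2 * (\<bar>t\<bar> ^ n / fact n)" by (simp add: norm_minus_commute)
      qed
      have "(\<lambda>n. \<bar>t\<bar> ^ n / fact n) \<longlonglongrightarrow> 0"
        using summable_LIMSEQ_zero[OF summable_exp[of "\<bar>t\<bar>"]] by (simp add: field_simps)
      then show "(\<lambda>n. 2 * (\<bar>t\<bar> ^ n / fact n)) \<longlonglongrightarrow> 0"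
        by (rule tendsto_mult_right_zero)
    qed
    then show ?thesis by (rule LIM_zero_cancel)
  qed
  have "char M t = char N t" for t
    using lim[OF assms(1) M, of t] lim[OF assms(2) N, of t] unfolding eq by (rule LIMSEQ_unique)
  then show ?thesis by (intro Levy_uniqueness assms(1,2) ext)
qed

text \<open>
  The substitution \<open>y = exp (- x)\<close> turns Laplace transforms at integers into moments on \<open>{0..1}\<close>.
\<close>
lemma measure_eqI_laplace:
  fixes \<mu> \<nu> :: "real measure" and N :: nat
  assumes sets: "sets \<mu> = sets borel" "sets \<nu> = sets borel"
    and pos: "AE x in \<mu>. 0 \<le> x" "AE x in \<nu>. 0 \<le> x"
    and fin: "(\<integral>\<^sup>+x. ennreal (exp (- real N * x)) \<partial>\<mu>) < \<infinity>"
    and eq: "\<And>n. N \<le> n \<Longrightarrow>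
      (\<integral>\<^sup>+x. ennreal (exp (- real n * x)) \<partial>\<mu>) = (\<integral>\<^sup>+x. ennreal (exp (- real n * x)) \<partial>\<nu>)"
  shows "\<mu> = \<nu>"
proof -
  note [measurable_cong] = sets
  define c where "c = enn2real (\<integral>\<^sup>+x. ennreal (exp (- real N * x)) \<partial>\<mu>)"
  have c: "(\<integral>\<^sup>+x. ennreal (exp (- real N * x)) \<partial>\<mu>) = ennreal c" "0 \<le> c"
    using fin by (auto simp: c_def less_top)
  show ?thesis
  proof (cases "c = 0")
    case True
    \<comment> \<open>The exponential is strictly positive, so a vanishing transform leaves only the
      zero measure.\<close>
    have null: "emeasure L A = 0" if "sets L = sets borel" "(\<integral>\<^sup>+x. ennreal (exp (- real N * x)) \<partial>L) = 0"
      for L :: "real measure" and A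
    proof -
      note [measurable_cong] = that(1)
      have "AE x in L. ennreal (exp (- real N * x)) = 0"
        using that(2) by (subst (asm) nn_integral_0_iff_AE) auto
      then have "emeasure L (space L) = 0"
        by (simp add: eventually_False ae_filter_eq_bot_iff)
      then show ?thesis by (metis emeasure_space le_zero_eq)
    qed
    show ?thesis
    proof (rule measure_eqI)
      show "sets \<mu> = sets \<nu>" using sets by simp
      show "emeasure \<mu> A = emeasure \<nu> A" for A
        using null[of \<mu> A] null[of \<nu> A] sets c True eq[of N] by simp
    qed
  next
    case False
    with c have c0: "0 < c" by simp
    \<comment> \<open>The measures may be infinite, as when a distribution function serves as
      density. Tilting by \<open>exp (- N * x) / c\<close> makes them probabilities before they are
      moved to \<open>{0..1}\<close>.\<close>
    define T where "T L = distr (density L (\<lambda>x. ennreal (exp (- real N * x) / c))) borel (\<lambda>x. exp (- x))"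
      for L :: "real measure"
    have nn_T: "(\<integral>\<^sup>+y. g y \<partial>T L) = (\<integral>\<^sup>+x. ennreal (exp (- real N * x) / c) * g (exp (- x)) \<partial>L)"
      if [measurable_cong]: "sets L = sets borel" and [measurable]: "g \<in> borel_measurable borel"
      for L :: "real measure" and g
      unfolding T_def by (subst nn_integral_distr) (auto simp: nn_integral_density)
    \<comment> \<open>The \<open>k\<close>-th moment of \<open>T L\<close> is the transform of
      \<open>L\<close> at \<open>N + k\<close>, so agreement from \<open>N\<close> on yields all
      moments.\<close>
    have nn_moment: "(\<integral>\<^sup>+y. ennreal (\<bar>y\<bar> ^ k) \<partial>T L) = (\<integral>\<^sup>+x. ennreal (exp (- real (N + k) * x)) \<partial>L) / ennreal c"
      if [measurable_cong]: "sets L = sets borel" for L k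
    proof -
      have "(\<integral>\<^sup>+y. ennreal (\<bar>y\<bar> ^ k) \<partial>T L) =
          (\<integral>\<^sup>+x. ennreal (exp (- real N * x) / c) * ennreal (\<bar>exp (- x)\<bar> ^ k) \<partial>L)"
        by (rule nn_T[OF that]) measurable
      also have "\<dots> = (\<integral>\<^sup>+x. ennreal (exp (- real (N + k) * x)) / ennreal c \<partial>L)"
        using c0 by (intro nn_integral_cong)
          (simp add: ennreal_mult[symmetric] divide_ennreal exp_of_nat_mult[symmetric] exp_add[symmetric] algebra_simps)
      finally have "(\<integral>\<^sup>+y. ennreal (\<bar>y\<bar> ^ k) \<partial>T L) =
        (\<integral>\<^sup>+x. ennreal (exp (- real (N + k) * x)) / ennreal c \<partial>L)" .
      then show ?thesis by (simp add: nn_integral_divide)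
    qed
    have dist: "real_distribution (T L)"
      if s [measurable_cong]: "sets L = sets borel" and e: "(\<integral>\<^sup>+x. ennreal (exp (- real N * x)) \<partial>L) = ennreal c" for L
    proof -
      have "emeasure (T L) UNIV = 1"
        using nn_moment[OF s, of 0] e c0 by (simp add: T_def divide_ennreal)
      then have "prob_space (T L)" by (intro prob_spaceI) (simp add: T_def)
      then show ?thesis
        by (simp add: real_distribution_def real_distribution_axioms_def T_def)
    qed
    have AE_T: "AE y in T L. 0 \<le> y \<and> y \<le> 1" if [measurable_cong]: "sets L = sets borel" and "AE x in L. 0 \<le> x" for L
      unfolding T_def using that(2)
      by (subst AE_distr_iff) (auto simp: AE_density elim!: eventually_mono)
    have moment: "(LINT y|T L. y ^ k) = enn2real (\<integral>\<^sup>+y. ennreal (\<bar>y\<bar> ^ k) \<partial>T L)"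
      if "sets L = sets borel" and "AE x in L. 0 \<le> x" for L k
    proof -
      have "(LINT y|T L. y ^ k) = (LINT y|T L. \<bar>y\<bar> ^ k)"
        using AE_T[OF that] by (intro integral_cong_AE) (auto simp: T_def elim!: eventually_mono)
      also have "\<dots> = enn2real (\<integral>\<^sup>+y. ennreal (\<bar>y\<bar> ^ k) \<partial>T L)"
        by (rule integral_eq_nn_integral) (auto simp: T_def)
      finally show ?thesis .
    qed
    have T_eq: "T \<mu> = T \<nu>"
    proof (rule real_distribution_eqI_moments)
      show "real_distribution (T \<mu>)" "real_distribution (T \<nu>)"
        using dist[of \<mu>] dist[of \<nu>] sets c eq[of N] by auto
      show "AE x in T \<mu>. \<bar>x\<bar> \<le> 1" "AE x in T \<nu>. \<bar>x\<bar> \<le> 1"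
        by (rule eventually_mono[OF AE_T[OF sets(1) pos(1)]], simp, rule eventually_mono[OF AE_T[OF sets(2) pos(2)]], simp)
      show "(LINT x|T \<mu>. x ^ k) = (LINT x|T \<nu>. x ^ k)" for k
        using eq[of "N + k"] by (simp add: moment sets pos nn_moment)
    qed
    \<comment> \<open>Both operations in \<open>T\<close> can be undone: \<open>- ln y\<close>
      recovers the point, and \<open>c * inverse y ^ N\<close> removes the tilt.\<close>
    have inv: "emeasure L A = (\<integral>\<^sup>+y. ennreal (c * inverse y ^ N) * indicator A (- ln y) \<partial>T L)"
      if s [measurable_cong]: "sets L = sets borel" and A [measurable]: "A \<in> sets borel" for L A
    proof -
      have "(\<integral>\<^sup>+y. ennreal (c * inverse y ^ N) * indicator A (- ln y) \<partial>T L) =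
          (\<integral>\<^sup>+x. ennreal (exp (- real N * x) / c) * (ennreal (c * inverse (exp (- x)) ^ N) * indicator A (- ln (exp (- x)))) \<partial>L)"
        by (rule nn_T[OF s]) measurable
      also have "\<dots> = (\<integral>\<^sup>+x. indicator A x \<partial>L)"
      proof (rule nn_integral_cong)
        fix x
        have "exp (- real N * x) / c * (c * inverse (exp (- x)) ^ N) = 1"
          using c0 by (simp add: exp_minus exp_of_nat_mult[symmetric])
        then have "ennreal (exp (- real N * x) / c) * ennreal (c * inverse (exp (- x)) ^ N) = 1"
          using c0 by (subst ennreal_mult[symmetric]) auto
        then show "ennreal (exp (- real N * x) / c) * (ennreal (c * inverse (exp (- x)) ^ N) * indicator A (- ln (exp (- x)))) =
            indicator A x"
          by (simp add: mult.assoc[symmetric])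
      qed
      finally show ?thesis using A s by simp
    qed
    show ?thesis
    proof (rule measure_eqI)
      show "sets \<mu> = sets \<nu>" using sets by simp
      show "emeasure \<mu> A = emeasure \<nu> A" if "A \<in> sets \<mu>" for A
        using that inv[of \<mu> A] inv[of \<nu> A] sets T_eq by simp
    qed
  qed
qed

section \<open>Distribution of the unweighted square integral\<close>

lemma DERIV_cdf_std_normal: "DERIV (cdf std_normal_distribution) z :> std_normal_density z"
proof -
  interpret real_distribution std_normal_distribution by (rule real_dist_normal_dist)
  have c: "continuous_on A std_normal_density" for A
    unfolding std_normal_density_def by (intro continuous_intros) auto
  \<comment> \<open>Starting the integral at \<open>z - 1\<close> puts \<open>z\<close> inside a
    compact interval, where the fundamental theorem of calculus applies.\<close>
  have eq: "cdf std_normal_distribution y = cdf std_normal_distribution (z - 1) + integral {z - 1..y} std_normal_density"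
    if "z - 1 \<le> y" for y
  proof -
    have "cdf std_normal_distribution y - cdf std_normal_distribution (z - 1) = measure std_normal_distribution {z - 1<..y}"
      using cdf_diff_eq[of "z - 1" y] that by (cases "y = z - 1") auto
    also have "\<dots> = (LINT x|std_normal_distribution. indicator {z - 1<..y} x)" by simp
    also have "\<dots> = (LINT x|lborel. std_normal_density x * indicator {z - 1<..y} x)"
      by (subst integral_density) auto
    also have "\<dots> = (LINT x:{z - 1..y}|lborel. std_normal_density x)"
      unfolding set_lebesgue_integral_def
      by (intro integral_discrete_difference[of "{z - 1}"]) (auto simp: indicator_def)
    also have "\<dots> = integral {z - 1..y} std_normal_density"
      by (intro set_borel_integral_eq_integral borel_integrable_atLeastAtMost' c)
    finally show ?thesis by simp
  qed
  have "((\<lambda>y. integral {z - 1..y} std_normal_density) has_real_derivative std_normal_density z) (at z within {z - 1..z + 1})"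
    by (rule integral_has_real_derivative[OF c]) auto
  then have "((\<lambda>y. integral {z - 1..y} std_normal_density) has_real_derivative std_normal_density z) (at z)"
    by (simp add: at_within_Icc_at)
  then have d: "((\<lambda>y. cdf std_normal_distribution (z - 1) + integral {z - 1..y} std_normal_density) has_real_derivative std_normal_density z) (at z)"
    by (auto intro!: derivative_eq_intros)
  have ev: "\<forall>\<^sub>F y in nhds z. cdf std_normal_distribution y = cdf std_normal_distribution (z - 1) + integral {z - 1..y} std_normal_density"
    using eventually_nhds_in_open[of "{z - 1<..}" z] by (auto elim!: eventually_mono intro!: eq)
  show ?thesis
    using DERIV_cong_ev[OF refl ev refl] d by (rule iffD2)
qed

text \<open>
  The antiderivative \<open>F\<close> in the proof is modelled on the distribution function of the first
  passage time of a Brownian motion with drift.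
\<close>
lemma nn_integral_exp_inverse:
  assumes a: "0 < (a::real)" and v: "0 < v"
  shows "(\<integral>\<^sup>+x. ennreal (exp (- (a\<^sup>2 / 2) * x) * (exp (- v\<^sup>2 / (2 * x)) / sqrt (2 * pi * x))) * indicator {0<..} x \<partial>lborel) =
    ennreal (exp (- (v * a)) / a)"
proof -
  interpret real_distribution std_normal_distribution by (rule real_dist_normal_dist)
  let ?\<Phi> = "cdf std_normal_distribution"
  define f where "f x = exp (- (a\<^sup>2 / 2) * x) * (exp (- v\<^sup>2 / (2 * x)) / sqrt (2 * pi * x))" for x
  define F where "F x = (exp (- (v * a)) * ?\<Phi> (a * sqrt x - v / sqrt x) - exp (v * a) * ?\<Phi> (- (a * sqrt x + v / sqrt x))) / a" for x
  have der: "DERIV F x :> f x" if x: "0 < x" for x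
  proof -
    define y where "y = sqrt x"
    have y: "0 < y" "x = y\<^sup>2" using x by (auto simp: y_def)
    \<comment> \<open>The factors \<open>exp (- (v * a))\<close> and \<open>exp (v * a)\<close>
      cancel the cross terms of the two squares, so both summands of \<open>F\<close> carry the same
      Gaussian factor. In the difference the parts with \<open>v / x\<close> then cancel and those
      with \<open>a\<close> add up.\<close>
    have e1: "exp (- (v * a)) * std_normal_density (a * y - v / y) = f x * y"
      and e2: "exp (v * a) * std_normal_density (- (a * y + v / y)) = f x * y"
    proof -
      have 1: "- (v * a) + - (a * y - v / y)\<^sup>2 / 2 = - (a\<^sup>2 / 2) * y\<^sup>2 + - v\<^sup>2 / (2 * y\<^sup>2)"
        and 2: "v * a + - (- (a * y + v / y))\<^sup>2 / 2 = - (a\<^sup>2 / 2) * y\<^sup>2 + - v\<^sup>2 / (2 * y\<^sup>2)"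
        using y(1) by (simp_all add: field_simps power2_eq_square)
      have 3: "f x * y = exp (- (a\<^sup>2 / 2) * y\<^sup>2 + - v\<^sup>2 / (2 * y\<^sup>2)) / sqrt (2 * pi)"
        unfolding exp_add using y(1) by (simp add: f_def y(2) real_sqrt_mult)
      show "exp (- (v * a)) * std_normal_density (a * y - v / y) = f x * y"
        unfolding 3 1[symmetric] exp_add std_normal_density_def by simp
      show "exp (v * a) * std_normal_density (- (a * y + v / y)) = f x * y"
        unfolding 3 2[symmetric] exp_add std_normal_density_def by simp
    qed
    have s: "(sqrt has_real_derivative inverse y / 2) (at x)"
      unfolding y_def by (rule DERIV_real_sqrt[OF x])
    have d1: "((\<lambda>x. a * sqrt x - v / sqrt x) has_real_derivative (a + v / x) / (2 * y)) (at x)"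
      using s y(1) x by (auto intro!: derivative_eq_intros s simp: y_def[symmetric])
        (simp add: y(2) field_simps power2_eq_square)
    have d2: "((\<lambda>x. - (a * sqrt x + v / sqrt x)) has_real_derivative (- a + v / x) / (2 * y)) (at x)"
      using s y(1) x by (auto intro!: derivative_eq_intros s simp: y_def[symmetric])
        (simp add: y(2) field_simps power2_eq_square)
    have "DERIV F x :> (exp (- (v * a)) * (std_normal_density (a * y - v / y) * ((a + v / x) / (2 * y))) -
       exp (v * a) * (std_normal_density (- (a * y + v / y)) * ((- a + v / x) / (2 * y)))) / a"
      unfolding F_def y_def
      by (intro DERIV_cdivide DERIV_diff DERIV_cmult DERIV_chain2[OF DERIV_cdf_std_normal] d1[unfolded y_def] d2[unfolded y_def])
    also have "(exp (- (v * a)) * (std_normal_density (a * y - v / y) * ((a + v / x) / (2 * y))) -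
       exp (v * a) * (std_normal_density (- (a * y + v / y)) * ((- a + v / x) / (2 * y)))) / a =
       (f x * y * ((a + v / x) / (2 * y)) - f x * y * ((- a + v / x) / (2 * y))) / a"
      by (simp only: mult.assoc[symmetric] e1 e2)
    also have "\<dots> = f x"
      using y(1) a by (simp add: field_simps)
    finally show ?thesis .
  qed
  have cont: "isCont f x" if "0 < x" for x
    unfolding f_def using that by (intro continuous_intros) auto
  have "LIM x at_right 0. inverse (sqrt x) :> at_top"
  proof (rule filterlim_inverse_at_top)
    show "(sqrt \<longlongrightarrow> 0) (at_right 0)" using tendsto_real_sqrt[OF tendsto_ident_at[of 0 "{0<..}"]] by simp
    show "\<forall>\<^sub>F x in at_right 0. 0 < sqrt x" by (auto simp: eventually_at_filter)
  qed
  from filterlim_tendsto_pos_mult_at_top[OF tendsto_const[of v] v this]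
  have inv0: "LIM x at_right 0. v / sqrt x :> at_top" by (simp add: divide_inverse)
  have s0: "((\<lambda>x. a * sqrt x) \<longlongrightarrow> 0) (at_right 0)"
    using tendsto_mult_left[OF tendsto_real_sqrt[OF tendsto_ident_at[of 0 "{0<..}"]], of a] by simp
  have sT: "LIM x at_top. a * sqrt x :> at_top"
    by (rule filterlim_tendsto_pos_mult_at_top[OF tendsto_const a sqrt_at_top])
  have invT: "((\<lambda>x. v / sqrt x) \<longlongrightarrow> 0) at_top"
    by (rule tendsto_divide_0[OF tendsto_const filterlim_at_top_imp_at_infinity[OF sqrt_at_top]])
  have z1: "LIM x at_right 0. a * sqrt x - v / sqrt x :> at_bot"
    unfolding filterlim_uminus_at_bot
    using filterlim_tendsto_add_at_top[OF tendsto_minus[OF s0] inv0] by simp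
  have z2: "LIM x at_right 0. - (a * sqrt x + v / sqrt x) :> at_bot"
    unfolding filterlim_uminus_at_bot
    using filterlim_tendsto_add_at_top[OF s0 inv0] by (simp add: add.commute)
  have z3: "LIM x at_top. a * sqrt x - v / sqrt x :> at_top"
    using filterlim_tendsto_add_at_top[OF tendsto_minus[OF invT] sT] by simp
  have z4: "LIM x at_top. - (a * sqrt x + v / sqrt x) :> at_bot"
    unfolding filterlim_uminus_at_bot
    using filterlim_tendsto_add_at_top[OF invT sT] by (simp add: add.commute)
  note bot = filterlim_compose[OF cdf_lim_at_bot] and top = filterlim_compose[OF cdf_lim_at_top_prob]
  \<comment> \<open>At \<open>0\<close> both arguments of the distribution function tend to minus
    infinity. At infinity the first one changes sign, and only \<open>exp (- (v * a)) / a\<close>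
    remains.\<close>
  have "(F \<longlongrightarrow> (exp (- (v * a)) * 0 - exp (v * a) * 0) / a) (at_right 0)"
    unfolding F_def by (intro tendsto_intros bot[OF z1] bot[OF z2]) (use a in auto)
  then have A: "((F \<circ> real_of_ereal) \<longlongrightarrow> 0) (at_right (ereal 0))"
    by (simp add: ereal_tendsto_simps1)
  have "(F \<longlongrightarrow> (exp (- (v * a)) * 1 - exp (v * a) * 0) / a) at_top"
    unfolding F_def by (intro tendsto_intros top[OF z3] bot[OF z4]) (use a in auto)
  then have B: "((F \<circ> real_of_ereal) \<longlongrightarrow> exp (- (v * a)) / a) (at_left \<infinity>)"
    by (simp add: ereal_tendsto_simps1)
  have nn: "0 \<le> f x" if "0 < x" for x using that by (simp add: f_def)
  have "set_integrable lborel (einterval (ereal 0) \<infinity>) f \<and> (LBINT x=ereal 0..\<infinity>. f x) = exp (- (v * a)) / a - 0"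
    by (intro conjI interval_integral_FTC_nonneg[OF _ _ _ _ A B]) (use der cont nn in auto)
  then have i: "integrable lborel (\<lambda>x. indicator {0<..} x * f x)"
    and e: "(LINT x|lborel. indicator {0<..} x * f x) = exp (- (v * a)) / a"
    by (simp_all add: interval_lebesgue_integral_def set_lebesgue_integral_def set_integrable_def einterval_eq)
  have "(\<integral>\<^sup>+x. ennreal (f x) * indicator {0<..} x \<partial>lborel) = (\<integral>\<^sup>+x. ennreal (indicator {0<..} x * f x) \<partial>lborel)"
    by (intro nn_integral_cong) (simp add: indicator_def)
  also have "\<dots> = ennreal (exp (- (v * a)) / a)"
    unfolding e[symmetric] by (rule nn_integral_eq_integral[OF i]) (auto simp: indicator_def nn)
  finally show ?thesis unfolding f_def .
qed

section \<open>The terms of the series: Laplace transforms and bounds\<close>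

lemma nn_integral_exp_square:
  assumes "0 < (a::real)"
  shows "(\<integral>\<^sup>+r. ennreal (exp (- (a * r\<^sup>2))) \<partial>lborel) = ennreal (sqrt (pi / a))"
proof -
  define \<sigma> where "\<sigma> = 1 / sqrt (2 * a)"
  have s: "0 < \<sigma>" "\<sigma>\<^sup>2 = 1 / (2 * a)" using assms by (auto simp: \<sigma>_def power_divide)
  have e: "exp (- (a * r\<^sup>2)) = sqrt (pi / a) * normal_density 0 \<sigma> r" for r
    unfolding normal_density_def s using assms by (simp add: field_simps real_sqrt_divide)
  have "(\<integral>\<^sup>+r. ennreal (exp (- (a * r\<^sup>2))) \<partial>lborel) = ennreal (LINT r|lborel. exp (- (a * r\<^sup>2)))"
    unfolding e using s by (intro nn_integral_eq_integral) (auto simp: assms less_imp_le)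
  also have "(LINT r|lborel. exp (- (a * r\<^sup>2))) = sqrt (pi / a)"
    unfolding e using s by simp
  finally show ?thesis .
qed

text \<open>
  Expanding \<open>sqrt (a / sinh a)\<close> in powers of \<open>exp (- 2 * a)\<close> and inverting term by term gives
  a series for the distribution function with these terms, in which \<open>b = 2 * k + 1 / 2\<close>;
  the integration over \<open>r\<close> produces the factor \<open>a powr (- 1 / 2)\<close>.
\<close>
definition theta_term :: "real \<Rightarrow> real \<Rightarrow> real \<Rightarrow> real" where
  "theta_term b x r = exp (- (b + r\<^sup>2)\<^sup>2 / (2 * x)) / sqrt (2 * pi * x)"

lemma measurable_theta_term [measurable]:
  "(\<lambda>(x, r). theta_term b x r) \<in> borel_measurable (borel \<Otimes>\<^sub>M borel)"
  "theta_term b x \<in> borel_measurable borel"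
  unfolding theta_term_def by measurable

text \<open>After the integrals are exchanged, the inner one is
  \<open>nn_integral_exp_inverse\<close> with \<open>v = b + r\<^sup>2\<close>, and a Gaussian
  integral in \<open>r\<close> is left.\<close>

lemma nn_integral_theta_term_laplace:
  assumes a: "0 < (a::real)" and b: "0 < b"
  shows "(\<integral>\<^sup>+x. ennreal (exp (- (a\<^sup>2 / 2) * x)) * (\<integral>\<^sup>+r. ennreal (theta_term b x r) \<partial>lborel) * indicator {0<..} x \<partial>lborel) =
    ennreal (exp (- (b * a)) * sqrt (pi / a) / a)"
proof -
  have "(\<integral>\<^sup>+x. ennreal (exp (- (a\<^sup>2 / 2) * x)) * (\<integral>\<^sup>+r. ennreal (theta_term b x r) \<partial>lborel) * indicator {0<..} x \<partial>lborel) =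
    (\<integral>\<^sup>+x. (\<integral>\<^sup>+r. ennreal (exp (- (a\<^sup>2 / 2) * x)) * ennreal (theta_term b x r) * indicator {0<..} x \<partial>lborel) \<partial>lborel)"
    by (simp add: nn_integral_cmult nn_integral_multc)
  also have "\<dots> = (\<integral>\<^sup>+r. (\<integral>\<^sup>+x. ennreal (exp (- (a\<^sup>2 / 2) * x)) * ennreal (theta_term b x r) * indicator {0<..} x \<partial>lborel) \<partial>lborel)"
    by (rule lborel_pair.Fubini') measurable
  also have "\<dots> = (\<integral>\<^sup>+r. ennreal (exp (- (b * a)) / a) * ennreal (exp (- (a * r\<^sup>2))) \<partial>lborel)"
  proof (rule nn_integral_cong)
    fix r :: real
    have v: "0 < b + r\<^sup>2" using b by (simp add: add_pos_nonneg)
    have "(\<integral>\<^sup>+x. ennreal (exp (- (a\<^sup>2 / 2) * x)) * ennreal (theta_term b x r) * indicator {0<..} x \<partial>lborel) =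
      (\<integral>\<^sup>+x. ennreal (exp (- (a\<^sup>2 / 2) * x) * (exp (- (b + r\<^sup>2)\<^sup>2 / (2 * x)) / sqrt (2 * pi * x))) * indicator {0<..} x \<partial>lborel)"
      by (intro nn_integral_cong) (auto simp: theta_term_def indicator_def ennreal_mult'[symmetric])
    also have "\<dots> = ennreal (exp (- ((b + r\<^sup>2) * a)) / a)"
      by (rule nn_integral_exp_inverse[OF a v])
    also have "exp (- ((b + r\<^sup>2) * a)) / a = exp (- (b * a)) / a * exp (- (a * r\<^sup>2))"
      by (simp add: exp_add[symmetric] algebra_simps)
    also have "ennreal (exp (- (b * a)) / a * exp (- (a * r\<^sup>2))) = ennreal (exp (- (b * a)) / a) * ennreal (exp (- (a * r\<^sup>2)))"
      using a by (intro ennreal_mult) auto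
    finally show "(\<integral>\<^sup>+x. ennreal (exp (- (a\<^sup>2 / 2) * x)) * ennreal (theta_term b x r) * indicator {0<..} x \<partial>lborel) =
      ennreal (exp (- (b * a)) / a) * ennreal (exp (- (a * r\<^sup>2)))" .
  qed
  also have "\<dots> = ennreal (exp (- (b * a)) / a) * ennreal (sqrt (pi / a))"
    using nn_integral_exp_square[OF a] by (subst nn_integral_cmult) auto
  also have "\<dots> = ennreal (exp (- (b * a)) * sqrt (pi / a) / a)"
    using a by (subst ennreal_mult[symmetric]) auto
  finally show ?thesis .
qed

text \<open>Dropping \<open>r ^ 4\<close> from the expanded square leaves a Gaussian in
  \<open>r\<close>, whose integral supplies the factor \<open>1 / sqrt (2 * b)\<close>. This factor
  equals \<open>1\<close> at \<open>b = 1 / 2\<close>, so the leading term is bounded with the sharp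
  constant.\<close>

lemma nn_integral_theta_term_le:
  assumes x: "0 < x" and b: "1 / 2 \<le> b"
  shows "(\<integral>\<^sup>+r. ennreal (theta_term b x r) \<partial>lborel) \<le> ennreal (exp (- b\<^sup>2 / (2 * x)))"
proof -
  have "(\<integral>\<^sup>+r. ennreal (theta_term b x r) \<partial>lborel) \<le>
      (\<integral>\<^sup>+r. ennreal (exp (- b\<^sup>2 / (2 * x)) / sqrt (2 * pi * x)) * ennreal (exp (- (b / x * r\<^sup>2))) \<partial>lborel)"
  proof (rule nn_integral_mono)
    fix r :: real
    have "- (b + r\<^sup>2)\<^sup>2 / (2 * x) \<le> - b\<^sup>2 / (2 * x) + - (b / x * r\<^sup>2)"
    proof -
      have "- (b + r\<^sup>2)\<^sup>2 \<le> - b\<^sup>2 - 2 * b * r\<^sup>2" by (simp add: power2_sum)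
      then have "- (b + r\<^sup>2)\<^sup>2 / (2 * x) \<le> (- b\<^sup>2 - 2 * b * r\<^sup>2) / (2 * x)"
        using x by (intro divide_right_mono) auto
      then show ?thesis using x by (simp add: diff_divide_distrib)
    qed
    then have "exp (- (b + r\<^sup>2)\<^sup>2 / (2 * x)) \<le> exp (- b\<^sup>2 / (2 * x)) * exp (- (b / x * r\<^sup>2))"
      by (simp only: exp_add[symmetric] exp_le_cancel_iff)
    then have "theta_term b x r \<le> exp (- b\<^sup>2 / (2 * x)) * exp (- (b / x * r\<^sup>2)) / sqrt (2 * pi * x)"
      unfolding theta_term_def using x by (intro divide_right_mono) auto
    then show "ennreal (theta_term b x r) \<le> ennreal (exp (- b\<^sup>2 / (2 * x)) / sqrt (2 * pi * x)) * ennreal (exp (- (b / x * r\<^sup>2)))"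
      using x by (simp add: ennreal_mult'[symmetric] ennreal_leI)
  qed
  also have "\<dots> = ennreal (exp (- b\<^sup>2 / (2 * x)) / sqrt (2 * pi * x)) * ennreal (sqrt (pi / (b / x)))"
    using nn_integral_exp_square[of "b / x"] x b by (subst nn_integral_cmult) auto
  also have "\<dots> = ennreal (exp (- b\<^sup>2 / (2 * x)) / sqrt (2 * pi * x) * sqrt (pi / (b / x)))"
    using x b by (intro ennreal_mult[symmetric]) auto
  also have "exp (- b\<^sup>2 / (2 * x)) / sqrt (2 * pi * x) * sqrt (pi / (b / x)) = exp (- b\<^sup>2 / (2 * x)) / sqrt (2 * b)"
    using x b by (simp add: real_sqrt_divide real_sqrt_mult)
  also have "\<dots> \<le> exp (- b\<^sup>2 / (2 * x))"
    using b by (simp add: divide_le_eq)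
  finally show ?thesis by (simp add: ennreal_leI)
qed

text \<open>For \<open>b = 1 / 2\<close> the term is \<open>exp (- 1 / (8 * x))\<close> times a
  normal density of variance \<open>x\<close> times \<open>exp (- (r ^ 4 / (2 * x)))\<close>.
  Bounding the last factor below by \<open>1 - r ^ 4 / (2 * x)\<close>, the fourth moment
  \<open>3 * x\<^sup>2\<close> gives the correction \<open>3 * x / 2\<close>.\<close>

lemma nn_integral_theta_term_ge:
  assumes x: "0 < x"
  shows "ennreal (exp (- 1 / (8 * x)) * (1 - 3 * x / 2)) \<le> (\<integral>\<^sup>+r. ennreal (theta_term (1 / 2) x r) \<partial>lborel)"
proof -
  define \<sigma> where "\<sigma> = sqrt x"
  have s: "0 < \<sigma>" "\<sigma>\<^sup>2 = x" using x by (auto simp: \<sigma>_def)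
  have e: "theta_term (1 / 2) x r = exp (- 1 / (8 * x)) * (normal_density 0 \<sigma> r * exp (- (r ^ 4 / (2 * x))))" for r
  proof -
    have "- (1 / 2 + r\<^sup>2)\<^sup>2 / (2 * x) = - 1 / (8 * x) + (- (r - 0)\<^sup>2 / (2 * \<sigma>\<^sup>2) + - (r ^ 4 / (2 * x)))"
      unfolding s using x by (simp add: power2_sum field_simps eval_nat_numeral)
    then have "exp (- (1 / 2 + r\<^sup>2)\<^sup>2 / (2 * x)) = exp (- 1 / (8 * x)) * (exp (- (r - 0)\<^sup>2 / (2 * \<sigma>\<^sup>2)) * exp (- (r ^ 4 / (2 * x))))"
      by (simp only: exp_add)
    then show ?thesis unfolding theta_term_def normal_density_def s(2) by simp
  qed
  note i4 = integrable_normal_moment[OF s(1), of 0 4, simplified]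
  have m4: "(LINT r|lborel. normal_density 0 \<sigma> r * r ^ 4) = 3 * x\<^sup>2"
    using integral_normal_moment_even[OF s(1), of 0 2] s(1)
    by (simp add: eval_nat_numeral fact_reduce s(2)[symmetric] field_simps)
  have i: "integrable lborel (\<lambda>r. normal_density 0 \<sigma> r * exp (- (r ^ 4 / (2 * x))))"
    by (rule Bochner_Integration.integrable_bound[OF integrable_normal_density[OF s(1), of 0]])
      (use x in \<open>auto intro!: mult_left_le\<close>)
  have "1 - 3 * x / 2 = (LINT r|lborel. normal_density 0 \<sigma> r - normal_density 0 \<sigma> r * r ^ 4 / (2 * x))"
    using i4 s x m4 by (subst Bochner_Integration.integral_diff) (auto simp: power2_eq_square)
  also have "\<dots> \<le> (LINT r|lborel. normal_density 0 \<sigma> r * exp (- (r ^ 4 / (2 * x))))"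
  proof (rule integral_mono)
    show "integrable lborel (\<lambda>r. normal_density 0 \<sigma> r - normal_density 0 \<sigma> r * r ^ 4 / (2 * x))"
      using i4 s by (intro Bochner_Integration.integrable_diff integrable_divide) auto
    fix r
    have "normal_density 0 \<sigma> r * (1 + - (r ^ 4 / (2 * x))) \<le> normal_density 0 \<sigma> r * exp (- (r ^ 4 / (2 * x)))"
      by (intro mult_left_mono exp_ge_add_one_self) auto
    then show "normal_density 0 \<sigma> r - normal_density 0 \<sigma> r * r ^ 4 / (2 * x) \<le> normal_density 0 \<sigma> r * exp (- (r ^ 4 / (2 * x)))"
      by (simp add: algebra_simps)
  qed (rule i)
  finally have "exp (- 1 / (8 * x)) * (1 - 3 * x / 2) \<le> exp (- 1 / (8 * x)) * (LINT r|lborel. normal_density 0 \<sigma> r * exp (- (r ^ 4 / (2 * x))))"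
    by (rule mult_left_mono) simp
  also have "\<dots> = (LINT r|lborel. theta_term (1 / 2) x r)"
    unfolding e by simp
  finally have "ennreal (exp (- 1 / (8 * x)) * (1 - 3 * x / 2)) \<le> ennreal (LINT r|lborel. theta_term (1 / 2) x r)"
    by (rule ennreal_leI)
  also have "\<dots> = (\<integral>\<^sup>+r. ennreal (theta_term (1 / 2) x r) \<partial>lborel)"
    using i by (intro nn_integral_eq_integral[symmetric]) (auto simp: e)
  finally show ?thesis .
qed

section \<open>The series and its Laplace transform\<close>

lemma pochhammer_half_sums:
  assumes "\<bar>z\<bar> < (1::real)"
  shows "(\<lambda>k. pochhammer (1 / 2) k / fact k * z ^ k) sums (1 / sqrt (1 - z))"
proof -
  have "(\<lambda>k. ((- 1 / 2) gchoose k) * (- z) ^ k) sums (1 + - z) powr (- 1 / 2)"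
    using assms by (intro gen_binomial_real) simp
  moreover have "((- 1 / 2) gchoose k) * (- z) ^ k = pochhammer (1 / 2) k / fact k * z ^ k" for k
  proof -
    have "(- 1) ^ k * (- z) ^ k = z ^ k" by (simp flip: power_mult_distrib)
    then show ?thesis by (simp add: gbinomial_pochhammer mult_ac)
  qed
  moreover have "(1 + - z) powr (- 1 / 2) = 1 / sqrt (1 - z)"
    using assms powr_minus[of "1 - z" "1 / 2"] powr_half_sqrt[of "1 - z"] by (simp add: inverse_eq_divide)
  ultimately show ?thesis by simp
qed

text \<open>Up to the factor \<open>2 * sqrt 2 / sqrt pi\<close> this is the Anderson--Darling
  series for the limit law of the Cramer--von Mises statistic; the inner integrals are Bessel
  functions of order 1/4 in integral form. Values in \<open>ennreal\<close> let sums and integrals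
  be exchanged freely.\<close>

definition theta_series :: "real \<Rightarrow> ennreal" where
  "theta_series x = (\<Sum>k. ennreal (pochhammer (1 / 2) k / fact k) *
     (\<integral>\<^sup>+r. ennreal (theta_term (2 * real k + 1 / 2) x r) \<partial>lborel))"

lemma measurable_theta_series [measurable]: "theta_series \<in> borel_measurable borel"
  unfolding theta_series_def by measurable

text \<open>Since \<open>sinh a = exp a * (1 - exp (- 2 * a)) / 2\<close>, the root of
  \<open>1 / sinh a\<close> is \<open>sqrt 2 * exp (- a / 2)\<close> times the binomial series at
  \<open>exp (- 2 * a)\<close>; its \<open>k\<close>-th term carries
  \<open>exp (- (2 * k + 1 / 2) * a)\<close>.\<close>

lemma nn_integral_theta_series_laplace:
  assumes a: "0 < (a::real)"
  shows "(\<integral>\<^sup>+x. ennreal (exp (- (a\<^sup>2 / 2) * x)) * theta_series x * indicator {0<..} x \<partial>lborel) =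
    ennreal (sqrt (pi / 2) * (sqrt (a / sinh a) / a\<^sup>2))"
proof -
  define c :: "nat \<Rightarrow> real" where "c k = pochhammer (1 / 2) k / fact k" for k
  have c0: "0 \<le> c k" for k
    using pochhammer_nonneg[of "1 / 2 :: real" k] by (simp add: c_def)
  have "(\<integral>\<^sup>+x. ennreal (exp (- (a\<^sup>2 / 2) * x)) * theta_series x * indicator {0<..} x \<partial>lborel) =
    (\<integral>\<^sup>+x. (\<Sum>k. ennreal (c k) * (ennreal (exp (- (a\<^sup>2 / 2) * x)) *
      (\<integral>\<^sup>+r. ennreal (theta_term (2 * real k + 1 / 2) x r) \<partial>lborel) * indicator {0<..} x)) \<partial>lborel)"
  proof (rule nn_integral_cong)
    fix x :: real
    let ?I = "\<lambda>k. \<integral>\<^sup>+r. ennreal (theta_term (2 * real k + 1 / 2) x r) \<partial>lborel"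
    let ?e = "ennreal (exp (- (a\<^sup>2 / 2) * x))"
    have "(\<Sum>k. ennreal (c k) * (?e * ?I k * indicator {0<..} x)) =
        (\<Sum>k. ?e * indicator {0<..} x * (ennreal (c k) * ?I k))"
      by (intro suminf_cong) (simp only: mult_ac)
    also have "\<dots> = ?e * indicator {0<..} x * theta_series x"
      unfolding theta_series_def c_def by (rule ennreal_suminf_cmult)
    finally show "?e * theta_series x * indicator {0<..} x =
        (\<Sum>k. ennreal (c k) * (?e * ?I k * indicator {0<..} x))"
      by (simp only: mult_ac)
  qed
  also have "\<dots> = (\<Sum>k. ennreal (c k) * (\<integral>\<^sup>+x. ennreal (exp (- (a\<^sup>2 / 2) * x)) *
      (\<integral>\<^sup>+r. ennreal (theta_term (2 * real k + 1 / 2) x r) \<partial>lborel) * indicator {0<..} x \<partial>lborel))"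
    by (subst nn_integral_suminf) (auto simp: nn_integral_cmult)
  also have "\<dots> = (\<Sum>k. ennreal (c k) * ennreal (exp (- ((2 * real k + 1 / 2) * a)) * sqrt (pi / a) / a))"
    by (subst nn_integral_theta_term_laplace[OF a]) auto
  also have "\<dots> = (\<Sum>k. ennreal (c k * exp (- 2 * a) ^ k * (exp (- (a / 2)) * sqrt (pi / a) / a)))"
  proof (rule suminf_cong)
    fix k
    have "exp (- ((2 * real k + 1 / 2) * a)) = exp (- 2 * a) ^ k * exp (- (a / 2))"
      by (simp add: exp_of_nat_mult[symmetric] exp_add[symmetric] algebra_simps)
    then show "ennreal (c k) * ennreal (exp (- ((2 * real k + 1 / 2) * a)) * sqrt (pi / a) / a) =
        ennreal (c k * exp (- 2 * a) ^ k * (exp (- (a / 2)) * sqrt (pi / a) / a))"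
      using a c0 by (subst ennreal_mult[symmetric]) (auto simp: mult_ac)
  qed
  also have "\<dots> = ennreal (1 / sqrt (1 - exp (- 2 * a)) * (exp (- (a / 2)) * sqrt (pi / a) / a))"
  proof (rule suminf_ennreal_eq)
    show "0 \<le> c k * exp (- 2 * a) ^ k * (exp (- (a / 2)) * sqrt (pi / a) / a)" for k
      using a c0 by (intro mult_nonneg_nonneg divide_nonneg_nonneg) auto
    show "(\<lambda>k. c k * exp (- 2 * a) ^ k * (exp (- (a / 2)) * sqrt (pi / a) / a)) sums
        (1 / sqrt (1 - exp (- 2 * a)) * (exp (- (a / 2)) * sqrt (pi / a) / a))"
      unfolding c_def using a by (intro sums_mult2 pochhammer_half_sums) simp
  qed
  also have "1 / sqrt (1 - exp (- 2 * a)) * (exp (- (a / 2)) * sqrt (pi / a) / a) = sqrt (pi / 2) * (sqrt (a / sinh a) / a\<^sup>2)"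
  proof -
    define e t where "e = exp (a / 2)" and "t = sqrt (1 - exp (- 2 * a))"
    have e0: "0 < e" and t0: "0 < t" using a by (auto simp: e_def t_def)
    have "exp a * exp (- 2 * a) = exp (- a)" by (simp flip: exp_add)
    then have "sinh a = exp a * (1 - exp (- 2 * a)) / 2"
      by (simp add: sinh_field_def right_diff_distrib)
    moreover have "exp a = e\<^sup>2" by (simp add: e_def power2_eq_square flip: exp_add)
    moreover have "t\<^sup>2 = 1 - exp (- 2 * a)" using a by (simp add: t_def)
    ultimately have *: "sinh a = (e * t)\<^sup>2 / 2" by (simp add: power_mult_distrib)
    have "sqrt (sinh a) = e * t / sqrt 2"
      unfolding * real_sqrt_divide using e0 t0 by simp
    then have "sqrt (pi / 2) * (sqrt (a / sinh a) / a\<^sup>2) = sqrt pi * (sqrt a / a\<^sup>2) / (e * t)"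
      unfolding real_sqrt_divide by simp
    also have "sqrt a / a\<^sup>2 = 1 / (sqrt a * a)"
    proof -
      have "sqrt a / a\<^sup>2 = sqrt a / (sqrt a * sqrt a * a)" using a by (simp add: power2_eq_square)
      then show ?thesis using a by (simp only: mult.assoc) simp
    qed
    also have "sqrt pi * (1 / (sqrt a * a)) / (e * t) = 1 / t * (inverse e * sqrt (pi / a) / a)"
      unfolding real_sqrt_divide
      by (simp only: divide_inverse inverse_mult_distrib mult_1_left mult_1_right mult_ac)
    finally have eq: "sqrt (pi / 2) * (sqrt (a / sinh a) / a\<^sup>2) = 1 / t * (inverse e * sqrt (pi / a) / a)" .
    show ?thesis unfolding eq t_def e_def exp_minus[symmetric] by (rule refl)
  qed
  finally show ?thesis .
qed

text \<open>The estimate \<open>(2 * k + 1 / 2)\<^sup>2 \<ge> 2 * k + 1 / 4\<close> makes the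
  exponentials geometric in \<open>k\<close> with ratio \<open>exp (- 1 / x)\<close>, so the
  binomial series sums the bounds as well.\<close>

lemma theta_series_le:
  assumes x: "0 < x"
  shows "theta_series x \<le> ennreal (exp (- 1 / (8 * x)) / sqrt (1 - exp (- 1 / x)))"
proof -
  define c :: "nat \<Rightarrow> real" where "c k = pochhammer (1 / 2) k / fact k" for k
  have c0: "0 \<le> c k" for k
    using pochhammer_nonneg[of "1 / 2 :: real" k] by (simp add: c_def)
  have "theta_series x \<le> (\<Sum>k. ennreal (c k * exp (- 1 / x) ^ k * exp (- 1 / (8 * x))))"
    unfolding theta_series_def c_def[symmetric]
  proof (rule suminf_le)
    fix k
    have "(\<integral>\<^sup>+r. ennreal (theta_term (2 * real k + 1 / 2) x r) \<partial>lborel) \<le> ennreal (exp (- (2 * real k + 1 / 2)\<^sup>2 / (2 * x)))"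
      by (rule nn_integral_theta_term_le[OF x]) simp
    also have "exp (- (2 * real k + 1 / 2)\<^sup>2 / (2 * x)) \<le> exp (- 1 / x) ^ k * exp (- 1 / (8 * x))"
    proof -
      have "- (2 * real k + 1 / 2)\<^sup>2 \<le> - (2 * real k) - 1 / 4" by (simp add: power2_sum power_divide)
      then have "- (2 * real k + 1 / 2)\<^sup>2 / (2 * x) \<le> (- (2 * real k) - 1 / 4) / (2 * x)"
        using x by (intro divide_right_mono) auto
      also have "\<dots> = real k * (- 1 / x) + - 1 / (8 * x)" using x by (simp add: field_simps)
      finally have "exp (- (2 * real k + 1 / 2)\<^sup>2 / (2 * x)) \<le> exp (real k * (- 1 / x) + - 1 / (8 * x))"
        by (simp only: exp_le_cancel_iff)
      then show ?thesis by (simp only: exp_add exp_of_nat_mult)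
    qed
    finally have "(\<integral>\<^sup>+r. ennreal (theta_term (2 * real k + 1 / 2) x r) \<partial>lborel) \<le> ennreal (exp (- 1 / x) ^ k * exp (- 1 / (8 * x)))"
      by (simp add: ennreal_leI)
    then have "ennreal (c k) * (\<integral>\<^sup>+r. ennreal (theta_term (2 * real k + 1 / 2) x r) \<partial>lborel) \<le>
      ennreal (c k) * ennreal (exp (- 1 / x) ^ k * exp (- 1 / (8 * x)))" by (rule mult_left_mono) simp
    then show "ennreal (c k) * (\<integral>\<^sup>+r. ennreal (theta_term (2 * real k + 1 / 2) x r) \<partial>lborel) \<le>
      ennreal (c k * exp (- 1 / x) ^ k * exp (- 1 / (8 * x)))"
      using c0 by (simp add: ennreal_mult'[symmetric] mult.assoc)
  qed auto
  also have "\<dots> = ennreal (1 / sqrt (1 - exp (- 1 / x)) * exp (- 1 / (8 * x)))"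
  proof (rule suminf_ennreal_eq)
    show "0 \<le> c k * exp (- 1 / x) ^ k * exp (- 1 / (8 * x))" for k
      using c0 by (intro mult_nonneg_nonneg) auto
    show "(\<lambda>k. c k * exp (- 1 / x) ^ k * exp (- 1 / (8 * x))) sums
        (1 / sqrt (1 - exp (- 1 / x)) * exp (- 1 / (8 * x)))"
      unfolding c_def using x by (intro sums_mult2 pochhammer_half_sums) simp
  qed
  finally show ?thesis by simp
qed

text \<open>All terms are non-negative, so the one with \<open>k = 0\<close> is a lower
  bound.\<close>

lemma theta_series_ge:
  assumes x: "0 < x"
  shows "ennreal (exp (- 1 / (8 * x)) * (1 - 3 * x / 2)) \<le> theta_series x"
proof -
  let ?f = "\<lambda>k. ennreal (pochhammer (1 / 2) k / fact k) * (\<integral>\<^sup>+r. ennreal (theta_term (2 * real k + 1 / 2) x r) \<partial>lborel)"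
  have f0: "?f 0 = (\<integral>\<^sup>+r. ennreal (theta_term (1 / 2) x r) \<partial>lborel)"
    by (simp only: pochhammer_0 fact_0 div_by_1 ennreal_1 mult_1_left of_nat_0 mult_zero_right add_0_left)
  have "ennreal (exp (- 1 / (8 * x)) * (1 - 3 * x / 2)) \<le> ?f 0"
    unfolding f0 by (rule nn_integral_theta_term_ge[OF x])
  also have "\<dots> \<le> suminf ?f"
    using sum_le_suminf[of ?f "{0}"] by simp
  finally show ?thesis unfolding theta_series_def .
qed

section \<open>Two-sided bounds for the distribution function\<close>

context brownian_bridge
begin

lemma measurable_square_integral [measurable]:
  "(\<lambda>\<omega>. LINT t:{0..1}|lborel. (B t \<omega>)\<^sup>2) \<in> borel_measurable M"
  using measurable_weighted_square_integral[of "\<lambda>t. t" "\<lambda>_. 1"] by simp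

lemma square_integral_nonneg: "0 \<le> (LINT t:{0..1}|lborel. (B t \<omega>)\<^sup>2)"
  unfolding set_lebesgue_integral_def by (intro integral_nonneg_AE) (auto simp: indicator_def)

lemma measurable_prob_square_integral_le [measurable]:
  "(\<lambda>x. prob {\<omega> \<in> space M. (LINT t:{0..1}|lborel. (B t \<omega>)\<^sup>2) \<le> x}) \<in> borel_measurable borel"
  by (intro borel_measurable_mono monoI finite_measure_mono) auto

text \<open>By Fubini the transform of the distribution function at \<open>n\<close> is
  \<open>expectation (\<lambda>\<omega>. exp (- real n * Q \<omega>)) / n\<close>. Uniqueness
  compares measures, so the functions are identified only almost everywhere; the two lemmas that
  follow recover pointwise bounds.\<close>

lemma density_prob_square_integral_le:
  "density lborel (\<lambda>x. ennreal (prob {\<omega> \<in> space M. (LINT t:{0..1}|lborel. (B t \<omega>)\<^sup>2) \<le> x})) =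
   density lborel (\<lambda>x. ennreal (2 * sqrt 2 / sqrt pi) * theta_series x * indicator {0<..} x)"
proof -
  define Q where "Q \<omega> = (LINT t:{0..1}|lborel. (B t \<omega>)\<^sup>2)" for \<omega>
  define C :: real where "C = 2 * sqrt 2 / sqrt pi"
  have Qm [measurable]: "Q \<in> borel_measurable M" unfolding Q_def by measurable
  have Q0: "0 \<le> Q \<omega>" for \<omega> unfolding Q_def by (rule square_integral_nonneg)
  have E: "ennreal (prob {\<omega> \<in> space M. Q \<omega> \<le> x}) = (\<integral>\<^sup>+\<omega>. indicator {Q \<omega>..} x \<partial>M)" for x
  proof -
    have "ennreal (prob {\<omega> \<in> space M. Q \<omega> \<le> x}) = (\<integral>\<^sup>+\<omega>. indicator {\<omega> \<in> space M. Q \<omega> \<le> x} \<omega> \<partial>M)"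
      by (simp add: emeasure_eq_measure)
    also have "\<dots> = (\<integral>\<^sup>+\<omega>. indicator {Q \<omega>..} x \<partial>M)"
      by (intro nn_integral_cong) (auto simp: indicator_def)
    finally show ?thesis .
  qed
  interpret P: pair_sigma_finite M "lborel :: real measure" ..
  have ind [measurable]: "(\<lambda>(x, \<omega>). indicator {Q \<omega>..} x :: ennreal) \<in> borel_measurable (borel \<Otimes>\<^sub>M M)"
  proof -
    have "(\<lambda>(x, \<omega>). indicator {Q \<omega>..} x :: ennreal) = (\<lambda>(x, \<omega>). if Q \<omega> \<le> x then 1 else 0)"
      by (auto simp: indicator_def fun_eq_iff)
    then show ?thesis by simp
  qed
  have Em [measurable]: "(\<lambda>x. \<integral>\<^sup>+\<omega>. indicator {Q \<omega>..} x \<partial>M) \<in> borel_measurable borel"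
    by measurable
  let ?\<mu> = "density lborel (\<lambda>x. \<integral>\<^sup>+\<omega>. indicator {Q \<omega>..} x \<partial>M)"
  have lap: "(\<integral>\<^sup>+x. ennreal (exp (- real n * x)) \<partial>?\<mu>) =
      ennreal (expectation (\<lambda>\<omega>. exp (- real n * Q \<omega>)) / real n)" if n: "1 \<le> n" for n :: nat
  proof -
    have "(\<integral>\<^sup>+x. ennreal (exp (- real n * x)) \<partial>?\<mu>) =
        (\<integral>\<^sup>+x. (\<integral>\<^sup>+\<omega>. indicator {Q \<omega>..} x * ennreal (exp (- real n * x)) \<partial>M) \<partial>lborel)"
      by (simp add: nn_integral_density nn_integral_multc)
    also have "\<dots> = (\<integral>\<^sup>+\<omega>. (\<integral>\<^sup>+x. indicator {Q \<omega>..} x * ennreal (exp (- real n * x)) \<partial>lborel) \<partial>M)"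
      by (rule P.Fubini') measurable
    also have "\<dots> = (\<integral>\<^sup>+\<omega>. ennreal (exp (- real n * Q \<omega>) / real n) \<partial>M)"
    proof (rule nn_integral_cong)
      fix \<omega>
      have "(\<integral>\<^sup>+x. ennreal (exp (- real n * x)) * indicator {Q \<omega>..} x \<partial>lborel) =
          ennreal (0 - - exp (- real n * Q \<omega>) / real n)"
      proof (rule nn_integral_FTC_atLeast)
        show "((\<lambda>x. - exp (- real n * x) / real n) has_real_derivative exp (- real n * x)) (at x)" for x
          using n by (auto intro!: derivative_eq_intros)
        have "LIM x at_top. real n * x :> at_top"
          using n by (intro filterlim_tendsto_pos_mult_at_top[OF tendsto_const _ filterlim_ident]) auto
        then have "((\<lambda>x. exp (- (real n * x))) \<longlongrightarrow> 0) at_top"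
          by (intro filterlim_compose[OF exp_at_bot] filterlim_compose[OF filterlim_uminus_at_bot_at_top])
        then have "((\<lambda>x. - exp (- real n * x) / real n) \<longlongrightarrow> - 0 / real n) at_top"
          using n by (intro tendsto_divide tendsto_minus tendsto_const) auto
        then show "((\<lambda>x. - exp (- real n * x) / real n) \<longlongrightarrow> 0) at_top" by simp
      qed auto
      then show "(\<integral>\<^sup>+x. indicator {Q \<omega>..} x * ennreal (exp (- real n * x)) \<partial>lborel) =
          ennreal (exp (- real n * Q \<omega>) / real n)"
        by (simp add: mult.commute)
    qed
    also have "\<dots> = ennreal (expectation (\<lambda>\<omega>. exp (- real n * Q \<omega>) / real n))"
    proof (rule nn_integral_eq_integral)
      show "integrable M (\<lambda>\<omega>. exp (- real n * Q \<omega>) / real n)"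
        using Q0 n by (intro integrable_divide integrable_const_bound[where B=1]) auto
    qed auto
    finally show ?thesis by simp
  qed
  have "density lborel (\<lambda>x. \<integral>\<^sup>+\<omega>. indicator {Q \<omega>..} x \<partial>M) =
      density lborel (\<lambda>x. ennreal C * theta_series x * indicator {0<..} x)" (is "_ = ?\<nu>")
  proof (rule measure_eqI_laplace[where N=1])
    fix n :: nat assume n: "1 \<le> n"
    \<comment> \<open>The parameter for which \<open>exp (- (a\<^sup>2 / 2) * x)\<close> is the
      Laplace kernel at \<open>n\<close>.\<close>
    define a where "a = sqrt (2 * real n)"
    have a: "0 < a" "a\<^sup>2 / 2 = real n" using n by (auto simp: a_def)
    have "expectation (\<lambda>\<omega>. exp (- real n * Q \<omega>)) = sqrt (a / sinh a)"
      using expectation_exp_square_integral[OF a(1)] unfolding a(2) Q_def .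
    then have "(\<integral>\<^sup>+x. ennreal (exp (- real n * x)) \<partial>?\<mu>) = ennreal (sqrt (a / sinh a) / real n)"
      using lap[OF n] by simp
    also have "sqrt (a / sinh a) / real n = C * (sqrt (pi / 2) * (sqrt (a / sinh a) / a\<^sup>2))"
    proof -
      \<comment> \<open>This fixes \<open>C\<close>: dividing by \<open>n\<close> is multiplying by
        \<open>2 / a\<^sup>2\<close>.\<close>
      have "C * sqrt (pi / 2) = 2" by (simp add: C_def real_sqrt_divide)
      then have "C * (sqrt (pi / 2) * (sqrt (a / sinh a) / a\<^sup>2)) = sqrt (a / sinh a) / (a\<^sup>2 / 2)"
        by (simp add: mult.assoc[symmetric])
      then show ?thesis using a(2) by simp
    qed
    also have "ennreal \<dots> = ennreal C * ennreal (sqrt (pi / 2) * (sqrt (a / sinh a) / a\<^sup>2))"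
      using a by (intro ennreal_mult) (auto simp: C_def intro!: mult_nonneg_nonneg divide_nonneg_nonneg)
    also have "\<dots> = ennreal C * (\<integral>\<^sup>+x. ennreal (exp (- real n * x)) * theta_series x * indicator {0<..} x \<partial>lborel)"
      using nn_integral_theta_series_laplace[OF a(1)] unfolding a(2) by simp
    also have "\<dots> = (\<integral>\<^sup>+x. ennreal (exp (- real n * x)) \<partial>?\<nu>)"
      by (simp add: nn_integral_density nn_integral_cmult[symmetric] mult_ac)
    finally show "(\<integral>\<^sup>+x. ennreal (exp (- real n * x)) \<partial>?\<mu>) = (\<integral>\<^sup>+x. ennreal (exp (- real n * x)) \<partial>?\<nu>)" .
  next
    show "(\<integral>\<^sup>+x. ennreal (exp (- real 1 * x)) \<partial>?\<mu>) < \<infinity>"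
      using lap[of 1] by simp
  next
    show "AE x in ?\<mu>. 0 \<le> x"
    proof -
      have "(\<integral>\<^sup>+\<omega>. indicator {Q \<omega>..} x \<partial>M) = 0" if "x < 0" for x
        using Q0 that by (intro nn_integral_zero') (auto simp: indicator_def not_le intro!: AE_I2 elim: less_le_trans)
      then show ?thesis by (subst AE_density) (auto simp: not_less[symmetric] intro!: AE_I2)
    qed
    show "AE x in ?\<nu>. 0 \<le> x"
      by (subst AE_density) (auto simp: indicator_def intro!: AE_I2 split: if_splits)
  qed auto
  then show ?thesis unfolding E[symmetric] unfolding Q_def C_def .
qed

text \<open>The distribution function is increasing, so its value at \<open>x\<close> is at least
  its mean over \<open>{y..x}\<close>, which the almost everywhere identity turns into a mean of the
  series; then \<open>y\<close> tends to \<open>x\<close> from the left.\<close>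

lemma prob_square_integral_ge:
  assumes x: "0 < x"
  shows "2 * sqrt 2 / sqrt pi * (exp (- 1 / (8 * x)) * (1 - 3 * x / 2)) \<le>
    prob {\<omega> \<in> space M. (LINT t:{0..1}|lborel. (B t \<omega>)\<^sup>2) \<le> x}" (is "?C * _ \<le> ?p x")
proof (cases "0 \<le> 1 - 3 * x / 2")
  case False
  then have "?C * (exp (- 1 / (8 * x)) * (1 - 3 * x / 2)) \<le> 0"
    by (intro mult_nonneg_nonpos) auto
  then show ?thesis using measure_nonneg by (rule order_trans)
next
  case True
  \<comment> \<open>A lower bound valid on all of \<open>{y..x}\<close>: the exponential factor is
    taken at the left end and the linear one at the right end. Multiplying the two estimates uses
    the sign of \<open>1 - 3 * x / 2\<close>.\<close>
  define L where "L y = ?C * (exp (- 1 / (8 * y)) * (1 - 3 * x / 2))" for y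
  have le: "L y \<le> ?p x" if y: "0 < y" "y < x" for y
  proof -
    have "ennreal (L y) * ennreal (x - y) = (\<integral>\<^sup>+z. ennreal (L y) * indicator {y..x} z \<partial>lborel)"
      using y by (simp add: nn_integral_cmult)
    also have "\<dots> \<le> (\<integral>\<^sup>+z. ennreal ?C * theta_series z * indicator {0<..} z * indicator {y..x} z \<partial>lborel)"
    proof (rule nn_integral_mono)
      fix z
      show "ennreal (L y) * indicator {y..x} z \<le> ennreal ?C * theta_series z * indicator {0<..} z * indicator {y..x} z"
      proof (cases "z \<in> {y..x}")
        case z: True
        have "- 1 / (8 * y) \<le> - 1 / (8 * z)" using y z by (simp add: frac_le)
        then have "exp (- 1 / (8 * y)) * (1 - 3 * x / 2) \<le> exp (- 1 / (8 * z)) * (1 - 3 * z / 2)"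
          using z True by (intro mult_mono) auto
        then have "ennreal (exp (- 1 / (8 * y)) * (1 - 3 * x / 2)) \<le> theta_series z"
          using z y by (intro order_trans[OF ennreal_leI theta_series_ge]) auto
        then have "ennreal ?C * ennreal (exp (- 1 / (8 * y)) * (1 - 3 * x / 2)) \<le> ennreal ?C * theta_series z"
          by (rule mult_left_mono) simp
        moreover have "ennreal (L y) = ennreal ?C * ennreal (exp (- 1 / (8 * y)) * (1 - 3 * x / 2))"
          unfolding L_def using True by (intro ennreal_mult) auto
        ultimately show ?thesis using z y by simp
      qed simp
    qed
    also have "\<dots> = emeasure (density lborel (\<lambda>x. ennreal ?C * theta_series x * indicator {0<..} x)) {y..x}"
      by (simp add: emeasure_density)
    also have "\<dots> = (\<integral>\<^sup>+z. ennreal (?p z) * indicator {y..x} z \<partial>lborel)"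
      unfolding density_prob_square_integral_le[symmetric]
      by (rule emeasure_density) (auto intro: measurable_prob_square_integral_le)
    also have "\<dots> \<le> (\<integral>\<^sup>+z. ennreal (?p x) * indicator {y..x} z \<partial>lborel)"
      by (intro nn_integral_mono) (auto simp: indicator_def intro!: ennreal_leI finite_measure_mono)
    also have "\<dots> = ennreal (?p x) * ennreal (x - y)"
      using y by (simp add: nn_integral_cmult)
    finally have "ennreal (L y * (x - y)) \<le> ennreal (?p x * (x - y))"
      using y True by (subst (1 2) ennreal_mult) (auto simp: L_def)
    then have "L y * (x - y) \<le> ?p x * (x - y)"
      using y by (subst (asm) ennreal_le_iff) auto
    then show ?thesis using y by simp
  qed
  have "isCont L x" unfolding L_def using x by (intro continuous_intros) auto
  then have "(L \<longlongrightarrow> L x) (at_left x)"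
    by (auto simp: isCont_def intro: tendsto_mono[OF at_le])
  moreover have "\<forall>\<^sub>F y in at_left x. L y \<le> ?p x"
    using eventually_at_left_real[OF x] by (rule eventually_mono) (auto intro: le)
  ultimately have "L x \<le> ?p x" by (rule tendsto_upperbound) simp
  then show ?thesis unfolding L_def .
qed

text \<open>For an upper bound the mean is taken over \<open>{x..y}\<close> to the right of
  \<open>x\<close>. There the bound on the series is increasing, so its value at \<open>y\<close>
  dominates; then \<open>y\<close> decreases to \<open>x\<close>.\<close>

lemma prob_square_integral_le:
  assumes x: "0 < x"
  shows "prob {\<omega> \<in> space M. (LINT t:{0..1}|lborel. (B t \<omega>)\<^sup>2) \<le> x} \<le>
    2 * sqrt 2 / sqrt pi * (exp (- 1 / (8 * x)) / sqrt (1 - exp (- 1 / x)))" (is "?p x \<le> ?C * _")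
proof -
  define U where "U y = ?C * (exp (- 1 / (8 * y)) / sqrt (1 - exp (- 1 / y)))" for y
  have U0: "0 \<le> U y" if "0 < y" for y unfolding U_def using that by simp
  have le: "?p x \<le> U y" if y: "x < y" for y
  proof -
    have "ennreal (?p x) * ennreal (y - x) = (\<integral>\<^sup>+z. ennreal (?p x) * indicator {x..y} z \<partial>lborel)"
      using y by (simp add: nn_integral_cmult)
    also have "\<dots> \<le> (\<integral>\<^sup>+z. ennreal (?p z) * indicator {x..y} z \<partial>lborel)"
      by (intro nn_integral_mono) (auto simp: indicator_def intro!: ennreal_leI finite_measure_mono)
    also have "\<dots> = emeasure (density lborel (\<lambda>x. ennreal (?p x))) {x..y}"
      by (rule emeasure_density[symmetric]) (auto intro: measurable_prob_square_integral_le)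
    also have "\<dots> = (\<integral>\<^sup>+z. ennreal ?C * theta_series z * indicator {0<..} z * indicator {x..y} z \<partial>lborel)"
      unfolding density_prob_square_integral_le by (simp add: emeasure_density)
    also have "\<dots> \<le> (\<integral>\<^sup>+z. ennreal (U y) * indicator {x..y} z \<partial>lborel)"
    proof (rule nn_integral_mono)
      fix z
      show "ennreal ?C * theta_series z * indicator {0<..} z * indicator {x..y} z \<le> ennreal (U y) * indicator {x..y} z"
      proof (cases "z \<in> {x..y}")
        case z: True
        then have z0: "0 < z" "0 < y" using x y by auto
        have "- 1 / (8 * z) \<le> - 1 / (8 * y)" "- 1 / z \<le> - 1 / y" using z z0 by (simp_all add: frac_le)
        then have "exp (- 1 / (8 * z)) / sqrt (1 - exp (- 1 / z)) \<le> exp (- 1 / (8 * y)) / sqrt (1 - exp (- 1 / y))"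
          using z0 by (intro frac_le) auto
        then have "theta_series z \<le> ennreal (exp (- 1 / (8 * y)) / sqrt (1 - exp (- 1 / y)))"
          by (intro order_trans[OF theta_series_le[OF z0(1)] ennreal_leI])
        then have "ennreal ?C * theta_series z \<le> ennreal ?C * ennreal (exp (- 1 / (8 * y)) / sqrt (1 - exp (- 1 / y)))"
          by (rule mult_left_mono) simp
        moreover have "ennreal (U y) = ennreal ?C * ennreal (exp (- 1 / (8 * y)) / sqrt (1 - exp (- 1 / y)))"
          unfolding U_def using z0 by (intro ennreal_mult) auto
        ultimately show ?thesis using z z0 by simp
      qed simp
    qed
    also have "\<dots> = ennreal (U y) * ennreal (y - x)"
      using y by (simp add: nn_integral_cmult)
    finally have "ennreal (?p x * (y - x)) \<le> ennreal (U y * (y - x))"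
      using x y U0[of y] by (subst (1 2) ennreal_mult) auto
    then have "?p x * (y - x) \<le> U y * (y - x)"
      using x y U0[of y] by (subst (asm) ennreal_le_iff) auto
    then show ?thesis using y by simp
  qed
  have "isCont U x" unfolding U_def using x by (intro continuous_intros) auto
  then have "(U \<longlongrightarrow> U x) (at_right x)"
    by (auto simp: isCont_def intro: tendsto_mono[OF at_le])
  moreover have "\<forall>\<^sub>F y in at_right x. ?p x \<le> U y"
    using eventually_at_right_less[of x] by (rule eventually_mono) (rule le)
  ultimately have "?p x \<le> U x" by (rule tendsto_lowerbound) simp
  then show ?thesis unfolding U_def .
qed

end

section \<open>The weighted square integral\<close>

text \<open>Supplies the derivatives of \<open>b = \<psi> powr (- 1 / 4)\<close> for the
  substitution.\<close>

lemma twice_continuously_differentiable_on_powr: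
  assumes f: "twice_continuously_differentiable_on f S" and pos: "\<And>x. x \<in> S \<Longrightarrow> 0 < f x"
  shows "twice_continuously_differentiable_on (\<lambda>x. f x powr p) S"
proof -
  obtain f' f'' where f': "\<And>x. x \<in> S \<Longrightarrow> (f has_real_derivative f' x) (at x within S)"
    and f'': "\<And>x. x \<in> S \<Longrightarrow> (f' has_real_derivative f'' x) (at x within S)"
    and c: "continuous_on S f''"
    using f unfolding twice_continuously_differentiable_on_def by blast
  have d: "((\<lambda>x. f x powr q) has_real_derivative q * f x powr (q - 1) * f' x) (at x within S)" if "x \<in> S" for x q
    using DERIV_chain[OF has_real_derivative_powr[OF pos[OF that]] f'[OF that], of q] by (simp add: o_def)
  have cf: "continuous_on S f" "continuous_on S f'"
    by (rule DERIV_continuous_on[OF f'] DERIV_continuous_on[OF f''], assumption)+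
  show ?thesis
    unfolding twice_continuously_differentiable_on_def
  proof (intro exI conjI ballI)
    show "((\<lambda>x. f x powr p) has_real_derivative p * f x powr (p - 1) * f' x) (at x within S)" if "x \<in> S" for x
      by (rule d[OF that])
    show "((\<lambda>x. p * f x powr (p - 1) * f' x) has_real_derivative
        p * ((p - 1) * f x powr (p - 1 - 1) * f' x) * f' x + f'' x * (p * f x powr (p - 1))) (at x within S)" if "x \<in> S" for x
      by (intro DERIV_mult DERIV_cmult d f'' that)
    show "continuous_on S (\<lambda>x. p * ((p - 1) * f x powr (p - 1 - 1) * f' x) * f' x + f'' x * (p * f x powr (p - 1)))"
      using pos by (intro continuous_intros cf c) force+
  qed
qed

text \<open>Both laws are compared on \<open>{..x}\<close>. On the event
  \<open>\<theta>\<^sup>2 * Q \<le> x\<close> the bound on \<open>R\<close> gives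
  \<open>\<bar>R\<bar> \<le> K * x\<close>, so the density \<open>C * exp R\<close> can be replaced
  by constants at the cost of \<open>exp (K * x)\<close> and \<open>exp (- (K * x))\<close>.\<close>

lemma (in brownian_bridge) prob_weighted_square_integral_bounds:
  assumes pos: "\<And>t. t \<in> {0..1} \<Longrightarrow> \<psi> t > 0"
    and C2: "twice_continuously_differentiable_on \<psi> {0..1}"
  defines "\<theta> \<equiv> (LINT t:{0..1}|lborel. sqrt (\<psi> t))"
  defines "C \<equiv> \<psi> 0 powr (1 / 8) * \<psi> 1 powr (1 / 8) / sqrt \<theta>"
  defines "p \<equiv> \<lambda>y. prob {\<omega> \<in> space M. (LINT t:{0..1}|lborel. (B t \<omega>)\<^sup>2) \<le> y}"
  shows "0 < \<theta>"
    and "\<exists>K. \<forall>x. C * exp (- (K * x)) * p (x / \<theta>\<^sup>2) \<le>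
           prob {\<omega> \<in> space M. (LINT t:{0..1}|lborel. (B t \<omega>)\<^sup>2 * \<psi> t) \<le> x} \<and>
         prob {\<omega> \<in> space M. (LINT t:{0..1}|lborel. (B t \<omega>)\<^sup>2 * \<psi> t) \<le> x} \<le> C * exp (K * x) * p (x / \<theta>\<^sup>2)"
proof -
  obtain \<psi>' \<psi>'' where "\<And>t. t \<in> {0..1} \<Longrightarrow> (\<psi> has_real_derivative \<psi>' t) (at t within {0..1})"
    using C2 unfolding twice_continuously_differentiable_on_def by blast
  then have c\<psi>: "continuous_on {0..1} \<psi>" by (rule DERIV_continuous_on)
  define a where "a t = \<psi> t powr (1 / 4)" for t
  define b where "b t = \<psi> t powr (- 1 / 4)" for t
  have a: "continuous_on {0..1} a" unfolding a_def using pos by (intro continuous_intros c\<psi>) force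
  have a_pos: "0 < a t" if "t \<in> {0..1}" for t using pos[OF that] by (simp add: a_def)
  have b_eq: "b t = 1 / a t" for t using powr_minus_divide[of "\<psi> t" "1 / 4"] by (simp add: a_def b_def)
  have a2: "(a t)\<^sup>2 = sqrt (\<psi> t)" if "t \<in> {0..1}" for t
  proof -
    have "(a t)\<^sup>2 = \<psi> t powr (1 / 4 + 1 / 4)"
      unfolding a_def power2_eq_square by (rule powr_add[symmetric])
    also have "\<dots> = sqrt (\<psi> t)" using pos[OF that] powr_half_sqrt[of "\<psi> t"] by simp
    finally show ?thesis .
  qed
  have a4: "(a t)^4 = \<psi> t" if "t \<in> {0..1}" for t
  proof -
    have "(a t)^4 = ((a t)\<^sup>2)\<^sup>2" by simp
    then show ?thesis unfolding a2[OF that] using pos[OF that] by simp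
  qed
  obtain b' b'' where b: "\<And>t. t \<in> {0..1} \<Longrightarrow> (b has_real_derivative b' t) (at t within {0..1})"
    and b': "\<And>t. t \<in> {0..1} \<Longrightarrow> (b' has_real_derivative b'' t) (at t within {0..1})"
    and b'': "continuous_on {0..1} b''"
    using twice_continuously_differentiable_on_powr[OF C2 pos, of "- 1 / 4"]
    unfolding twice_continuously_differentiable_on_def b_def[symmetric] by blast
  have \<theta>: "\<theta> = integral {0..1} (\<lambda>t. (a t)\<^sup>2)"
  proof -
    have "\<theta> = integral {0..1} (\<lambda>t. sqrt (\<psi> t))"
      unfolding \<theta>_def by (intro LINT_Icc_eq_integral continuous_intros c\<psi>)
    also have "\<dots> = integral {0..1} (\<lambda>t. (a t)\<^sup>2)"
      by (rule integral_cong) (simp add: a2)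
    finally show ?thesis .
  qed
  show \<theta>0: "0 < \<theta>" unfolding \<theta> by (rule expectation_exp_time_change(1)[OF a a_pos b_eq b b' b''])
  define Q where "Q \<omega> = (LINT t:{0..1}|lborel. (B t \<omega>)\<^sup>2)" for \<omega>
  define Q\<psi> where "Q\<psi> \<omega> = (LINT t:{0..1}|lborel. (a t)^4 * (B t \<omega>)\<^sup>2)" for \<omega>
  have Q\<psi>: "(LINT t:{0..1}|lborel. (B t \<omega>)\<^sup>2 * \<psi> t) = Q\<psi> \<omega>" for \<omega>
    unfolding Q\<psi>_def by (intro set_lebesgue_integral_cong) (auto simp: a4 mult.commute)
  have [measurable]: "Q \<in> borel_measurable M" unfolding Q_def by measurable
  have Q0: "0 \<le> Q \<omega>" for \<omega> unfolding Q_def by (rule square_integral_nonneg)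
  have [measurable]: "Q\<psi> \<in> borel_measurable M"
    unfolding Q\<psi>_def using measurable_weighted_square_integral[of "\<lambda>t. t" "\<lambda>t. (a t)^4"]
    by (simp add: continuous_on_power[OF a])
  have Q\<psi>0: "0 \<le> Q\<psi> \<omega>" for \<omega>
    unfolding Q\<psi>_def set_lebesgue_integral_def by (intro integral_nonneg_AE) (auto simp: indicator_def)
  obtain R K0 \<gamma> where R [measurable]: "R \<in> borel_measurable M"
    and R_le0: "\<And>\<omega>. \<omega> \<in> space M \<Longrightarrow> \<bar>R \<omega>\<bar> \<le> K0 * Q \<omega>"
    and L: "\<And>l. \<gamma> \<le> l \<Longrightarrow> expectation (\<lambda>\<omega>. exp (- l * Q\<psi> \<omega>)) =
      sqrt (a 0 * a 1 / \<theta>) * expectation (\<lambda>\<omega>. exp (R \<omega> - l * (\<theta>\<^sup>2 * Q \<omega>)))"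
    using expectation_exp_time_change(2)[OF a a_pos b_eq b b' b''] unfolding \<theta>[symmetric] Q_def Q\<psi>_def by blast
  have C: "C = sqrt (a 0 * a 1 / \<theta>)"
  proof -
    have "\<psi> t powr (1 / 8) = sqrt (a t)" if "t \<in> {0..1}" for t
      using powr_half_sqrt[of "a t"] a_pos[OF that] powr_powr[of "\<psi> t" "1 / 4" "1 / 2"] by (simp add: a_def)
    then show ?thesis by (simp add: C_def real_sqrt_divide real_sqrt_mult)
  qed
  have C0: "0 \<le> C" unfolding C using a_pos[of 0] a_pos[of 1] \<theta>0 by simp
  \<comment> \<open>The bound on \<open>R\<close> is restated in terms of
    \<open>\<theta>\<^sup>2 * Q\<close>, the variable cut off at \<open>x\<close>; the absolute
    value guarantees a non-negative constant.\<close>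
  define K where "K = \<bar>K0\<bar> / \<theta>\<^sup>2"
  have K0: "0 \<le> K" by (simp add: K_def)
  have R_le: "\<bar>R \<omega>\<bar> \<le> K * (\<theta>\<^sup>2 * Q \<omega>)" if "\<omega> \<in> space M" for \<omega>
  proof -
    have "\<bar>R \<omega>\<bar> \<le> \<bar>K0\<bar> * Q \<omega>"
      using R_le0[OF that] by (rule order_trans) (intro mult_right_mono Q0 abs_ge_self)
    then show ?thesis using \<theta>0 by (simp add: K_def)
  qed
  have "distr M borel Q\<psi> = distr (density M (\<lambda>\<omega>. ennreal (C * exp (R \<omega>)))) borel (\<lambda>\<omega>. \<theta>\<^sup>2 * Q \<omega>)" (is "?\<mu> = ?\<nu>")
  proof -
    \<comment> \<open>From \<open>\<gamma>\<close> on the transforms are related, and from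
      \<open>K\<close> on the exponent \<open>R - n * \<theta>\<^sup>2 * Q\<close> is at most
      \<open>0\<close>, so its exponential is integrable.\<close>
    obtain N :: nat where N: "max \<gamma> K < real N" using reals_Archimedean2 by blast
    have lap: "(\<integral>\<^sup>+x. ennreal (exp (- real n * x)) \<partial>?\<mu>) = ennreal (expectation (\<lambda>\<omega>. exp (- real n * Q\<psi> \<omega>)))" for n
    proof -
      have "integrable M (\<lambda>\<omega>. exp (- real n * Q\<psi> \<omega>))"
        using Q\<psi>0 by (intro integrable_const_bound[where B=1]) auto
      then show ?thesis by (subst nn_integral_distr) (auto simp: nn_integral_eq_integral)
    qed
    show ?thesis
    proof (rule measure_eqI_laplace[where N=N])
      show "(\<integral>\<^sup>+x. ennreal (exp (- real N * x)) \<partial>?\<mu>) < \<infinity>" unfolding lap by simp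
      show "AE x in ?\<mu>. 0 \<le> x" using Q\<psi>0 by (subst AE_distr_iff) auto
      show "AE x in ?\<nu>. 0 \<le> x" using Q0 by (subst AE_distr_iff) auto
      fix n assume "N \<le> n"
      then have n: "\<gamma> \<le> real n" "K \<le> real n" using N by auto
      have le0: "R \<omega> - real n * (\<theta>\<^sup>2 * Q \<omega>) \<le> 0" if "\<omega> \<in> space M" for \<omega>
      proof -
        have "R \<omega> \<le> K * (\<theta>\<^sup>2 * Q \<omega>)" using R_le[OF that] by (simp add: abs_le_iff)
        also have "\<dots> \<le> real n * (\<theta>\<^sup>2 * Q \<omega>)" using n(2) Q0 by (intro mult_right_mono) auto
        finally show ?thesis by simp
      qed
      have i: "integrable M (\<lambda>\<omega>. C * exp (R \<omega> - real n * (\<theta>\<^sup>2 * Q \<omega>)))"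
        by (intro integrable_mult_right integrable_const_bound[where B=1] AE_I2) (use le0 in auto)
      have "(\<integral>\<^sup>+x. ennreal (exp (- real n * x)) \<partial>?\<nu>) = (\<integral>\<^sup>+\<omega>. ennreal (C * exp (R \<omega> - real n * (\<theta>\<^sup>2 * Q \<omega>))) \<partial>M)"
        using C0 by (subst nn_integral_distr)
          (auto simp: nn_integral_density exp_diff exp_minus divide_inverse ennreal_mult'[symmetric] mult.assoc
            intro!: nn_integral_cong)
      also have "\<dots> = ennreal (C * expectation (\<lambda>\<omega>. exp (R \<omega> - real n * (\<theta>\<^sup>2 * Q \<omega>))))"
        using C0 by (subst nn_integral_eq_integral[OF i]) auto
      also have "\<dots> = (\<integral>\<^sup>+x. ennreal (exp (- real n * x)) \<partial>?\<mu>)"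
        unfolding lap L[OF n(1)] C ..
      finally show "(\<integral>\<^sup>+x. ennreal (exp (- real n * x)) \<partial>?\<mu>) = (\<integral>\<^sup>+x. ennreal (exp (- real n * x)) \<partial>?\<nu>)" by (rule sym)
    qed auto
  qed
  then have eq: "emeasure ?\<mu> {..x} = emeasure ?\<nu> {..x}" for x by simp
  have prob_eq: "ennreal (prob {\<omega> \<in> space M. Q\<psi> \<omega> \<le> x}) =
      (\<integral>\<^sup>+\<omega>. ennreal (C * exp (R \<omega>)) * indicator {\<omega> \<in> space M. \<theta>\<^sup>2 * Q \<omega> \<le> x} \<omega> \<partial>M)" for x
  proof -
    have "ennreal (prob {\<omega> \<in> space M. Q\<psi> \<omega> \<le> x}) = emeasure ?\<mu> {..x}"
      by (subst emeasure_distr) (auto simp: emeasure_eq_measure vimage_def Int_def conj_commute)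
    also have "\<dots> = emeasure (density M (\<lambda>\<omega>. ennreal (C * exp (R \<omega>)))) {\<omega> \<in> space M. \<theta>\<^sup>2 * Q \<omega> \<le> x}"
      unfolding eq by (subst emeasure_distr) (auto simp: vimage_def Int_def conj_commute)
    also have "\<dots> = (\<integral>\<^sup>+\<omega>. ennreal (C * exp (R \<omega>)) * indicator {\<omega> \<in> space M. \<theta>\<^sup>2 * Q \<omega> \<le> x} \<omega> \<partial>M)"
      by (rule emeasure_density) auto
    finally show ?thesis .
  qed
  have p: "p (x / \<theta>\<^sup>2) = prob {\<omega> \<in> space M. \<theta>\<^sup>2 * Q \<omega> \<le> x}" for x
    using \<theta>0 by (simp add: p_def Q_def field_simps)
  have nn_const: "(\<integral>\<^sup>+\<omega>. ennreal c * indicator {\<omega> \<in> space M. \<theta>\<^sup>2 * Q \<omega> \<le> x} \<omega> \<partial>M) = ennreal (c * p (x / \<theta>\<^sup>2))"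
    if "0 \<le> c" for c x
    using that unfolding p by (simp add: nn_integral_cmult emeasure_eq_measure ennreal_mult)
  have R_x: "R \<omega> \<le> K * x" "- (K * x) \<le> R \<omega>" if "\<omega> \<in> space M" "\<theta>\<^sup>2 * Q \<omega> \<le> x" for \<omega> x
    using R_le[OF that(1)] mult_left_mono[OF that(2) K0] by linarith+
  have lower: "C * exp (- (K * x)) * p (x / \<theta>\<^sup>2) \<le> prob {\<omega> \<in> space M. Q\<psi> \<omega> \<le> x}" for x
  proof -
    have "ennreal (C * exp (- (K * x)) * p (x / \<theta>\<^sup>2)) \<le> ennreal (prob {\<omega> \<in> space M. Q\<psi> \<omega> \<le> x})"
      unfolding prob_eq using C0 R_x[of _ x]
      by (subst nn_const[symmetric])
        (auto intro!: nn_integral_mono ennreal_leI mult_left_mono simp: indicator_def)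
    then show ?thesis by (subst (asm) ennreal_le_iff) auto
  qed
  have upper: "prob {\<omega> \<in> space M. Q\<psi> \<omega> \<le> x} \<le> C * exp (K * x) * p (x / \<theta>\<^sup>2)" for x
  proof -
    have "ennreal (prob {\<omega> \<in> space M. Q\<psi> \<omega> \<le> x}) \<le> ennreal (C * exp (K * x) * p (x / \<theta>\<^sup>2))"
      unfolding prob_eq using C0 R_x[of _ x]
      by (subst nn_const[symmetric])
        (auto intro!: nn_integral_mono ennreal_leI mult_left_mono simp: indicator_def)
    then show ?thesis using C0 by (subst (asm) ennreal_le_iff) (auto simp: p_def)
  qed
  show "\<exists>K. \<forall>x. C * exp (- (K * x)) * p (x / \<theta>\<^sup>2) \<le>
           prob {\<omega> \<in> space M. (LINT t:{0..1}|lborel. (B t \<omega>)\<^sup>2 * \<psi> t) \<le> x} \<and>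
         prob {\<omega> \<in> space M. (LINT t:{0..1}|lborel. (B t \<omega>)\<^sup>2 * \<psi> t) \<le> x} \<le> C * exp (K * x) * p (x / \<theta>\<^sup>2)"
    unfolding Q\<psi> using lower upper by blast
qed

section \<open>Conclusion: the small ball asymptotics\<close>

theorem theorem2:
  fixes M :: "'a measure" and B :: "real \<Rightarrow> 'a \<Rightarrow> real" and \<psi> :: "real \<Rightarrow> real" and \<theta> :: real
  assumes psi_pos: "\<And>t. t \<in> {0..1} \<Longrightarrow> \<psi> t > 0"
    and psi_C2: "twice_continuously_differentiable_on \<psi> {0..1}"
    and theta: "\<theta> = (LINT t:{0..1}|lborel. sqrt (\<psi> t))"
    and bridge: "brownian_bridge M B"
  shows "(\<lambda>\<epsilon>. measure M {\<omega> \<in> space M. weighted_norm \<psi> (\<lambda>t. B t \<omega>) \<le> \<epsilon>})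
           \<sim>[at_right 0]
         (\<lambda>\<epsilon>. 2 * sqrt 2 * \<psi> 0 powr (1/8) * \<psi> 1 powr (1/8) / sqrt (pi * \<theta>)
                * exp (- (\<theta>\<^sup>2 / 8) * \<epsilon> powi (-2)))"
proof -
  interpret brownian_bridge M B by (rule bridge)
  define C where "C = \<psi> 0 powr (1 / 8) * \<psi> 1 powr (1 / 8) / sqrt \<theta>"
  define p where "p y = prob {\<omega> \<in> space M. (LINT t:{0..1}|lborel. (B t \<omega>)\<^sup>2) \<le> y}" for y
  define P where "P \<epsilon> = prob {\<omega> \<in> space M. weighted_norm \<psi> (\<lambda>t. B t \<omega>) \<le> \<epsilon>}" for \<epsilon>
  \<comment> \<open>The level for the unweighted integral that corresponds to radius
    \<open>\<epsilon>\<close>.\<close>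
  define y where "y \<epsilon> = \<epsilon>\<^sup>2 / \<theta>\<^sup>2" for \<epsilon>
  define D :: real where "D = 2 * sqrt 2 / sqrt pi"
  define g where "g \<epsilon> = C * (D * exp (- 1 / (8 * y \<epsilon>)))" for \<epsilon>
  have \<theta>0: "0 < \<theta>" unfolding theta by (rule prob_weighted_square_integral_bounds(1)[OF psi_pos psi_C2])
  have C0: "0 < C" using psi_pos[of 0] psi_pos[of 1] \<theta>0 by (simp add: C_def)
  have D0: "0 < D" by (simp add: D_def)
  obtain K where K: "\<And>x. C * exp (- (K * x)) * p (x / \<theta>\<^sup>2) \<le>
           prob {\<omega> \<in> space M. (LINT t:{0..1}|lborel. (B t \<omega>)\<^sup>2 * \<psi> t) \<le> x}"
    "\<And>x. prob {\<omega> \<in> space M. (LINT t:{0..1}|lborel. (B t \<omega>)\<^sup>2 * \<psi> t) \<le> x} \<le> C * exp (K * x) * p (x / \<theta>\<^sup>2)"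
    using prob_weighted_square_integral_bounds(2)[OF psi_pos psi_C2] unfolding theta[symmetric] C_def p_def by blast
  have P: "P \<epsilon> = prob {\<omega> \<in> space M. (LINT t:{0..1}|lborel. (B t \<omega>)\<^sup>2 * \<psi> t) \<le> \<epsilon>\<^sup>2}" if "0 < \<epsilon>" for \<epsilon>
  proof -
    have "sqrt u \<le> \<epsilon> \<longleftrightarrow> u \<le> \<epsilon>\<^sup>2" for u using that real_sqrt_le_iff[of u "\<epsilon>\<^sup>2"] by simp
    then show ?thesis unfolding P_def weighted_norm_def by simp
  qed
  have y0: "0 < y \<epsilon>" if "0 < \<epsilon>" for \<epsilon> using that \<theta>0 by (simp add: y_def)
  have lower: "exp (- (K * \<epsilon>\<^sup>2)) * (1 - 3 * y \<epsilon> / 2) \<le> P \<epsilon> / g \<epsilon>" if "0 < \<epsilon>" for \<epsilon>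
  proof -
    have "C * exp (- (K * \<epsilon>\<^sup>2)) * (D * (exp (- 1 / (8 * y \<epsilon>)) * (1 - 3 * y \<epsilon> / 2))) \<le> C * exp (- (K * \<epsilon>\<^sup>2)) * p (y \<epsilon>)"
      using prob_square_integral_ge[OF y0[OF that]] C0 unfolding D_def p_def by (intro mult_left_mono) auto
    also have "\<dots> \<le> P \<epsilon>" using K(1)[of "\<epsilon>\<^sup>2"] unfolding P[OF that] y_def .
    finally have "exp (- (K * \<epsilon>\<^sup>2)) * (1 - 3 * y \<epsilon> / 2) * g \<epsilon> \<le> P \<epsilon>"
      unfolding g_def by (simp only: mult_ac)
    moreover have "0 < g \<epsilon>" using C0 D0 by (simp add: g_def)
    ultimately show ?thesis by (simp add: pos_le_divide_eq)
  qed
  have upper: "P \<epsilon> / g \<epsilon> \<le> exp (K * \<epsilon>\<^sup>2) / sqrt (1 - exp (- 1 / y \<epsilon>))" if "0 < \<epsilon>" for \<epsilon>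
  proof -
    have "P \<epsilon> \<le> C * exp (K * \<epsilon>\<^sup>2) * p (y \<epsilon>)" using K(2)[of "\<epsilon>\<^sup>2"] unfolding P[OF that] y_def .
    also have "\<dots> \<le> C * exp (K * \<epsilon>\<^sup>2) * (D * (exp (- 1 / (8 * y \<epsilon>)) / sqrt (1 - exp (- 1 / y \<epsilon>))))"
      using prob_square_integral_le[OF y0[OF that]] C0 unfolding D_def p_def by (intro mult_left_mono) auto
    also have "\<dots> = exp (K * \<epsilon>\<^sup>2) / sqrt (1 - exp (- 1 / y \<epsilon>)) * g \<epsilon>"
      unfolding g_def by simp
    finally show ?thesis using C0 D0 by (simp add: g_def pos_divide_le_eq)
  qed
  have \<epsilon>_lim: "((\<lambda>\<epsilon>. \<epsilon>\<^sup>2) \<longlongrightarrow> 0) (at_right (0::real))"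
    using tendsto_power[OF tendsto_ident_at[of "0::real" "{0<..}"], of 2] by simp
  have y_lim: "(y \<longlongrightarrow> 0) (at_right 0)"
    unfolding y_def using tendsto_divide[OF \<epsilon>_lim tendsto_const[of "\<theta>\<^sup>2"]] \<theta>0 by simp
  have "LIM \<epsilon> at_right 0. inverse (y \<epsilon>) :> at_top"
    by (rule filterlim_inverse_at_top[OF y_lim]) (auto simp: eventually_at_filter y0)
  then have "((\<lambda>\<epsilon>. exp (- inverse (y \<epsilon>))) \<longlongrightarrow> 0) (at_right 0)"
    by (intro filterlim_compose[OF exp_at_bot] filterlim_compose[OF filterlim_uminus_at_bot_at_top])
  then have e_lim: "((\<lambda>\<epsilon>. exp (- 1 / y \<epsilon>)) \<longlongrightarrow> 0) (at_right 0)"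
    by (simp add: divide_inverse)
  \<comment> \<open>The errors from \<open>R\<close>, from the first term of the series and from the
    other terms all tend to factors \<open>1\<close>, as \<open>\<epsilon>\<^sup>2\<close>,
    \<open>y \<epsilon>\<close> and \<open>exp (- 1 / y \<epsilon>)\<close> tend to
    \<open>0\<close>.\<close>
  have "((\<lambda>\<epsilon>. P \<epsilon> / g \<epsilon>) \<longlongrightarrow> 1) (at_right 0)"
  proof (rule tendsto_sandwich)
    show "\<forall>\<^sub>F \<epsilon> in at_right 0. exp (- (K * \<epsilon>\<^sup>2)) * (1 - 3 * y \<epsilon> / 2) \<le> P \<epsilon> / g \<epsilon>"
      using eventually_at_right_less[of "0::real"] by (rule eventually_mono) (rule lower)
    show "\<forall>\<^sub>F \<epsilon> in at_right 0. P \<epsilon> / g \<epsilon> \<le> exp (K * \<epsilon>\<^sup>2) / sqrt (1 - exp (- 1 / y \<epsilon>))"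
      using eventually_at_right_less[of "0::real"] by (rule eventually_mono) (rule upper)
    have "((\<lambda>\<epsilon>. exp (- (K * \<epsilon>\<^sup>2)) * (1 - 3 * y \<epsilon> / 2)) \<longlongrightarrow> exp (- (K * 0)) * (1 - 3 * 0 / 2)) (at_right 0)"
      by (intro tendsto_intros \<epsilon>_lim y_lim) auto
    then show "((\<lambda>\<epsilon>. exp (- (K * \<epsilon>\<^sup>2)) * (1 - 3 * y \<epsilon> / 2)) \<longlongrightarrow> 1) (at_right 0)" by simp
    have "((\<lambda>\<epsilon>. exp (K * \<epsilon>\<^sup>2) / sqrt (1 - exp (- 1 / y \<epsilon>))) \<longlongrightarrow> exp (K * 0) / sqrt (1 - 0)) (at_right 0)"
      by (intro tendsto_divide tendsto_real_sqrt tendsto_diff tendsto_const tendsto_exp tendsto_mult \<epsilon>_lim e_lim) auto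
    then show "((\<lambda>\<epsilon>. exp (K * \<epsilon>\<^sup>2) / sqrt (1 - exp (- 1 / y \<epsilon>))) \<longlongrightarrow> 1) (at_right 0)" by simp
  qed
  then have "P \<sim>[at_right 0] g" by (rule asymp_equivI')
  also have "g = (\<lambda>\<epsilon>. 2 * sqrt 2 * \<psi> 0 powr (1/8) * \<psi> 1 powr (1/8) / sqrt (pi * \<theta>)
                * exp (- (\<theta>\<^sup>2 / 8) * \<epsilon> powi (-2)))"
  proof
    fix \<epsilon> :: real
    \<comment> \<open>The functions are equal at every real argument; at \<open>0\<close> both
      exponents are \<open>0\<close>, by division by zero.\<close>
    have "\<epsilon> powi (-2) = 1 / \<epsilon>\<^sup>2"
      using power_int_minus[of \<epsilon> 2] by (simp add: inverse_eq_divide)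
    then have e: "- 1 / (8 * y \<epsilon>) = - (\<theta>\<^sup>2 / 8) * \<epsilon> powi (-2)"
      by (simp add: y_def)
    show "g \<epsilon> = 2 * sqrt 2 * \<psi> 0 powr (1/8) * \<psi> 1 powr (1/8) / sqrt (pi * \<theta>)
                * exp (- (\<theta>\<^sup>2 / 8) * \<epsilon> powi (-2))"
      unfolding g_def e C_def D_def real_sqrt_mult by (simp only: times_divide_times_eq times_divide_eq_left times_divide_eq_right divide_divide_eq_left mult_ac)
  qed
  finally show ?thesis unfolding P_def .
qed

end
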